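(* Let $1\le d_1<\cdots<d_r\le n+1$ be integers. The odd symplectic flag manifold $\mathbb{F}_\omega(d_1,\dots,d_r,E)$ is a smooth subvariety of codimension $\frac12 d_r(d_r-1)$ in the flag manifold $\mathbb{F}(d_1,\dots,d_r,E)$.
   Context: $E$ is a complex vector space of dimension $2n+1$ and $\omega\in\Lambda^2E^*$ is a skew-form on $E$ of maximal rank $2n$. A subspace $V\subset E$ is isotropic if $\omega|_{V\times V}=0$. $\mathbb{F}(d_1,\dots,d_r,E)$ is the variety of flags $(V_{d_1}\subset\cdots\subset V_{d_r}\subset E)$ with $\dim V_{d_i}=d_i$. $\mathbb{F}_\omega(d_1,\dots,d_r,E)$ is its closed subvariety of flags all of whose members $V_{d_i}$ are isotropic. *)

theory Defs
  imports "HOL-Analysis.Analysis" "HOL-Library.Function_Algebras"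
begin

section \<open>Classical varieties as spaces with functions\<close>

text \<open>
  A complex variety in the classical sense is a Zariski topological space together with, for every
  open set, the regular complex-valued functions on it.  Functions are total in HOL; membership in
  \<open>reg X U\<close> only constrains the values on \<open>U\<close> and is only meaningful for \<open>U\<close> open.
\<close>

record 'a fspace =
  zar :: "'a topology"
  reg :: "'a set \<Rightarrow> ('a \<Rightarrow> complex) set"

text \<open>
  \<open>P\<close> is a locally closed subset of an affine space and \<open>A\<close> its ring of polynomial functions.
  The principal open sets generate the topology, and a function is regular if it is locally a
  quotient of polynomials.
\<close>

definition quasi_affine :: "'a set \<Rightarrow> ('a \<Rightarrow> complex) set \<Rightarrow> 'a fspace" where
  "quasi_affine P A =
    (let T = topology_generated_by {{x \<in> P. f x \<noteq> 0} | f. f \<in> A}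
     in \<lparr> zar = T,
          reg = (\<lambda>U. {f. \<forall>x\<in>U. \<exists>g\<in>A. \<exists>h\<in>A. \<exists>W. openin T W \<and> x \<in> W \<and> W \<subseteq> U \<and>
                        (\<forall>y\<in>W. h y \<noteq> 0 \<and> f y = g y / h y)}) \<rparr>)"

text \<open>The structure induced on a locally closed subset: regular functions extend locally to \<open>X\<close>.\<close>

definition sub_fspace :: "'a fspace \<Rightarrow> 'a set \<Rightarrow> 'a fspace" where
  "sub_fspace X Z =
    \<lparr> zar = subtopology (zar X) Z,
      reg = (\<lambda>U. {f. \<forall>x\<in>U. \<exists>W. \<exists>g\<in>reg X W. openin (zar X) W \<and> x \<in> W \<and>
                    (\<forall>y \<in> W \<inter> U. f y = g y)}) \<rparr>"

text \<open>The quotient structure on \<open>Y\<close> along a surjection \<open>p\<close> from the points of \<open>X\<close> onto \<open>Y\<close>.\<close>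

definition quotient_fspace :: "'a fspace \<Rightarrow> ('a \<Rightarrow> 'b) \<Rightarrow> 'b set \<Rightarrow> 'b fspace" where
  "quotient_fspace X p Y =
    \<lparr> zar = topology (\<lambda>U. U \<subseteq> Y \<and> openin (zar X) {x \<in> topspace (zar X). p x \<in> U}),
      reg = (\<lambda>U. {f. f \<circ> p \<in> reg X {x \<in> topspace (zar X). p x \<in> U}}) \<rparr>"

lemma openin_quotient_fspace:
  "openin (zar (quotient_fspace X p Y)) U \<longleftrightarrow>
    U \<subseteq> Y \<and> openin (zar X) {x \<in> topspace (zar X). p x \<in> U}"
proof -
  have "istopology (\<lambda>U. U \<subseteq> Y \<and> openin (zar X) {x \<in> topspace (zar X). p x \<in> U})"
    unfolding istopology_def
  proof (intro conjI allI impI)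
    fix S T
    assume S: "S \<subseteq> Y \<and> openin (zar X) {x \<in> topspace (zar X). p x \<in> S}"
      and T: "T \<subseteq> Y \<and> openin (zar X) {x \<in> topspace (zar X). p x \<in> T}"
    show "S \<inter> T \<subseteq> Y" using S by blast
    have "{x \<in> topspace (zar X). p x \<in> S \<inter> T} =
        {x \<in> topspace (zar X). p x \<in> S} \<inter> {x \<in> topspace (zar X). p x \<in> T}" by blast
    then show "openin (zar X) {x \<in> topspace (zar X). p x \<in> S \<inter> T}"
      using S T by (metis (no_types, lifting) openin_Int)
  next
    fix K
    assume K: "\<forall>S\<in>K. S \<subseteq> Y \<and> openin (zar X) {x \<in> topspace (zar X). p x \<in> S}"
    then show "\<Union>K \<subseteq> Y" by blast
    have "{x \<in> topspace (zar X). p x \<in> \<Union>K} =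
        (\<Union>S\<in>K. {x \<in> topspace (zar X). p x \<in> S})" by blast
    then show "openin (zar X) {x \<in> topspace (zar X). p x \<in> \<Union>K}"
      using K by auto
  qed
  then show ?thesis by (simp add: quotient_fspace_def)
qed

definition iso_fspace :: "'a fspace \<Rightarrow> 'b fspace \<Rightarrow> ('a \<Rightarrow> 'b) \<Rightarrow> bool" where
  "iso_fspace X Y p \<longleftrightarrow>
    homeomorphic_map (zar X) (zar Y) p \<and>
    (\<forall>U f. openin (zar Y) U \<longrightarrow>
       (f \<in> reg Y U \<longleftrightarrow> f \<circ> p \<in> reg X {x \<in> topspace (zar X). p x \<in> U}))"


section \<open>Polynomial functions and smoothness\<close>

text \<open>
  The polynomial functions on \<open>E^d\<close>, a point of which is a list of \<open>d\<close> vectors, are the algebra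
  generated by the linear forms on the factors.  The values on lists of other lengths are
  irrelevant.  The case \<open>E = \<complex>\<close> gives the polynomial functions on affine \<open>d\<close>-space.
\<close>

inductive_set poly_funs ::
    "(complex \<Rightarrow> 'e::ab_group_add \<Rightarrow> 'e) \<Rightarrow> nat \<Rightarrow> ('e list \<Rightarrow> complex) set"
  for scl :: "complex \<Rightarrow> 'e::ab_group_add \<Rightarrow> 'e" and d :: nat where
  const: "(\<lambda>_. c) \<in> poly_funs scl d"
| coord: "Vector_Spaces.linear scl (*) \<phi> \<Longrightarrow> i < d \<Longrightarrow> (\<lambda>v. \<phi> (v ! i)) \<in> poly_funs scl d"
| add: "f \<in> poly_funs scl d \<Longrightarrow> g \<in> poly_funs scl d \<Longrightarrow> (\<lambda>v. f v + g v) \<in> poly_funs scl d"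
| mult: "f \<in> poly_funs scl d \<Longrightarrow> g \<in> poly_funs scl d \<Longrightarrow> (\<lambda>v. f v * g v) \<in> poly_funs scl d"

abbreviation affine_polys :: "nat \<Rightarrow> (complex list \<Rightarrow> complex) set" where
  "affine_polys k \<equiv> poly_funs (*) k"

definition partial :: "nat \<Rightarrow> (complex list \<Rightarrow> complex) \<Rightarrow> complex list \<Rightarrow> complex" where
  "partial i f x = deriv (\<lambda>t. f (x[i := t])) (x ! i)"

text \<open>
  A standard smooth affine variety of dimension \<open>k - r\<close>: the points of affine \<open>k\<close>-space with
  \<open>h \<noteq> 0\<close> and \<open>F 0 = \<dots> = F (r - 1) = 0\<close>, where the Jacobian of \<open>F\<close> has rank \<open>r\<close> at all of them.
  The Jacobian condition makes the ideal of the \<open>F j\<close> radical where \<open>h \<noteq> 0\<close>, so that the structure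
  as a space with functions is the scheme structure.
\<close>

definition std_locus ::
    "nat \<Rightarrow> nat \<Rightarrow> (complex list \<Rightarrow> complex) \<Rightarrow> (nat \<Rightarrow> complex list \<Rightarrow> complex) \<Rightarrow> complex list set" where
  "std_locus k r h F = {x. length x = k \<and> h x \<noteq> 0 \<and> (\<forall>j<r. F j x = 0)}"

definition std_smooth ::
    "nat \<Rightarrow> nat \<Rightarrow> (complex list \<Rightarrow> complex) \<Rightarrow> (nat \<Rightarrow> complex list \<Rightarrow> complex) \<Rightarrow> bool" where
  "std_smooth k r h F \<longleftrightarrow>
    h \<in> affine_polys k \<and> (\<forall>j<r. F j \<in> affine_polys k) \<and>
    (\<forall>x \<in> std_locus k r h F. \<forall>a.
       (\<forall>i<k. (\<Sum>j<r. a j * partial i (F j) x) = 0) \<longrightarrow> (\<forall>j<r. a j = 0))"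

text \<open>Smooth of pure dimension \<open>m\<close>: locally isomorphic to a standard smooth variety.\<close>

definition smooth_of_dim :: "'a fspace \<Rightarrow> nat \<Rightarrow> bool" where
  "smooth_of_dim X m \<longleftrightarrow>
    (\<forall>x \<in> topspace (zar X). \<exists>U k r h F p.
       openin (zar X) U \<and> x \<in> U \<and> k = m + r \<and> std_smooth k r h F \<and>
       iso_fspace (sub_fspace X U) (quasi_affine (std_locus k r h F) (affine_polys k)) p)"

definition irreducible_space :: "'a topology \<Rightarrow> bool" where
  "irreducible_space T \<longleftrightarrow>
    topspace T \<noteq> {} \<and>
    (\<forall>U V. openin T U \<and> openin T V \<and> U \<noteq> {} \<and> V \<noteq> {} \<longrightarrow> U \<inter> V \<noteq> {})"

text \<open>
  Subvarieties are closed and irreducible and carry the induced structure; the codimension is the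
  difference of the dimensions.
\<close>

definition smooth_subvariety_of_codim :: "'a fspace \<Rightarrow> 'a set \<Rightarrow> nat \<Rightarrow> bool" where
  "smooth_subvariety_of_codim X Z c \<longleftrightarrow>
    closedin (zar X) Z \<and> irreducible_space (zar (sub_fspace X Z)) \<and>
    (\<exists>m. smooth_of_dim X (m + c) \<and> smooth_of_dim (sub_fspace X Z) m)"


section \<open>Flag varieties\<close>

definition flags :: "(complex \<Rightarrow> 'e::ab_group_add \<Rightarrow> 'e) \<Rightarrow> nat list \<Rightarrow> 'e set list set" where
  "flags scl ds =
    {Vs. length Vs = length ds \<and> sorted_wrt (\<subseteq>) Vs \<and>
         (\<forall>i<length ds. module.subspace scl (Vs ! i) \<and> vector_space.dim scl (Vs ! i) = ds ! i)}"

definition frames :: "(complex \<Rightarrow> 'e::ab_group_add \<Rightarrow> 'e) \<Rightarrow> nat \<Rightarrow> 'e list set" where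
  "frames scl d = {v. length v = d \<and> distinct v \<and> \<not> module.dependent scl (set v)}"

definition flag_of_frame ::
    "(complex \<Rightarrow> 'e::ab_group_add \<Rightarrow> 'e) \<Rightarrow> nat list \<Rightarrow> 'e list \<Rightarrow> 'e set list" where
  "flag_of_frame scl ds v = map (\<lambda>d. module.span scl (set (take d v))) ds"

text \<open>
  For increasing \<open>ds\<close> with last entry \<open>d\<close>, the flag variety is the geometric quotient of the Stiefel
  variety of \<open>d\<close>-frames, open in \<open>E^d\<close>, by the parabolic subgroup of \<open>GL d\<close> of block triangular
  matrices.  This is the variety structure of \<open>GL(E)/P\<close>, and also the one given by the Pluecker
  embedding.
\<close>

definition flag_variety ::
    "(complex \<Rightarrow> 'e::ab_group_add \<Rightarrow> 'e) \<Rightarrow> nat list \<Rightarrow> 'e set list fspace" where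
  "flag_variety scl ds =
    quotient_fspace (quasi_affine (frames scl (last ds)) (poly_funs scl (last ds)))
      (flag_of_frame scl ds) (flags scl ds)"


section \<open>Skew-forms and isotropic flags\<close>

definition skew_form ::
    "(complex \<Rightarrow> 'e::ab_group_add \<Rightarrow> 'e) \<Rightarrow> ('e \<Rightarrow> 'e \<Rightarrow> complex) \<Rightarrow> bool" where
  "skew_form scl \<omega> \<longleftrightarrow>
    (\<forall>x. Vector_Spaces.linear scl (*) (\<omega> x)) \<and>
    (\<forall>y. Vector_Spaces.linear scl (*) (\<lambda>x. \<omega> x y)) \<and>
    (\<forall>x y. \<omega> x y = - \<omega> y x)"

text \<open>The rank of the map from \<open>E\<close> to its dual, whose image lies in the space of functions on \<open>E\<close>.\<close>

definition form_rank :: "('e \<Rightarrow> 'e \<Rightarrow> complex) \<Rightarrow> nat" where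
  "form_rank \<omega> = vector_space.dim (\<lambda>c f x. c * f x) (range \<omega>)"

definition isotropic :: "('e \<Rightarrow> 'e \<Rightarrow> complex) \<Rightarrow> 'e set \<Rightarrow> bool" where
  "isotropic \<omega> V \<longleftrightarrow> (\<forall>x\<in>V. \<forall>y\<in>V. \<omega> x y = 0)"

definition isotropic_flags ::
    "(complex \<Rightarrow> 'e::ab_group_add \<Rightarrow> 'e) \<Rightarrow> ('e \<Rightarrow> 'e \<Rightarrow> complex) \<Rightarrow> nat list \<Rightarrow> 'e set list set" where
  "isotropic_flags scl \<omega> ds = {Vs \<in> flags scl ds. \<forall>V\<in>set Vs. isotropic \<omega> V}"

end

theory Submission
  imports Defs "Jordan_Normal_Form.Determinant"
begin

text \<open>
  A flag is isotropic as soon as its largest member \<open>V\<close> is, so with \<open>d = last ds\<close> the isotropic flags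
  are cut out by the \<open>d (d - 1) / 2\<close> equations \<open>\<omega> v\<^sub>i v\<^sub>j = 0\<close> for \<open>i < j\<close> in a frame of \<open>V\<close>.  The point is
  that these equations are independent at every isotropic flag, also where \<open>V\<close> contains the kernel of
  \<open>\<omega>\<close>.  The proof solves them explicitly, in coordinates adapted to the flag.

  Let \<open>e\<close> be a basis of \<open>E\<close> whose initial segments span the members of the flag.  The flags that are
  transverse to the spans of the final segments form an open set.  Each of them has a unique frame of
  the form \<open>u\<cdot>g\<close>, where \<open>g\<^sub>i = e\<^sub>i + \<Sum>\<^sub>j y\<^sub>i\<^sub>j e\<^sub>j\<close> (with \<open>j \<ge> d\<close>) describes \<open>V\<close> as a graph and \<open>u\<close> is block
  unipotent.  The entries of \<open>u\<close> and the \<open>y\<^sub>i\<^sub>j\<close> are regular functions by Cramer's rule, and the frame is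
  polynomial in them, so the open set is an affine space (\<open>chart_iso\<close>).  The entries of \<open>u\<close> do not
  enter the condition that \<open>V\<close> is isotropic.

  At an isotropic flag the basis can be chosen so that every \<open>e\<^sub>i\<close> with \<open>i < d\<close> outside the kernel has a
  dual vector among the later basis vectors, which is orthogonal to all other basis vectors
  (\<open>isotropic_chart_exists\<close>).  As \<open>\<omega>\<close> has maximal rank, at most one of the \<open>e\<^sub>i\<close> spans the kernel.  Then
  \<open>\<omega> g\<^sub>i g\<^sub>j = 0\<close> says that a difference of two coordinates, or a single one if \<open>e\<^sub>j\<close> spans the kernel,
  equals a quadratic polynomial in coordinates of a different kind.  Each equation is solved for its
  own coordinate (\<open>isotropic_graph_iff\<close>), so that the isotropic flags in the chart form an affine
  space of dimension smaller by \<open>d (d - 1) / 2\<close> (\<open>isotropic_chart_iso\<close>).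

  Affine spaces are irreducible, and a space that is covered by irreducible open sets is irreducible
  if it is connected.  Connectedness is shown by exchange: any two isotropic frames are joined by a
  chain in which consecutive ones lie on a line of isotropic tuples (\<open>isotropic_frames_chain\<close>).
  Isotropic flags exist because \<open>d \<le> n + 1\<close> (\<open>isotropic_frame_exists\<close>).
\<close>

section \<open>Polynomial functions\<close>

definition fun_algebra :: "('a \<Rightarrow> complex) set \<Rightarrow> bool" where
  "fun_algebra A \<longleftrightarrow> (\<forall>c. (\<lambda>_. c) \<in> A) \<and>
     (\<forall>f\<in>A. \<forall>g\<in>A. (\<lambda>x. f x + g x) \<in> A \<and> (\<lambda>x. f x * g x) \<in> A)"

lemma fun_algebra_poly_funs: "fun_algebra (poly_funs scl d)"
  by (auto simp: fun_algebra_def intro: poly_funs.intros)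

lemma fun_algebra_const: "fun_algebra A \<Longrightarrow> (\<lambda>_. c) \<in> A"
  and fun_algebra_add: "fun_algebra A \<Longrightarrow> f \<in> A \<Longrightarrow> g \<in> A \<Longrightarrow> (\<lambda>x. f x + g x) \<in> A"
  and fun_algebra_mult: "fun_algebra A \<Longrightarrow> f \<in> A \<Longrightarrow> g \<in> A \<Longrightarrow> (\<lambda>x. f x * g x) \<in> A"
  by (auto simp: fun_algebra_def)

lemma fun_algebra_sum:
  assumes "fun_algebra A" "\<And>i. i \<in> I \<Longrightarrow> f i \<in> A"
  shows "(\<lambda>x. \<Sum>i\<in>I. f i x) \<in> A"
  using assms(2)
  by (induction I rule: infinite_finite_induct)
     (auto intro: fun_algebra_const[OF assms(1)] fun_algebra_add[OF assms(1)])

lemma fun_algebra_prod: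
  assumes "fun_algebra A" "\<And>i. i \<in> I \<Longrightarrow> f i \<in> A"
  shows "(\<lambda>x. \<Prod>i\<in>I. f i x) \<in> A"
  using assms(2)
  by (induction I rule: infinite_finite_induct)
     (auto intro: fun_algebra_const[OF assms(1)] fun_algebra_mult[OF assms(1)])

lemma fun_algebra_minus:
  assumes "fun_algebra A" "f \<in> A" "g \<in> A"
  shows "(\<lambda>x. f x - g x) \<in> A"
  using fun_algebra_add[OF assms(1,2) fun_algebra_mult[OF assms(1) fun_algebra_const[OF assms(1), of "-1"] assms(3)]]
  by simp

lemma affine_coord: "i < m \<Longrightarrow> (\<lambda>x. x ! i) \<in> affine_polys m"
proof -
  have "Vector_Spaces.linear (*) (*) (\<lambda>x::complex. x)"
    by (unfold Vector_Spaces.linear_iff, unfold_locales) (auto simp: algebra_simps vector_space_def)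
  then show "i < m \<Longrightarrow> (\<lambda>x. x ! i) \<in> affine_polys m"
    using poly_funs.coord[of "(*)" "\<lambda>x. x" i m] by simp
qed

lemma vector_space_complex: "vector_space ((*) :: complex \<Rightarrow> complex \<Rightarrow> complex)"
  by unfold_locales (auto simp: algebra_simps)

definition line_point ::
    "(complex \<Rightarrow> 'e::ab_group_add \<Rightarrow> 'e) \<Rightarrow> 'e list \<Rightarrow> 'e list \<Rightarrow> complex \<Rightarrow> 'e list" where
  "line_point scl v w t = map (\<lambda>i. v ! i + scl t (w ! i - v ! i)) [0..<length v]"

lemma poly_on_line:
  assumes f: "f \<in> poly_funs scl d" and v: "length v = d"
  shows "\<exists>q. \<forall>t. f (line_point scl v w t) = poly q t"
  using f
proof induction
  case (const c)
  show ?case by (rule exI[of _ "[:c:]"]) simp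
next
  case (coord \<phi> i)
  have "\<phi> (line_point scl v w t ! i) = poly [:\<phi> (v ! i), \<phi> (w ! i - v ! i):] t" for t
    using coord v by (simp add: line_point_def Vector_Spaces.linear_iff)
  then show ?case by blast
next
  case (add f g)
  then show ?case by (metis poly_add)
next
  case (mult f g)
  then show ?case by (metis poly_mult)
qed

text \<open>
  A line through two points is irreducible: its nonzero polynomial functions have finitely many
  zeros.
\<close>

lemma nonzero_on_line:
  assumes scl: "vector_space scl"
    and f: "f \<in> poly_funs scl d" and g: "g \<in> poly_funs scl d"
    and v: "length v = d" and w: "length w = d" and fv: "f v \<noteq> 0" and gw: "g w \<noteq> 0"
  shows "\<exists>t. f (line_point scl v w t) \<noteq> 0 \<and> g (line_point scl v w t) \<noteq> 0"
proof -
  interpret vector_space scl by fact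
  obtain q where q: "\<And>t. f (line_point scl v w t) = poly q t" using poly_on_line[OF f v] by blast
  obtain r where r: "\<And>t. g (line_point scl v w t) = poly r t" using poly_on_line[OF g v] by blast
  have "line_point scl v w 0 = v" "line_point scl v w 1 = w"
    using v w by (auto simp: line_point_def intro!: nth_equalityI)
  then have "q \<noteq> 0" "r \<noteq> 0" using q[of 0] r[of 1] fv gw by auto
  then have "finite ({t. poly q t = 0} \<union> {t. poly r t = 0})" by (simp add: poly_roots_finite)
  then obtain t where "t \<notin> {t. poly q t = 0} \<union> {t. poly r t = 0}"
    using infinite_UNIV_char_0 ex_new_if_finite by blast
  then show ?thesis using q r by auto
qed

section \<open>Subspaces and quotients of quasi-affine spaces\<close>

lemma openin_quasi_affine:
  assumes A: "fun_algebra A"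
  shows "openin (zar (quasi_affine P A)) U \<longleftrightarrow>
    U \<subseteq> P \<and> (\<forall>x\<in>U. \<exists>f\<in>A. f x \<noteq> 0 \<and> {y \<in> P. f y \<noteq> 0} \<subseteq> U)" (is "?l \<longleftrightarrow> ?r")
proof -
  let ?S = "{{x \<in> P. f x \<noteq> 0} | f. f \<in> A}"
  have zar: "zar (quasi_affine P A) = topology_generated_by ?S"
    by (simp add: quasi_affine_def Let_def)
  show ?thesis
  proof
    assume ?l
    then have "generate_topology_on ?S U" by (simp add: zar openin_topology_generated_by_iff)
    then show ?r
    proof induction
      case Empty
      then show ?case by simp
    next
      case (Int U V)
      show ?case
      proof (intro conjI ballI)
        show "U \<inter> V \<subseteq> P" using Int by blast
        fix x assume "x \<in> U \<inter> V"
        then obtain f g where fg: "f \<in> A" "f x \<noteq> 0" "{y \<in> P. f y \<noteq> 0} \<subseteq> U"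
          "g \<in> A" "g x \<noteq> 0" "{y \<in> P. g y \<noteq> 0} \<subseteq> V" using Int.IH by (meson IntE)
        then show "\<exists>f\<in>A. f x \<noteq> 0 \<and> {y \<in> P. f y \<noteq> 0} \<subseteq> U \<inter> V"
          by (intro bexI[of _ "\<lambda>x. f x * g x"]) (auto intro: fun_algebra_mult[OF A])
      qed
    next
      case (UN K)
      then show ?case by (meson Union_iff Union_least Union_upper order_trans)
    next
      case (Basis s)
      then show ?case by auto
    qed
  next
    assume r: ?r
    let ?K = "{V. V \<subseteq> U \<and> (\<exists>f\<in>A. V = {y \<in> P. f y \<noteq> 0})}"
    have "U \<subseteq> \<Union>?K"
    proof
      fix x assume x: "x \<in> U"
      then obtain f where f: "f \<in> A" "f x \<noteq> 0" "{y \<in> P. f y \<noteq> 0} \<subseteq> U" using r by metis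
      then have "x \<in> {y \<in> P. f y \<noteq> 0}" "{y \<in> P. f y \<noteq> 0} \<in> ?K" using x r by auto
      then show "x \<in> \<Union>?K" by (rule UnionI[rotated])
    qed
    then have "U = \<Union>?K" by auto
    moreover have "openin (topology_generated_by ?S) (\<Union>?K)"
      by (intro openin_Union) (auto intro!: topology_generated_by_Basis)
    ultimately show ?l using zar by metis
  qed
qed

lemma openin_principal:
  assumes "fun_algebra A" "f \<in> A"
  shows "openin (zar (quasi_affine P A)) {x \<in> P. f x \<noteq> 0}"
  unfolding openin_quasi_affine[OF assms(1)] using assms(2) by blast

lemma topspace_quasi_affine: "fun_algebra A \<Longrightarrow> topspace (zar (quasi_affine P A)) = P"
proof -
  assume A: "fun_algebra A"
  have "openin (zar (quasi_affine P A)) P"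
    using openin_principal[OF A fun_algebra_const[OF A, of 1], of P] by simp
  moreover have "topspace (zar (quasi_affine P A)) \<subseteq> P"
    by (rule conjunct1[OF openin_quasi_affine[OF A, THEN iffD1, OF openin_topspace]])
  ultimately show ?thesis by (simp add: openin_subset subset_antisym)
qed

lemma reg_quasi_affine:
  "f \<in> reg (quasi_affine P A) U \<longleftrightarrow> (\<forall>x\<in>U. \<exists>g\<in>A. \<exists>h\<in>A. \<exists>W.
     openin (zar (quasi_affine P A)) W \<and> x \<in> W \<and> W \<subseteq> U \<and> (\<forall>y\<in>W. h y \<noteq> 0 \<and> f y = g y / h y))"
  by (simp add: quasi_affine_def Let_def)

lemma reg_quasi_affine_restrict:
  assumes "f \<in> reg (quasi_affine P A) U" "V \<subseteq> U" "openin (zar (quasi_affine P A)) V"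
  shows "f \<in> reg (quasi_affine P A) V"
  unfolding reg_quasi_affine
proof
  fix x assume x: "x \<in> V"
  then obtain g h W where "g \<in> A" "h \<in> A" "openin (zar (quasi_affine P A)) W" "x \<in> W" "W \<subseteq> U"
    "\<forall>y\<in>W. h y \<noteq> 0 \<and> f y = g y / h y" using assms(1,2) unfolding reg_quasi_affine by (meson subsetD)
  then show "\<exists>g\<in>A. \<exists>h\<in>A. \<exists>W. openin (zar (quasi_affine P A)) W \<and> x \<in> W \<and> W \<subseteq> V \<and>
      (\<forall>y\<in>W. h y \<noteq> 0 \<and> f y = g y / h y)"
    using x assms(3) by (intro bexI[of _ g] bexI[of _ h] exI[of _ "W \<inter> V"]) auto
qed

definition restrictable :: "'a fspace \<Rightarrow> bool" where
  "restrictable X \<longleftrightarrow> (\<forall>U V f. f \<in> reg X U \<and> V \<subseteq> U \<and> openin (zar X) U \<and> openin (zar X) V \<longrightarrow> f \<in> reg X V)"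

lemma restrictable_quotient: "restrictable (quotient_fspace (quasi_affine P A) p Y)"
  unfolding restrictable_def openin_quotient_fspace
  by (auto simp: quotient_fspace_def intro: reg_quasi_affine_restrict)

lemma zar_sub_fspace: "zar (sub_fspace X Z) = subtopology (zar X) Z"
  by (simp add: sub_fspace_def)

lemma reg_sub_fspace: "f \<in> reg (sub_fspace X Z) U \<longleftrightarrow>
  (\<forall>x\<in>U. \<exists>W. \<exists>g\<in>reg X W. openin (zar X) W \<and> x \<in> W \<and> (\<forall>y \<in> W \<inter> U. f y = g y))"
  by (simp add: sub_fspace_def)

lemma zar_sub_sub: "zar (sub_fspace (sub_fspace X Z) W) = zar (sub_fspace X (Z \<inter> W))"
  by (simp add: zar_sub_fspace subtopology_subtopology)

text \<open>
  A function on a subspace of \<open>Z\<close> extends locally to \<open>Z\<close>, and this extension again extends to \<open>X\<close>, but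
  only over a smaller neighbourhood.  This is where functions on \<open>X\<close> have to restrict to smaller open
  sets.
\<close>

lemma reg_sub_sub:
  assumes X: "restrictable X" and V: "V \<subseteq> Z"
  shows "f \<in> reg (sub_fspace (sub_fspace X Z) W) V \<longleftrightarrow> f \<in> reg (sub_fspace X (Z \<inter> W)) V"
    (is "?l \<longleftrightarrow> ?r")
proof
  assume l: ?l
  show ?r unfolding reg_sub_fspace
  proof
    fix x assume x: "x \<in> V"
    then obtain W1 g where g: "g \<in> reg (sub_fspace X Z) W1" "openin (zar (sub_fspace X Z)) W1" "x \<in> W1"
      "\<forall>y\<in>W1 \<inter> V. f y = g y" using l unfolding reg_sub_fspace[of f "sub_fspace X Z"] by meson
    obtain W2 where W2: "openin (zar X) W2" "W1 = W2 \<inter> Z"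
      using g(2) by (auto simp: zar_sub_fspace openin_subtopology)
    obtain W3 g3 where g3: "g3 \<in> reg X W3" "openin (zar X) W3" "x \<in> W3" "\<forall>y\<in>W3 \<inter> W1. g y = g3 y"
      using g(1,3) unfolding reg_sub_fspace by meson
    have "openin (zar X) (W2 \<inter> W3)" using W2 g3 by blast
    moreover have "g3 \<in> reg X (W2 \<inter> W3)"
      using X g3(1,2) calculation unfolding restrictable_def by (meson Int_lower2)
    ultimately show "\<exists>W. \<exists>g\<in>reg X W. openin (zar X) W \<and> x \<in> W \<and> (\<forall>y\<in>W \<inter> V. f y = g y)"
      using W2 g3 g x V by (intro exI[of _ "W2 \<inter> W3"] bexI[of _ g3]) auto
  qed
next
  assume r: ?r
  show ?l unfolding reg_sub_fspace[of f "sub_fspace X Z"]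
  proof
    fix x assume x: "x \<in> V"
    then obtain W1 g where g: "g \<in> reg X W1" "openin (zar X) W1" "x \<in> W1" "\<forall>y\<in>W1 \<inter> V. f y = g y"
      using r unfolding reg_sub_fspace by meson
    have "g \<in> reg (sub_fspace X Z) (W1 \<inter> Z)" unfolding reg_sub_fspace using g by blast
    moreover have "openin (zar (sub_fspace X Z)) (W1 \<inter> Z)"
      using g by (auto simp: zar_sub_fspace openin_subtopology)
    ultimately show "\<exists>W. \<exists>g\<in>reg (sub_fspace X Z) W. openin (zar (sub_fspace X Z)) W \<and> x \<in> W \<and>
        (\<forall>y\<in>W \<inter> V. f y = g y)"
      using x V g by (intro exI[of _ "W1 \<inter> Z"] bexI[of _ g]) auto
  qed
qed

text \<open>
  The charts below are isomorphisms from subspaces of the flag variety, whereas smoothness of a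
  subvariety \<open>Z\<close> asks for isomorphisms from subspaces of \<open>Z\<close>.
\<close>

lemma iso_fspace_sub_sub:
  assumes X: "restrictable X" and iso: "iso_fspace (sub_fspace X (Z \<inter> W)) Y p"
  shows "iso_fspace (sub_fspace (sub_fspace X Z) W) Y p"
  using iso unfolding iso_fspace_def zar_sub_sub
  by (subst reg_sub_sub[OF X]) (auto simp: zar_sub_fspace)

text \<open>
  Both the quotient topology and the quotient functions are tested on the polynomial section \<open>\<sigma>\<close> of
  the quotient map over \<open>T\<close>, so \<open>\<sigma>\<close> pulls them back to the affine space.  In the other direction,
  polynomials in the chart coordinates \<open>p\<close> become quotients of functions in \<open>A\<close>.  Functions on the
  subspace \<open>T\<close> are those that extend to open sets of \<open>X\<close>, which is why the coordinates are assumed to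
  be defined and regular on the open set \<open>U\<close> around \<open>T\<close>.
\<close>

lemma quotient_chart:
  fixes \<pi> :: "'a \<Rightarrow> 'b" and p :: "'b \<Rightarrow> complex list"
  assumes X_def: "X = quotient_fspace (quasi_affine P A) \<pi> Y"
    and A: "fun_algebra A" and U: "openin (zar X) U" and T: "T \<subseteq> U"
    and sec: "\<And>x. length x = m \<Longrightarrow> \<sigma> x \<in> P \<and> \<pi> (\<sigma> x) \<in> T \<and> p (\<pi> (\<sigma> x)) = x"
    and pull: "\<And>f. f \<in> A \<Longrightarrow> (\<lambda>x. f (\<sigma> x)) \<in> affine_polys m"
    and inv: "\<And>z. z \<in> T \<Longrightarrow> \<pi> (\<sigma> (p z)) = z"
    and len: "\<And>z. z \<in> U \<Longrightarrow> length (p z) = m"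
    and rat: "\<And>i. i < m \<Longrightarrow>
      \<exists>g\<in>A. \<exists>h\<in>A. \<forall>v\<in>P. \<pi> v \<in> U \<longrightarrow> h v \<noteq> 0 \<and> p (\<pi> v) ! i = g v / h v"
  shows "iso_fspace (sub_fspace X T) (quasi_affine {x. length x = m} (affine_polys m)) p"
proof -
  define Q where "Q = quasi_affine {x::complex list. length x = m} (affine_polys m)"
  define S where "S = quasi_affine P A"
  note algm = fun_algebra_poly_funs[of "(*)" m]
  have tQ: "topspace (zar Q) = {x. length x = m}" unfolding Q_def by (rule topspace_quasi_affine[OF algm])
  have tS: "topspace (zar S) = P" unfolding S_def by (rule topspace_quasi_affine[OF A])
  have opX: "openin (zar X) V \<longleftrightarrow> V \<subseteq> Y \<and> openin (zar S) {v \<in> P. \<pi> v \<in> V}" for V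
    unfolding X_def openin_quotient_fspace S_def[symmetric] tS ..
  have rgX: "f \<in> reg X V \<longleftrightarrow> f \<circ> \<pi> \<in> reg S {v \<in> P. \<pi> v \<in> V}" for f V
    unfolding X_def quotient_fspace_def S_def[symmetric] tS by simp
  have opS: "openin (zar S) V \<longleftrightarrow> V \<subseteq> P \<and> (\<forall>x\<in>V. \<exists>f\<in>A. f x \<noteq> 0 \<and> {y \<in> P. f y \<noteq> 0} \<subseteq> V)" for V
    unfolding S_def by (rule openin_quasi_affine[OF A])
  have opQ: "openin (zar Q) V \<longleftrightarrow> V \<subseteq> {x. length x = m} \<and> (\<forall>x\<in>V. \<exists>f\<in>affine_polys m. f x \<noteq> 0 \<and>
      {y \<in> {x. length x = m}. f y \<noteq> 0} \<subseteq> V)" for V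
    unfolding Q_def by (rule openin_quasi_affine[OF algm])
  have UY: "U \<subseteq> Y" and Uop: "openin (zar S) {v \<in> P. \<pi> v \<in> U}" using U by (auto simp: opX)
  have tT: "topspace (zar (sub_fspace X T)) = T"
    using T openin_subset[OF U] by (auto simp: zar_sub_fspace)
  have pull_p: "\<exists>g\<in>A. \<exists>h\<in>A. \<forall>v\<in>P. \<pi> v \<in> U \<longrightarrow> h v \<noteq> 0 \<and> f (p (\<pi> v)) = g v / h v"
    if "f \<in> affine_polys m" for f
    using that
  proof induction
    case (const c)
    show ?case
      by (intro bexI[OF _ fun_algebra_const[OF A, of c]] bexI[OF _ fun_algebra_const[OF A, of 1]]) simp
  next
    case (coord \<phi> i)
    obtain g h where gh: "g \<in> A" "h \<in> A" "\<forall>v\<in>P. \<pi> v \<in> U \<longrightarrow> h v \<noteq> 0 \<and> p (\<pi> v) ! i = g v / h v"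
      using rat[OF coord(2)] by blast
    define c where "c = \<phi> 1"
    have "\<phi> x = x * c" for x using coord(1) unfolding c_def
      by (metis (no_types, opaque_lifting) Vector_Spaces.linear_iff mult.right_neutral)
    then show ?case using gh
      by (intro bexI[of _ "\<lambda>v. g v * c"] bexI[of _ h])
         (auto intro!: fun_algebra_mult[OF A] fun_algebra_const[OF A])
  next
    case (add f f')
    then obtain g h g' h' where "g \<in> A" "h \<in> A" "\<forall>v\<in>P. \<pi> v \<in> U \<longrightarrow> h v \<noteq> 0 \<and> f (p (\<pi> v)) = g v / h v"
      "g' \<in> A" "h' \<in> A" "\<forall>v\<in>P. \<pi> v \<in> U \<longrightarrow> h' v \<noteq> 0 \<and> f' (p (\<pi> v)) = g' v / h' v" by blast
    then show ?case
      by (intro bexI[of _ "\<lambda>v. g v * h' v + g' v * h v"] bexI[of _ "\<lambda>v. h v * h' v"])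
         (auto simp: add_frac_eq intro!: fun_algebra_mult[OF A] fun_algebra_add[OF A])
  next
    case (mult f f')
    then obtain g h g' h' where "g \<in> A" "h \<in> A" "\<forall>v\<in>P. \<pi> v \<in> U \<longrightarrow> h v \<noteq> 0 \<and> f (p (\<pi> v)) = g v / h v"
      "g' \<in> A" "h' \<in> A" "\<forall>v\<in>P. \<pi> v \<in> U \<longrightarrow> h' v \<noteq> 0 \<and> f' (p (\<pi> v)) = g' v / h' v" by blast
    then show ?case
      by (intro bexI[of _ "\<lambda>v. g v * g' v"] bexI[of _ "\<lambda>v. h v * h' v"])
         (auto intro!: fun_algebra_mult[OF A])
  qed
  have p_cont: "openin (zar X) {z \<in> U. p z \<in> V}" if V: "openin (zar Q) V" for V
    unfolding opX opS
  proof (intro conjI ballI)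
    show "{z \<in> U. p z \<in> V} \<subseteq> Y" using UY by blast
    show "{v \<in> P. \<pi> v \<in> {z \<in> U. p z \<in> V}} \<subseteq> P" by blast
    fix v assume "v \<in> {v \<in> P. \<pi> v \<in> {z \<in> U. p z \<in> V}}"
    then have v: "v \<in> P" "\<pi> v \<in> U" "p (\<pi> v) \<in> V" by auto
    then obtain f where f: "f \<in> affine_polys m" "f (p (\<pi> v)) \<noteq> 0"
      "{y \<in> {x. length x = m}. f y \<noteq> 0} \<subseteq> V" using V unfolding opQ by blast
    obtain g h where gh: "g \<in> A" "h \<in> A" "\<forall>v\<in>P. \<pi> v \<in> U \<longrightarrow> h v \<noteq> 0 \<and> f (p (\<pi> v)) = g v / h v"
      using pull_p[OF f(1)] by blast
    obtain k where k: "k \<in> A" "k v \<noteq> 0" "{y \<in> P. k y \<noteq> 0} \<subseteq> {v \<in> P. \<pi> v \<in> U}"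
      using Uop v unfolding opS by blast
    show "\<exists>f\<in>A. f v \<noteq> 0 \<and> {y \<in> P. f y \<noteq> 0} \<subseteq> {v \<in> P. \<pi> v \<in> {z \<in> U. p z \<in> V}}"
    proof (intro bexI[of _ "\<lambda>v. k v * g v"] conjI)
      show "k v * g v \<noteq> 0" using k f gh v by auto
      show "{y \<in> P. k y * g y \<noteq> 0} \<subseteq> {v \<in> P. \<pi> v \<in> {z \<in> U. p z \<in> V}}"
        using k f(3) gh len by force
    qed (use k gh A in \<open>auto intro: fun_algebra_mult\<close>)
  qed
  have \<sigma>_cont: "openin (zar Q) {x. length x = m \<and> \<sigma> x \<in> W}" if W: "openin (zar S) W" for W
    unfolding opQ
  proof (intro conjI ballI)
    fix x assume "x \<in> {x. length x = m \<and> \<sigma> x \<in> W}"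
    then obtain f where "f \<in> A" "f (\<sigma> x) \<noteq> 0" "{y \<in> P. f y \<noteq> 0} \<subseteq> W" using W unfolding opS by blast
    then show "\<exists>f\<in>affine_polys m. f x \<noteq> 0 \<and> {y \<in> {x. length x = m}. f y \<noteq> 0} \<subseteq> {x. length x = m \<and> \<sigma> x \<in> W}"
      using sec pull by (intro bexI[of _ "\<lambda>x. f (\<sigma> x)"]) auto
  qed auto
  have bij: "bij_betw p T {x. length x = m}"
    by (rule bij_betw_byWitness[where f' = "\<lambda>x. \<pi> (\<sigma> x)"]) (use sec inv len T in auto)
  have opT: "openin (zar (sub_fspace X T)) V \<longleftrightarrow> (\<exists>W. openin (zar X) W \<and> V = W \<inter> T)" for V
    by (simp add: zar_sub_fspace openin_subtopology)
  have cont: "openin (zar (sub_fspace X T)) {z \<in> T. p z \<in> V}" if V: "openin (zar Q) V" for V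
    unfolding opT using p_cont[OF V] T by blast
  have opn: "openin (zar Q) (p ` V)" if "openin (zar (sub_fspace X T)) V" for V
  proof -
    obtain W where W: "openin (zar X) W" "V = W \<inter> T" using \<open>openin _ V\<close> unfolding opT by blast
    have "p ` V = {x. length x = m \<and> \<sigma> x \<in> {v \<in> P. \<pi> v \<in> W}}"
    proof (intro equalityI subsetI)
      fix x assume "x \<in> p ` V"
      then obtain z where z: "z \<in> T" "z \<in> W" "x = p z" using W by blast
      then have "length x = m" using len T by blast
      then show "x \<in> {x. length x = m \<and> \<sigma> x \<in> {v \<in> P. \<pi> v \<in> W}}" using z sec inv by auto
    next
      fix x assume x: "x \<in> {x. length x = m \<and> \<sigma> x \<in> {v \<in> P. \<pi> v \<in> W}}"
      then have "x = p (\<pi> (\<sigma> x))" "\<pi> (\<sigma> x) \<in> W \<inter> T" using sec by auto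
      then show "x \<in> p ` V" using W(2) by blast
    qed
    then show ?thesis using \<sigma>_cont[of "{v \<in> P. \<pi> v \<in> W}"] W(1) unfolding opX by simp
  qed
  have homeo: "homeomorphic_map (zar (sub_fspace X T)) (zar Q) p"
    using bijective_open_imp_homeomorphic_map[of "zar (sub_fspace X T)" "zar Q" p] cont opn bij
    by (auto simp: continuous_map_def open_map_def tT tQ bij_betw_def)
  have "f \<in> reg Q V \<longleftrightarrow> f \<circ> p \<in> reg (sub_fspace X T) {z \<in> T. p z \<in> V}" (is "?l \<longleftrightarrow> ?r")
    if V: "openin (zar Q) V" for V f
  proof
    assume l: ?l
    show ?r unfolding reg_sub_fspace
    proof
      fix z assume "z \<in> {z \<in> T. p z \<in> V}"
      then have z: "z \<in> T" "p z \<in> V" by auto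
      obtain g h W where gh: "g \<in> affine_polys m" "h \<in> affine_polys m" "openin (zar Q) W" "p z \<in> W" "W \<subseteq> V"
        and fgh: "\<forall>y\<in>W. h y \<noteq> 0 \<and> f y = g y / h y"
        using l z(2) unfolding Q_def reg_quasi_affine by meson
      obtain g1 h1 where 1: "g1 \<in> A" "h1 \<in> A" "\<forall>v\<in>P. \<pi> v \<in> U \<longrightarrow> h1 v \<noteq> 0 \<and> g (p (\<pi> v)) = g1 v / h1 v"
        using pull_p[OF gh(1)] by blast
      obtain g2 h2 where 2: "g2 \<in> A" "h2 \<in> A" "\<forall>v\<in>P. \<pi> v \<in> U \<longrightarrow> h2 v \<noteq> 0 \<and> h (p (\<pi> v)) = g2 v / h2 v"
        using pull_p[OF gh(2)] by blast
      let ?W = "{z \<in> U. p z \<in> W}"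
      have W: "openin (zar X) ?W" by (rule p_cont[OF gh(3)])
      have "f \<circ> p \<in> reg X ?W"
        unfolding rgX S_def reg_quasi_affine
      proof (rule ballI, rule bexI[of _ "\<lambda>v. g1 v * h2 v"], rule bexI[of _ "\<lambda>v. h1 v * g2 v"],
          intro exI[of _ "{v \<in> P. \<pi> v \<in> ?W}"] conjI)
        show "openin (zar (quasi_affine P A)) {v \<in> P. \<pi> v \<in> ?W}"
          using W unfolding opX S_def by blast
        show "\<forall>y\<in>{v \<in> P. \<pi> v \<in> ?W}. h1 y * g2 y \<noteq> 0 \<and> (f \<circ> p \<circ> \<pi>) y = g1 y * h2 y / (h1 y * g2 y)"
        proof
          fix y assume "y \<in> {v \<in> P. \<pi> v \<in> ?W}"
          then have "h (p (\<pi> y)) \<noteq> 0" "f (p (\<pi> y)) = g (p (\<pi> y)) / h (p (\<pi> y))"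
            "h1 y \<noteq> 0" "h2 y \<noteq> 0" "h (p (\<pi> y)) = g2 y / h2 y" "g (p (\<pi> y)) = g1 y / h1 y"
            using fgh 1 2 by auto
          then show "h1 y * g2 y \<noteq> 0 \<and> (f \<circ> p \<circ> \<pi>) y = g1 y * h2 y / (h1 y * g2 y)" by auto
        qed
      qed (use 1 2 A in \<open>auto intro: fun_algebra_mult\<close>)
      then show "\<exists>W. \<exists>g\<in>reg X W. openin (zar X) W \<and> z \<in> W \<and> (\<forall>y\<in>W \<inter> {z \<in> T. p z \<in> V}. (f \<circ> p) y = g y)"
        using W z T gh(4) by (intro exI[of _ ?W] bexI[of _ "f \<circ> p"]) auto
    qed
  next
    assume r: ?r
    show ?l unfolding Q_def reg_quasi_affine
    proof
      fix x assume x: "x \<in> V"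
      then have lx: "length x = m" using V by (auto simp: opQ)
      define z where "z = \<pi> (\<sigma> x)"
      have z: "z \<in> T" "p z = x" using sec lx by (auto simp: z_def)
      then have "z \<in> {z \<in> T. p z \<in> V}" using x by simp
      from bspec[OF r[unfolded reg_sub_fspace] this]
      obtain W G where W: "openin (zar X) W" "G \<in> reg X W" "z \<in> W"
        and "\<forall>y\<in>W \<inter> {z \<in> T. p z \<in> V}. (f \<circ> p) y = G y"
        by (elim exE bexE conjE)
      then have fG: "\<forall>y\<in>W \<inter> {z \<in> T. p z \<in> V}. f (p y) = G y" by simp
      have "\<sigma> x \<in> {v \<in> P. \<pi> v \<in> W}" using W z sec lx by (auto simp: z_def)
      then obtain g h W' where gh: "g \<in> A" "h \<in> A" "openin (zar S) W'" "\<sigma> x \<in> W'" "W' \<subseteq> {v \<in> P. \<pi> v \<in> W}"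
        "\<forall>y\<in>W'. h y \<noteq> 0 \<and> (G \<circ> \<pi>) y = g y / h y"
        using W(2) unfolding rgX S_def reg_quasi_affine by meson
      let ?V = "V \<inter> {x. length x = m \<and> \<sigma> x \<in> W'}"
      show "\<exists>g\<in>affine_polys m. \<exists>h\<in>affine_polys m. \<exists>W.
          openin (zar (quasi_affine {x. length x = m} (affine_polys m))) W \<and> x \<in> W \<and> W \<subseteq> V \<and>
          (\<forall>y\<in>W. h y \<noteq> 0 \<and> f y = g y / h y)"
      proof (rule bexI[OF _ pull[OF gh(1)]], rule bexI[OF _ pull[OF gh(2)]], intro exI[of _ ?V] conjI)
        show "openin (zar (quasi_affine {x. length x = m} (affine_polys m))) ?V"
          using \<sigma>_cont[OF gh(3)] V unfolding Q_def by blast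
        show "\<forall>y\<in>?V. h (\<sigma> y) \<noteq> 0 \<and> f y = g (\<sigma> y) / h (\<sigma> y)"
        proof
          fix y assume y: "y \<in> ?V"
          then have "\<pi> (\<sigma> y) \<in> W \<inter> {z \<in> T. p z \<in> V}" "p (\<pi> (\<sigma> y)) = y" using gh(5) sec by auto
          then have "f y = G (\<pi> (\<sigma> y))" using fG by metis
          then show "h (\<sigma> y) \<noteq> 0 \<and> f y = g (\<sigma> y) / h (\<sigma> y)" using gh(6) y by auto
        qed
      qed (use x lx gh in auto)
    qed
  qed
  then show ?thesis using homeo unfolding iso_fspace_def Q_def[symmetric] tT by blast
qed

lemma std_locus_affine: "std_locus m 0 (\<lambda>_. 1) F = {x. length x = m}"
  by (auto simp: std_locus_def)

lemma std_smooth_affine: "std_smooth m 0 (\<lambda>_. 1) F"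
  by (auto simp: std_smooth_def intro: poly_funs.const)

lemma smooth_of_dim_if_affine_charts:
  assumes "\<And>x. x \<in> topspace (zar X) \<Longrightarrow> \<exists>U p. openin (zar X) U \<and> x \<in> U \<and>
    iso_fspace (sub_fspace X U) (quasi_affine {x. length x = m} (affine_polys m)) p"
  shows "smooth_of_dim X m"
  unfolding smooth_of_dim_def
proof
  fix x assume "x \<in> topspace (zar X)"
  then obtain U p where U: "openin (zar X) U" "x \<in> U"
    "iso_fspace (sub_fspace X U) (quasi_affine {x. length x = m} (affine_polys m)) p"
    using assms by blast
  show "\<exists>U k r h F p. openin (zar X) U \<and> x \<in> U \<and> k = m + r \<and> std_smooth k r h F \<and>
       iso_fspace (sub_fspace X U) (quasi_affine (std_locus k r h F) (affine_polys k)) p"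
    using U std_smooth_affine[of m] std_locus_affine[of m]
    by (intro exI[of _ U] exI[of _ m] exI[of _ "0::nat"] exI[of _ "\<lambda>_. 1"] exI[of _ "\<lambda>_ _. 0"] exI[of _ p])
       auto
qed

section \<open>Irreducibility\<close>

text \<open>
  Restricted to the line through a point of \<open>U\<close> and a point of \<open>V\<close>, both sets are cofinite.
\<close>

lemma affine_space_irreducible:
  assumes "openin (zar (quasi_affine {x. length x = m} (affine_polys m))) U"
    and "openin (zar (quasi_affine {x. length x = m} (affine_polys m))) V"
    and "U \<noteq> {}" "V \<noteq> {}"
  shows "U \<inter> V \<noteq> {}"
proof -
  note op = openin_quasi_affine[OF fun_algebra_poly_funs[of "(*)" m]]
  obtain v w where vw: "v \<in> U" "w \<in> V" using assms(3,4) by blast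
  obtain f where f: "f \<in> affine_polys m" "f v \<noteq> 0" "{y \<in> {x. length x = m}. f y \<noteq> 0} \<subseteq> U"
    using assms(1) vw(1) unfolding op by blast
  obtain g where g: "g \<in> affine_polys m" "g w \<noteq> 0" "{y \<in> {x. length x = m}. g y \<noteq> 0} \<subseteq> V"
    using assms(2) vw(2) unfolding op by blast
  have vw': "length v = m" "length w = m" using assms(1,2) vw unfolding op by auto
  obtain t where "f (line_point (*) v w t) \<noteq> 0" "g (line_point (*) v w t) \<noteq> 0"
    using nonzero_on_line[OF vector_space_complex f(1) g(1) vw' f(2) g(2)] by blast
  moreover have "length (line_point (*) v w t) = m" using vw' by (simp add: line_point_def)
  ultimately show ?thesis using f(3) g(3) by blast
qed

lemma irreducible_if_affine_chart:
  assumes iso: "iso_fspace (sub_fspace Y N) (quasi_affine {x. length x = m} (affine_polys m)) p"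
    and UV: "openin (zar Y) U" "openin (zar Y) V" "U \<subseteq> N" "V \<subseteq> N" "U \<noteq> {}" "V \<noteq> {}"
  shows "U \<inter> V \<noteq> {}"
proof -
  let ?Q = "quasi_affine {x. length x = m} (affine_polys m)"
  have h: "homeomorphic_map (subtopology (zar Y) N) (zar ?Q) p"
    using iso by (simp add: iso_fspace_def zar_sub_fspace)
  have op: "openin (subtopology (zar Y) N) U" "openin (subtopology (zar Y) N) V"
    using UV by (auto simp: openin_subtopology)
  then have "openin (zar ?Q) (p ` U)" "openin (zar ?Q) (p ` V)"
    using homeomorphic_imp_open_map[OF h] by (auto simp: open_map_def)
  then have "p ` U \<inter> p ` V \<noteq> {}" by (rule affine_space_irreducible) (use UV in auto)
  then obtain u v where uv: "u \<in> U" "v \<in> V" "p u = p v" by blast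
  have "u \<in> topspace (subtopology (zar Y) N)" "v \<in> topspace (subtopology (zar Y) N)"
    using uv op openin_subset by blast+
  then have "u = v" using uv(3) homeomorphic_imp_injective_map[OF h] by (simp add: inj_on_def)
  then show ?thesis using uv by blast
qed

text \<open>
  Among irreducible open sets, to meet is a transitive relation.  If any two points are joined by a
  chain whose steps cannot be separated by open sets, it follows that the irreducible neighbourhoods
  of any two points meet, and then so do all nonempty open sets.
\<close>

lemma irreducible_space_if_chain_connected:
  assumes ne: "topspace T \<noteq> {}"
    and cover: "\<And>x. x \<in> topspace T \<Longrightarrow> \<exists>N. openin T N \<and> x \<in> N \<and>
        (\<forall>U V. openin T U \<and> openin T V \<and> U \<subseteq> N \<and> V \<subseteq> N \<and> U \<noteq> {} \<and> V \<noteq> {} \<longrightarrow> U \<inter> V \<noteq> {})"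
    and near: "\<And>x y. R x y \<Longrightarrow> x \<in> topspace T \<and> y \<in> topspace T \<and>
        (\<forall>U V. openin T U \<and> openin T V \<and> x \<in> U \<and> y \<in> V \<longrightarrow> U \<inter> V \<noteq> {})"
    and chain: "\<And>x y. x \<in> topspace T \<Longrightarrow> y \<in> topspace T \<Longrightarrow> R\<^sup>*\<^sup>* x y"
  shows "irreducible_space T"
proof -
  obtain N where N: "\<And>x. x \<in> topspace T \<Longrightarrow> openin T (N x) \<and> x \<in> N x"
    and irr: "\<And>x U V. x \<in> topspace T \<Longrightarrow> openin T U \<Longrightarrow> openin T V \<Longrightarrow> U \<subseteq> N x \<Longrightarrow> V \<subseteq> N x \<Longrightarrow>
      U \<noteq> {} \<Longrightarrow> V \<noteq> {} \<Longrightarrow> U \<inter> V \<noteq> {}"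
    using cover by metis
  have trans: "N x \<inter> V \<noteq> {}" if "x \<in> topspace T" "y \<in> topspace T" "N x \<inter> N y \<noteq> {}" "openin T V"
    "V \<inter> N y \<noteq> {}" for x y V
    using irr[of y "N x \<inter> N y" "V \<inter> N y"] N that by (metis Int_empty_right Int_lower2 inf_commute inf_left_commute openin_Int)
  have meet: "N x \<inter> N y \<noteq> {}" if "x \<in> topspace T" "R\<^sup>*\<^sup>* x y" for x y
    using that(2)
  proof induction
    case base
    then show ?case using N that by blast
  next
    case (step y z)
    then have "y \<in> topspace T" "z \<in> topspace T" "N y \<inter> N z \<noteq> {}" using near N by blast+
    then show ?case using trans[of x y "N z"] step.IH that(1) N by (metis inf_commute)
  qed
  have "U \<inter> V \<noteq> {}" if UV: "openin T U" "openin T V" "U \<noteq> {}" "V \<noteq> {}" for U V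
  proof -
    obtain x y where xy: "x \<in> U" "y \<in> V" using UV by blast
    then have t: "x \<in> topspace T" "y \<in> topspace T" using UV by (auto dest: openin_subset)
    have "N x \<inter> V \<noteq> {}"
      using trans[OF t meet[OF t(1) chain[OF t]] UV(2)] xy N t by blast
    moreover have "U \<inter> N x \<noteq> {}" using xy N t by blast
    ultimately show ?thesis
      using irr[OF t(1), of "U \<inter> N x" "V \<inter> N x"] UV N[OF t(1)]
      by (metis Int_empty_right Int_lower2 inf_commute inf_left_commute openin_Int)
  qed
  then show ?thesis using ne by (auto simp: irreducible_space_def)
qed

section \<open>Determinants\<close>

text \<open>
  The orders of the minors vary with the dimensions in \<open>ds\<close>, so the entries are given by a function on
  all pairs of indices, of which a minor uses an initial part.
\<close>

definition fdet :: "nat \<Rightarrow> (nat \<Rightarrow> nat \<Rightarrow> complex) \<Rightarrow> complex" where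
  "fdet s a = Determinant.det (Matrix.mat s s (\<lambda>(i, j). a i j))"

text \<open>
  The adjugate matrix.  Its cofactors are again determinants of this kind, which shows that it
  depends polynomially on the entries.
\<close>

definition fadj :: "nat \<Rightarrow> (nat \<Rightarrow> nat \<Rightarrow> complex) \<Rightarrow> nat \<Rightarrow> nat \<Rightarrow> complex" where
  "fadj s a i j = (-1) ^ (j + i) *
    fdet (s - 1) (\<lambda>k l. a (if k < j then k else Suc k) (if l < i then l else Suc l))"

lemma fadj_mult:
  assumes "i < s" "j < s"
  shows "(\<Sum>l<s. fadj s a i l * a l j) = (if i = j then fdet s a else 0)"
proof -
  let ?A = "Matrix.mat s s (\<lambda>(i, j). a i j)"
  have A: "?A \<in> carrier_mat s s" by simp
  have "fadj s a i l = adj_mat ?A $$ (i, l)" if "l < s" for l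
  proof -
    have "mat_delete ?A l i = Matrix.mat (s - 1) (s - 1)
        (\<lambda>(k, m). a (if k < l then k else Suc k) (if m < i then m else Suc m))"
      using that assms by (intro eq_matI) (auto simp: mat_delete_def)
    then show ?thesis using that assms by (simp add: adj_mat_def cofactor_def fadj_def fdet_def)
  qed
  then have "(\<Sum>l<s. fadj s a i l * a l j) = (\<Sum>l<s. adj_mat ?A $$ (i, l) * ?A $$ (l, j))"
    using assms by simp
  also have "\<dots> = (adj_mat ?A * ?A) $$ (i, j)"
    using assms adj_mat(1)[OF A] by (simp add: scalar_prod_def lessThan_atLeast0)
  also have "\<dots> = (if i = j then fdet s a else 0)"
    using assms by (simp add: adj_mat(3)[OF A] fdet_def)
  finally show ?thesis .
qed

lemma fdet_eq_0_iff:
  "fdet s a = 0 \<longleftrightarrow> (\<exists>c. (\<exists>l<s. c l \<noteq> 0) \<and> (\<forall>j<s. (\<Sum>l<s. c l * a l j) = 0))"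
proof -
  let ?A = "Matrix.mat s s (\<lambda>(i, j). a i j)"
  have T: "transpose_mat ?A \<in> carrier_mat s s" by simp
  have mv: "(transpose_mat ?A *\<^sub>v w) $ j = (\<Sum>l<s. w $ l * a l j)"
    if "w \<in> carrier_vec s" "j < s" for w j
    using that by (simp add: scalar_prod_def lessThan_atLeast0 mult.commute)
  have "fdet s a = 0 \<longleftrightarrow> Determinant.det (transpose_mat ?A) = 0"
    unfolding fdet_def by (subst det_transpose[of _ s]) auto
  also have "\<dots> \<longleftrightarrow> (\<exists>w. w \<in> carrier_vec s \<and> w \<noteq> 0\<^sub>v s \<and> transpose_mat ?A *\<^sub>v w = 0\<^sub>v s)"
    by (rule det_0_iff_vec_prod_zero[OF T])
  also have "\<dots> \<longleftrightarrow> (\<exists>c. (\<exists>l<s. c l \<noteq> 0) \<and> (\<forall>j<s. (\<Sum>l<s. c l * a l j) = 0))" (is "?L \<longleftrightarrow> ?R")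
  proof
    assume ?L
    then obtain w where w: "w \<in> carrier_vec s" "w \<noteq> 0\<^sub>v s" "transpose_mat ?A *\<^sub>v w = 0\<^sub>v s" by blast
    have "\<exists>l<s. w $ l \<noteq> 0"
    proof (rule ccontr)
      assume "\<not> (\<exists>l<s. w $ l \<noteq> 0)"
      then have "w = 0\<^sub>v s" using w(1) by (intro eq_vecI) auto
      then show False using w(2) by simp
    qed
    moreover have "\<forall>j<s. (\<Sum>l<s. w $ l * a l j) = 0"
      using mv[OF w(1)] w(3) by (metis index_zero_vec(1))
    ultimately show ?R by (intro exI[of _ "\<lambda>l. w $ l"]) blast
  next
    assume ?R
    then obtain c l where c: "l < s" "c l \<noteq> 0" "\<forall>j<s. (\<Sum>l<s. c l * a l j) = 0" by blast
    let ?w = "Matrix.vec s c"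
    have "?w \<noteq> 0\<^sub>v s" using c(1,2) by (metis index_vec index_zero_vec(1))
    moreover have "transpose_mat ?A *\<^sub>v ?w = 0\<^sub>v s"
    proof (rule eq_vecI)
      fix j assume "j < dim_vec (0\<^sub>v s :: complex Matrix.vec)"
      then have j: "j < s" by simp
      have "(transpose_mat ?A *\<^sub>v ?w) $ j = (\<Sum>l<s. ?w $ l * a l j)" by (rule mv) (use j in auto)
      also have "\<dots> = 0" using c(3) j by simp
      finally show "(transpose_mat ?A *\<^sub>v ?w) $ j = 0\<^sub>v s $ j" using j by simp
    qed simp
    ultimately show ?L by (intro exI[of _ ?w]) simp
  qed
  finally show ?thesis .
qed

lemma fun_algebra_fdet:
  assumes A: "fun_algebra A" and a: "\<And>i j. i < s \<Longrightarrow> j < s \<Longrightarrow> (\<lambda>x. a x i j) \<in> A"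
  shows "(\<lambda>x. fdet s (a x)) \<in> A"
proof -
  have "fdet s (a x) = (\<Sum>p\<in>{p. p permutes {0..<s}}. signof p * (\<Prod>i=0..<s. a x i (p i)))" for x
  proof -
    have "(\<Prod>i=0..<s. Matrix.mat s s (\<lambda>(i, j). a x i j) $$ (i, p i)) = (\<Prod>i=0..<s. a x i (p i))"
      if "p permutes {0..<s}" for p
      using permutes_in_image[OF that] by (intro prod.cong) auto
    then show ?thesis unfolding fdet_def
      by (subst det_def'[where n = s]) (auto intro!: sum.cong)
  qed
  moreover have "(\<lambda>x. \<Sum>p\<in>{p. p permutes {0..<s}}. signof p * (\<Prod>i=0..<s. a x i (p i))) \<in> A"
    by (intro fun_algebra_sum[OF A] fun_algebra_mult[OF A] fun_algebra_const[OF A] fun_algebra_prod[OF A])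
       (auto intro!: a dest: permutes_in_image)
  ultimately show ?thesis by simp
qed

lemma fun_algebra_fadj:
  assumes "fun_algebra A" "\<And>i j. i < s \<Longrightarrow> j < s \<Longrightarrow> (\<lambda>x. a x i j) \<in> A" "i < s" "j < s"
  shows "(\<lambda>x. fadj s (a x) i j) \<in> A"
  unfolding fadj_def
  by (intro fun_algebra_mult fun_algebra_const fun_algebra_fdet assms) (use assms(3,4) in auto)

section \<open>Frames and flags\<close>

context vector_space
begin

lemma span_take_iff:
  assumes "s \<le> length v"
  shows "x \<in> span (set (take s v)) \<longleftrightarrow> (\<exists>c. x = (\<Sum>l<s. c l *s (v ! l)))"
  using assms
proof (induction s arbitrary: x)
  case 0
  then show ?case by simp
next
  case (Suc s)
  have t: "set (take (Suc s) v) = insert (v ! s) (set (take s v))"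
    using Suc.prems by (simp add: take_Suc_conv_app_nth)
  have "x \<in> span (set (take (Suc s) v)) \<longleftrightarrow> (\<exists>k c. x - k *s (v ! s) = (\<Sum>l<s. c l *s (v ! l)))"
    unfolding t span_breakdown_eq using Suc by simp
  also have "\<dots> \<longleftrightarrow> (\<exists>c. x = (\<Sum>l<Suc s. c l *s (v ! l)))"
  proof
    assume "\<exists>k c. x - k *s (v ! s) = (\<Sum>l<s. c l *s (v ! l))"
    then obtain k c where "x - k *s (v ! s) = (\<Sum>l<s. c l *s (v ! l))" by blast
    then show "\<exists>c. x = (\<Sum>l<Suc s. c l *s (v ! l))"
      by (intro exI[of _ "c(s := k)"]) (simp add: algebra_simps)
  next
    assume "\<exists>c. x = (\<Sum>l<Suc s. c l *s (v ! l))"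
    then show "\<exists>k c. x - k *s (v ! s) = (\<Sum>l<s. c l *s (v ! l))"
      by (metis (no_types, lifting) add_diff_cancel_right' sum.lessThan_Suc)
  qed
  finally show ?case .
qed

end

lemma nth_le_last:
  assumes "sorted_wrt (<) (ds :: nat list)" "i < length ds"
  shows "ds ! i \<le> last ds"
proof (cases "i = length ds - 1")
  case True
  then show ?thesis using assms(2) by (cases ds) (auto simp: last_conv_nth)
next
  case False
  then have "i < length ds - 1" "ds \<noteq> []" using assms(2) by auto
  then show ?thesis using sorted_wrt_nth_less[OF assms(1), of i "length ds - 1"]
    by (simp add: last_conv_nth)
qed

locale flag_space = finite_dimensional_vector_space scl Basis
  for scl :: "complex \<Rightarrow> 'e::ab_group_add \<Rightarrow> 'e" and Basis
begin

lemma frames_iff: "v \<in> frames scl d \<longleftrightarrow>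
    length v = d \<and> (\<forall>c. (\<Sum>l<d. scl (c l) (v ! l)) = 0 \<longrightarrow> (\<forall>l<d. c l = 0))"
proof
  assume v: "v \<in> frames scl d"
  then have l: "length v = d" and dv: "distinct v" and iv: "independent (set v)"
    by (auto simp: frames_def)
  have bij: "bij_betw ((!) v) {..<d} (set v)" using bij_betw_nth[OF dv] l by auto
  have "c l = 0" if 0: "(\<Sum>l<d. scl (c l) (v ! l)) = 0" and ld: "l < d" for c l
  proof -
    define u where "u = (\<lambda>x. c (the_inv_into {..<d} ((!) v) x))"
    have u: "u (v ! l) = c l" if "l < d" for l
      using that bij by (simp add: u_def the_inv_into_f_f bij_betw_def)
    have "(\<Sum>x\<in>set v. scl (u x) x) = (\<Sum>l<d. scl (u (v ! l)) (v ! l))"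
      using sum.reindex_bij_betw[OF bij, of "\<lambda>x. scl (u x) x"] by simp
    also have "\<dots> = 0" using 0 u by simp
    finally have "u (v ! l) = 0"
      using independentD[OF iv finite_set order_refl, of u "v ! l"] ld l by simp
    then show ?thesis using u ld by simp
  qed
  then show "length v = d \<and> (\<forall>c. (\<Sum>l<d. scl (c l) (v ! l)) = 0 \<longrightarrow> (\<forall>l<d. c l = 0))"
    using l by blast
next
  assume "length v = d \<and> (\<forall>c. (\<Sum>l<d. scl (c l) (v ! l)) = 0 \<longrightarrow> (\<forall>l<d. c l = 0))"
  then have l: "length v = d" and 0: "\<And>c l. (\<Sum>l<d. scl (c l) (v ! l)) = 0 \<Longrightarrow> l < d \<Longrightarrow> c l = 0"
    by blast+
  have dv: "distinct v" unfolding distinct_conv_nth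
  proof (intro allI impI notI)
    fix i j assume ij: "i < length v" "j < length v" "i \<noteq> j" "v ! i = v ! j"
    define c :: "nat \<Rightarrow> complex" where "c = (\<lambda>l. if l = i then 1 else if l = j then -1 else 0)"
    have "(\<Sum>l<d. scl (c l) (v ! l)) = (\<Sum>l\<in>{i, j}. scl (c l) (v ! l))"
      by (rule sum.mono_neutral_right) (use ij l in \<open>auto simp: c_def\<close>)
    also have "\<dots> = 0" using ij by (simp add: c_def)
    finally show False using 0[of c i] ij l by (simp add: c_def)
  qed
  have bij: "bij_betw ((!) v) {..<d} (set v)" using bij_betw_nth[OF dv] l by auto
  have "independent (set v)"
  proof (rule independent_if_scalars_zero[OF finite_set])
    fix u x assume u: "(\<Sum>x\<in>set v. scl (u x) x) = 0" and x: "x \<in> set v"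
    have "(\<Sum>l<d. scl (u (v ! l)) (v ! l)) = 0"
      using sum.reindex_bij_betw[OF bij, of "\<lambda>x. scl (u x) x"] u by simp
    moreover obtain l where "l < d" "x = v ! l" using x l by (metis in_set_conv_nth)
    ultimately show "u x = 0" using 0[of "\<lambda>l. u (v ! l)" l] by simp
  qed
  then show "v \<in> frames scl d" using l dv by (simp add: frames_def)
qed

lemma length_frame: "v \<in> frames scl d \<Longrightarrow> length v = d"
  by (simp add: frames_def)

lemma frame_extends:
  assumes v: "v \<in> frames scl c" and V: "subspace V" "set v \<subseteq> V"
  shows "\<exists>w. v @ w \<in> frames scl (dim V) \<and> span (set (v @ w)) = V"
proof -
  have "independent (set v)" "distinct v" using v by (auto simp: frames_def)
  then obtain B where B: "set v \<subseteq> B" "B \<subseteq> V" "independent B" "V \<subseteq> span B"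
    using maximal_independent_subset_extend[OF V(2)] by metis
  have fin: "finite (B - set v)" using finiteI_independent[OF B(3)] by simp
  obtain w where w: "set w = B - set v" "distinct w" using finite_distinct_list[OF fin] by blast
  have sB: "set (v @ w) = B" using w B by auto
  have dvw: "distinct (v @ w)" using w \<open>distinct v\<close> by auto
  have "span B = V" using B V(1) by (simp add: span_minimal subset_antisym)
  moreover have "length (v @ w) = dim V"
    using distinct_card[OF dvw] basis_card_eq_dim[OF B(2,4,3)] sB by simp
  ultimately show ?thesis using sB dvw B(3) unfolding frames_def by blast
qed

lemma dim_span_take:
  assumes "v \<in> frames scl d" "s \<le> d"
  shows "dim (span (set (take s v))) = s"
proof -
  have "independent (set (take s v))"
    using assms independent_mono[OF _ set_take_subset[of s v]] by (auto simp: frames_def)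
  then show ?thesis using assms distinct_card[of "take s v"]
    by (simp add: dim_eq_card_independent frames_def)
qed

lemma flag_of_frame_nth: "i < length ds \<Longrightarrow> flag_of_frame scl ds v ! i = span (set (take (ds ! i) v))"
  by (simp add: flag_of_frame_def)

lemma flag_of_frame_in_flags:
  assumes "sorted_wrt (<) ds" "v \<in> frames scl (last ds)"
  shows "flag_of_frame scl ds v \<in> flags scl ds"
proof -
  have "sorted_wrt (\<subseteq>) (flag_of_frame scl ds v)"
    unfolding flag_of_frame_def sorted_wrt_map
    by (rule sorted_wrt_mono_rel[OF _ assms(1)]) (auto intro!: span_mono set_take_subset_set_take)
  then show ?thesis
    using dim_span_take[OF assms(2) nth_le_last[OF assms(1)]]
    by (simp add: flags_def flag_of_frame_nth) (simp add: flag_of_frame_def)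
qed

lemma flag_of_frame_append:
  assumes "\<And>s. s \<in> set ds \<Longrightarrow> s \<le> length v"
  shows "flag_of_frame scl ds (v @ w) = flag_of_frame scl ds v"
  using assms by (auto simp: flag_of_frame_def)

text \<open>
  A frame of each member is extended to a frame of the next one.
\<close>

lemma flag_has_frame:
  assumes "sorted_wrt (<) ds" "ds \<noteq> []" "Vs \<in> flags scl ds"
  shows "\<exists>v\<in>frames scl (last ds). flag_of_frame scl ds v = Vs"
  using assms
proof (induction ds arbitrary: Vs rule: rev_induct)
  case Nil
  then show ?case by simp
next
  case (snoc a ds)
  define V where "V = last Vs"
  have lVs: "length Vs = Suc (length ds)" using snoc.prems by (simp add: flags_def)
  then have Vs: "Vs = butlast Vs @ [V]" by (metis V_def append_butlast_last_id list.size(3) nat.distinct(1))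
  have "V = Vs ! length ds" using lVs last_conv_nth[of Vs]
    by (metis V_def diff_Suc_1 list.size(3) nat.distinct(1))
  then have V: "subspace V" "dim V = a"
    using snoc.prems(3) unfolding flags_def by (auto dest!: spec[of _ "length ds"])
  have "\<exists>v\<in>frames scl (if ds = [] then 0 else last ds). flag_of_frame scl ds v = butlast Vs \<and> set v \<subseteq> V"
  proof (cases "ds = []")
    case True
    then have "butlast Vs = []" using lVs by (metis length_0_conv length_butlast diff_Suc_1 list.size(3))
    then show ?thesis using True by (intro bexI[of _ "[]"]) (auto simp: flag_of_frame_def frames_def independent_empty)
  next
    case False
    have "butlast Vs \<in> flags scl ds"
    proof -
      have "sorted_wrt (\<subseteq>) (butlast Vs @ [V])" using snoc.prems(3) Vs by (simp add: flags_def)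
      moreover have "subspace (butlast Vs ! i) \<and> dim (butlast Vs ! i) = ds ! i" if "i < length ds" for i
      proof -
        have "subspace (Vs ! i) \<and> dim (Vs ! i) = (ds @ [a]) ! i"
          using snoc.prems(3) that unfolding flags_def by auto
        then show ?thesis using that lVs by (simp add: nth_butlast nth_append)
      qed
      ultimately show ?thesis using lVs by (simp add: flags_def sorted_wrt_append)
    qed
    then obtain v where v: "v \<in> frames scl (last ds)" "flag_of_frame scl ds v = butlast Vs"
      using snoc False by (auto simp: sorted_wrt_append)
    have "last (butlast Vs) \<subseteq> V"
      using snoc.prems(3) Vs False lVs v
      by (metis (no_types, lifting) flag_of_frame_def flags_def last_in_set list.set_intros(1) map_is_Nil_conv
          mem_Collect_eq sorted_wrt_append)
    moreover have "last (butlast Vs) = span (set v)"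
      using v False length_frame[OF v(1)] by (metis flag_of_frame_def last_map order_refl take_all)
    ultimately have "set v \<subseteq> V" using span_superset[of "set v"] by simp
    then show ?thesis using v False by auto
  qed
  then obtain v where v: "v \<in> frames scl (if ds = [] then 0 else last ds)"
    "flag_of_frame scl ds v = butlast Vs" "set v \<subseteq> V" by blast
  obtain w where w: "v @ w \<in> frames scl a" "span (set (v @ w)) = V"
    using frame_extends[OF v(1) V(1) v(3)] V(2) by blast
  have "s \<le> length v" if "s \<in> set ds" for s
    using that length_frame[OF v(1)] snoc.prems(1) nth_le_last[of ds]
    by (auto simp: sorted_wrt_append in_set_conv_nth)
  then have "flag_of_frame scl (ds @ [a]) (v @ w) = Vs"
    using v(2) w length_frame[OF w(1)] Vs flag_of_frame_append[of ds v w]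
    by (simp add: flag_of_frame_def)
  then show ?case using w by auto
qed

end

definition pos_index :: "'a list \<Rightarrow> 'a \<Rightarrow> nat" where
  "pos_index ps p = (THE k. k < length ps \<and> ps ! k = p)"

lemma pos_index_nth: "distinct ps \<Longrightarrow> k < length ps \<Longrightarrow> pos_index ps (ps ! k) = k"
  unfolding pos_index_def by (rule the_equality) (auto simp: nth_eq_iff_index_eq)

lemma pos_index:
  assumes "distinct ps" "p \<in> set ps"
  shows "pos_index ps p < length ps" "ps ! pos_index ps p = p"
proof -
  obtain k where "k < length ps" "p = ps ! k" using assms(2) by (auto simp: in_set_conv_nth)
  then show "pos_index ps p < length ps" "ps ! pos_index ps p = p"
    using pos_index_nth[OF assms(1)] by auto
qed

section \<open>Affine charts of the flag variety\<close>

text \<open>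
  The chart belongs to a basis \<open>e\<close> of \<open>E\<close>, and its origin is the flag spanned by initial segments of
  \<open>e\<close>.
\<close>

locale flag_chart = flag_space scl "e ` {..<D}"
  for scl :: "complex \<Rightarrow> 'e::ab_group_add \<Rightarrow> 'e" and e :: "nat \<Rightarrow> 'e" and D :: nat +
  fixes ds :: "nat list"
  assumes inj_e: "inj_on e {..<D}"
    and sorted_ds: "sorted_wrt (<) ds" and ds_ne: "ds \<noteq> []" and last_le: "last ds \<le> D"
begin

definition co :: "nat \<Rightarrow> 'e \<Rightarrow> complex" where
  "co j x = representation (e ` {..<D}) x (e j)"

lemma co_linear: "Vector_Spaces.linear scl (*) (co j)"
  unfolding co_def
  by (rule linear_representation[OF independent_Basis, unfolded span_Basis]) simp

lemma co_add: "co j (x + y) = co j x + co j y"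
  and co_scale: "co j (scl c x) = c * co j x"
  using co_linear[of j] by (auto simp: Vector_Spaces.linear_iff)

lemma co_zero: "co j 0 = 0"
  using co_scale[of j 0 0] by simp

lemma co_diff: "co j (x - y) = co j x - co j y"
  using co_add[of j "x - y" y] by simp

lemma co_sum: "co j (\<Sum>i\<in>I. f i) = (\<Sum>i\<in>I. co j (f i))"
  by (induction I rule: infinite_finite_induct) (auto simp: co_zero co_add)

lemma co_e: "i < D \<Longrightarrow> j < D \<Longrightarrow> co j (e i) = (if i = j then 1 else 0)"
  using inj_e by (simp add: co_def representation_basis independent_Basis inj_on_eq_iff[of e "{..<D}"])

lemma sum_co_e: "x = (\<Sum>j<D. scl (co j x) (e j))"
proof -
  have "x = (\<Sum>b\<in>e ` {..<D}. scl (representation (e ` {..<D}) x b) b)"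
    by (rule sum_representation_eq[symmetric]) (auto simp: independent_Basis span_Basis)
  also have "\<dots> = (\<Sum>j<D. scl (co j x) (e j))"
    by (simp add: sum.reindex[OF inj_e] co_def)
  finally show ?thesis .
qed

lemma eqI_co: "(\<And>j. j < D \<Longrightarrow> co j x = co j y) \<Longrightarrow> x = y"
  using sum_co_e[of x] sum_co_e[of y] by simp

abbreviation d :: nat where "d \<equiv> last ds"

lemma ds_le: "b < length ds \<Longrightarrow> ds ! b \<le> d"
  by (rule nth_le_last[OF sorted_ds])

lemma last_ds: "ds ! (length ds - 1) = d" "length ds - 1 < length ds"
  using ds_ne by (auto simp: last_conv_nth)

text \<open>
  The step of the flag at which the \<open>i\<close>-th vector of a frame appears, that is the block of the
  parabolic subgroup to which the index \<open>i\<close> belongs.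
\<close>

definition block :: "nat \<Rightarrow> nat" where
  "block i = (LEAST b. i < ds ! b)"

lemma block:
  assumes "i < d"
  shows "block i < length ds" "i < ds ! block i" "ds ! block i \<le> d"
proof -
  have i: "i < ds ! (length ds - 1)" using assms last_ds by simp
  then show "i < ds ! block i" unfolding block_def by (rule LeastI)
  have "block i \<le> length ds - 1" unfolding block_def using i by (rule Least_le)
  then show "block i < length ds" using last_ds(2) by linarith
  then show "ds ! block i \<le> d" by (rule ds_le)
qed

lemma block_le: "i < ds ! b \<Longrightarrow> block i \<le> b"
  unfolding block_def by (rule Least_le)

text \<open>
  Each member \<open>Vs ! b\<close> is complementary to the span of the \<open>e j\<close> with \<open>j \<ge> ds ! b\<close>.
\<close>

definition chart_dom :: "'e set list set" where
  "chart_dom = {Vs \<in> flags scl ds. \<forall>b<length ds. \<forall>x\<in>Vs ! b. (\<forall>j<ds ! b. co j x = 0) \<longrightarrow> x = 0}"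

text \<open>
  Row \<open>i\<close> of the reduced echelon form of \<open>V\<close>.  It is well-defined if \<open>V\<close> has dimension \<open>s\<close> and is
  complementary to the span of the \<open>e j\<close> with \<open>j \<ge> s\<close>.
\<close>

definition reduced_vec :: "'e set \<Rightarrow> nat \<Rightarrow> nat \<Rightarrow> 'e" where
  "reduced_vec V s i = (THE x. x \<in> V \<and> (\<forall>j<s. co j x = (if i = j then 1 else 0)))"

text \<open>
  The coordinates with \<open>j \<ge> d\<close> are read off from the largest member alone, so that the condition that
  it is isotropic involves no others.  Those with \<open>j < d\<close> record the position of the smaller members
  in it.
\<close>

definition chart_coord :: "'e set list \<Rightarrow> nat \<Rightarrow> nat \<Rightarrow> complex" where
  "chart_coord Vs i j = co j (if j < d then reduced_vec (Vs ! block i) (ds ! block i) i else reduced_vec (last Vs) d i)"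

text \<open>
  At the other positions \<open>(i, j)\<close> the reduced vectors have the constant coordinates \<open>0\<close> or \<open>1\<close>.
\<close>

definition free_pos :: "(nat \<times> nat) set" where
  "free_pos = {(i, j). i < d \<and> ds ! block i \<le> j \<and> j < D}"

lemma finite_free_pos: "finite free_pos"
  by (rule finite_subset[of _ "{..<d} \<times> {..<D}"]) (auto simp: free_pos_def)

definition graph_vec :: "(nat \<Rightarrow> nat \<Rightarrow> complex) \<Rightarrow> nat \<Rightarrow> 'e" where
  "graph_vec y i = e i + (\<Sum>j\<in>{d..<D}. scl (y i j) (e j))"

text \<open>
  The frame with chart coordinates \<open>y\<close>: a block unipotent matrix applied to a basis of the graph that
  is the largest member.
\<close>

definition chart_frame :: "(nat \<Rightarrow> nat \<Rightarrow> complex) \<Rightarrow> 'e list" where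
  "chart_frame y = map (\<lambda>i. graph_vec y i + (\<Sum>j\<in>{ds ! block i..<d}. scl (y i j) (graph_vec y j))) [0..<d]"

lemma length_chart_frame: "length (chart_frame y) = d"
  by (simp add: chart_frame_def)

lemma nth_chart_frame:
  "i < d \<Longrightarrow> chart_frame y ! i = graph_vec y i + (\<Sum>j\<in>{ds ! block i..<d}. scl (y i j) (graph_vec y j))"
  by (simp add: chart_frame_def)

lemma co_graph_vec:
  assumes "i < d" "j < D"
  shows "co j (graph_vec y i) = (if j < d then if i = j then 1 else 0 else y i j)"
proof -
  have "co j (graph_vec y i) = co j (e i) + (\<Sum>k\<in>{d..<D}. y i k * co j (e k))"
    by (simp add: graph_vec_def co_add co_sum co_scale)
  also have "(\<Sum>k\<in>{d..<D}. y i k * co j (e k)) = (\<Sum>k\<in>{d..<D}. if k = j then y i k else 0)"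
    by (rule sum.cong) (use assms in \<open>auto simp: co_e\<close>)
  also have "\<dots> = (if d \<le> j then y i j else 0)" using assms by simp
  finally show ?thesis using assms last_le by (auto simp: co_e)
qed

lemma co_chart_frame:
  assumes "i < d" "j < d"
  shows "co j (chart_frame y ! i) = (if i = j then 1 else if ds ! block i \<le> j then y i j else 0)"
proof -
  have "co j (chart_frame y ! i) = co j (graph_vec y i) + (\<Sum>k\<in>{ds ! block i..<d}. y i k * co j (graph_vec y k))"
    using assms by (simp add: nth_chart_frame co_add co_sum co_scale)
  also have "(\<Sum>k\<in>{ds ! block i..<d}. y i k * co j (graph_vec y k))
      = (\<Sum>k\<in>{ds ! block i..<d}. if k = j then y i k else 0)"
    by (rule sum.cong) (use assms last_le in \<open>auto simp: co_graph_vec\<close>)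
  also have "\<dots> = (if ds ! block i \<le> j then y i j else 0)" using assms by simp
  finally show ?thesis using assms last_le block[OF assms(1)] by (auto simp: co_graph_vec)
qed

text \<open>
  The first coordinates of the frame form a unitriangular matrix, so the coefficients vanish one
  after the other.
\<close>

lemma chart_frame_unitriangular:
  assumes s: "s \<le> d" and 0: "\<forall>j<s. co j (\<Sum>l<s. scl (c l) (chart_frame y ! l)) = 0"
  shows "l < s \<Longrightarrow> c l = 0"
proof (induction l rule: less_induct)
  case (less l)
  have "co l (\<Sum>k<s. scl (c k) (chart_frame y ! k)) = (\<Sum>k<s. c k * co l (chart_frame y ! k))"
    by (simp add: co_sum co_scale)
  also have "\<dots> = (\<Sum>k<s. if k = l then c k else 0)"
  proof (rule sum.cong)
    fix k assume k: "k \<in> {..<s}"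
    show "c k * co l (chart_frame y ! k) = (if k = l then c k else 0)"
    proof (cases "k < l")
      case True
      then show ?thesis using less k by simp
    next
      case False
      then have "\<not> ds ! block k \<le> l" using block(2)[of k] k s by auto
      then show ?thesis using k s less.prems by (simp add: co_chart_frame)
    qed
  qed simp
  also have "\<dots> = c l" using less.prems by simp
  finally show ?case using 0 less.prems by simp
qed

lemma chart_frame_in_frames: "chart_frame y \<in> frames scl d"
  unfolding frames_iff
proof (intro conjI allI impI)
  fix c l assume "(\<Sum>l<d. scl (c l) (chart_frame y ! l)) = 0" "l < d"
  then show "c l = 0" using chart_frame_unitriangular[of d c y l] by (simp add: co_zero)
qed (rule length_chart_frame)

lemma chart_frame_in_dom: "flag_of_frame scl ds (chart_frame y) \<in> chart_dom"
  unfolding chart_dom_def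
proof (intro CollectI conjI allI impI ballI)
  show "flag_of_frame scl ds (chart_frame y) \<in> flags scl ds"
    by (rule flag_of_frame_in_flags[OF sorted_ds chart_frame_in_frames])
  fix b x assume b: "b < length ds" and x: "x \<in> flag_of_frame scl ds (chart_frame y) ! b"
    and 0: "\<forall>j<ds ! b. co j x = 0"
  obtain c where c: "x = (\<Sum>l<ds ! b. scl (c l) (chart_frame y ! l))"
    using x span_take_iff[of "ds ! b" "chart_frame y" x] b ds_le[OF b]
    by (auto simp: flag_of_frame_nth length_chart_frame)
  then have "c l = 0" if "l < ds ! b" for l
    using chart_frame_unitriangular[OF ds_le[OF b], of c y l] 0 that by simp
  then show "x = 0" using c by simp
qed

lemma reduced_vec_eqI:
  assumes V: "subspace V" and dom: "\<forall>x\<in>V. (\<forall>j<s. co j x = 0) \<longrightarrow> x = 0"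
    and x: "x \<in> V" "\<And>j. j < s \<Longrightarrow> co j x = (if i = j then 1 else 0)"
  shows "reduced_vec V s i = x"
  unfolding reduced_vec_def
proof (rule the_equality)
  fix z assume z: "z \<in> V \<and> (\<forall>j<s. co j z = (if i = j then 1 else 0))"
  then have "z - x \<in> V" using x V by (simp add: subspace_diff)
  moreover have "\<forall>j<s. co j (z - x) = 0" using z x by (simp add: co_diff)
  ultimately have "z - x = 0" using dom by blast
  then show "z = x" by simp
qed (use x in auto)

abbreviation coord_matrix :: "'e list \<Rightarrow> nat \<Rightarrow> nat \<Rightarrow> complex" where
  "coord_matrix v \<equiv> \<lambda>l j. co j (v ! l)"

text \<open>
  The minor is the determinant of the projection of the span of the first \<open>s\<close> vectors of \<open>v\<close> to the
  span of the \<open>e j\<close> with \<open>j < s\<close>.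
\<close>

lemma fdet_coord_matrix:
  assumes v: "v \<in> frames scl c" and s: "s \<le> c"
  shows "fdet s (coord_matrix v) \<noteq> 0 \<longleftrightarrow> (\<forall>x\<in>span (set (take s v)). (\<forall>j<s. co j x = 0) \<longrightarrow> x = 0)"
proof -
  have l: "s \<le> length v" using v s by (simp add: frames_def)
  have indep: "(\<Sum>l<s. scl (c' l) (v ! l)) = 0 \<Longrightarrow> l < s \<Longrightarrow> c' l = 0" for c' l
  proof -
    assume 0: "(\<Sum>l<s. scl (c' l) (v ! l)) = 0" and ls: "l < s"
    have "(\<Sum>l<c. scl (if l < s then c' l else 0) (v ! l)) = (\<Sum>l<s. scl (c' l) (v ! l))"
      by (rule sum.mono_neutral_cong_right) (use s in auto)
    then have "(\<Sum>l<c. scl (if l < s then c' l else 0) (v ! l)) = 0" using 0 by simp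
    then have "\<forall>l<c. (if l < s then c' l else 0) = 0"
      using v unfolding frames_iff by (elim conjE allE[of _ "\<lambda>l. if l < s then c' l else 0"] mp)
    then show "c' l = 0" using ls s by (auto dest: spec[of _ l])
  qed
  have co: "co j (\<Sum>l<s. scl (c l) (v ! l)) = (\<Sum>l<s. c l * co j (v ! l))" for c j
    by (simp add: co_sum co_scale)
  show ?thesis
  proof
    assume f: "fdet s (coord_matrix v) \<noteq> 0"
    show "\<forall>x\<in>span (set (take s v)). (\<forall>j<s. co j x = 0) \<longrightarrow> x = 0"
    proof (intro ballI impI)
      fix x assume x: "x \<in> span (set (take s v))" and 0: "\<forall>j<s. co j x = 0"
      obtain c where c: "x = (\<Sum>l<s. scl (c l) (v ! l))" using x span_take_iff[OF l] by blast
      then have "\<forall>j<s. (\<Sum>l<s. c l * co j (v ! l)) = 0" using 0 co by simp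
      then have "\<forall>l<s. c l = 0" using f unfolding fdet_eq_0_iff by blast
      then show "x = 0" using c by simp
    qed
  next
    assume dom: "\<forall>x\<in>span (set (take s v)). (\<forall>j<s. co j x = 0) \<longrightarrow> x = 0"
    show "fdet s (coord_matrix v) \<noteq> 0"
    proof
      assume "fdet s (coord_matrix v) = 0"
      then obtain c l where c: "l < s" "c l \<noteq> 0" "\<forall>j<s. (\<Sum>l<s. c l * co j (v ! l)) = 0"
        unfolding fdet_eq_0_iff by blast
      have "(\<Sum>l<s. scl (c l) (v ! l)) = 0"
        using dom span_take_iff[OF l] c(3) co by metis
      then show False using indep c by blast
    qed
  qed
qed

text \<open>
  Cramer's rule.
\<close>

lemma reduced_vec_span_take:
  assumes v: "v \<in> frames scl c" and s: "s \<le> c" and i: "i < s"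
    and f: "fdet s (coord_matrix v) \<noteq> 0"
  shows "reduced_vec (span (set (take s v))) s i =
    (\<Sum>l<s. scl (fadj s (coord_matrix v) i l / fdet s (coord_matrix v)) (v ! l))"
proof (rule reduced_vec_eqI)
  show "(\<Sum>l<s. scl (fadj s (coord_matrix v) i l / fdet s (coord_matrix v)) (v ! l)) \<in> span (set (take s v))"
    using span_take_iff[of s v] v s by (auto simp: frames_def)
  fix j assume j: "j < s"
  have "co j (\<Sum>l<s. scl (fadj s (coord_matrix v) i l / fdet s (coord_matrix v)) (v ! l)) =
      (\<Sum>l<s. fadj s (coord_matrix v) i l * co j (v ! l)) / fdet s (coord_matrix v)"
    by (simp add: co_sum co_scale sum_divide_distrib)
  also have "\<dots> = (if i = j then 1 else 0)" using fadj_mult[OF i j, of "coord_matrix v"] f by simp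
  finally show "co j (\<Sum>l<s. scl (fadj s (coord_matrix v) i l / fdet s (coord_matrix v)) (v ! l)) =
      (if i = j then 1 else 0)" .
qed (use fdet_coord_matrix[OF v s] f in \<open>auto simp: subspace_span\<close>)

lemma flag_in_dom_iff:
  assumes "v \<in> frames scl d"
  shows "flag_of_frame scl ds v \<in> chart_dom \<longleftrightarrow> (\<Prod>b<length ds. fdet (ds ! b) (coord_matrix v)) \<noteq> 0"
  using fdet_coord_matrix[OF assms ds_le] flag_of_frame_in_flags[OF sorted_ds assms]
  by (auto simp: chart_dom_def flag_of_frame_nth)

lemma last_flag_of_frame: "v \<in> frames scl d \<Longrightarrow> last (flag_of_frame scl ds v) = span (set v)"
  using ds_ne by (simp add: flag_of_frame_def last_map frames_def)

lemma co_coord: "j < D \<Longrightarrow> l < c \<Longrightarrow> (\<lambda>v. co j (v ! l)) \<in> poly_funs scl c"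
  by (rule poly_funs.coord[OF co_linear])

lemma chart_coord_rational:
  assumes "(i, j) \<in> free_pos"
  shows "\<exists>g\<in>poly_funs scl d. \<exists>h\<in>poly_funs scl d. \<forall>v\<in>frames scl d.
    flag_of_frame scl ds v \<in> chart_dom \<longrightarrow> h v \<noteq> 0 \<and> chart_coord (flag_of_frame scl ds v) i j = g v / h v"
proof -
  have i: "i < d" and j: "j < D" using assms by (auto simp: free_pos_def)
  define b where "b = (if j < d then block i else length ds - 1)"
  have b: "b < length ds" "i < ds ! b" "ds ! b \<le> d"
    using block[OF i] last_ds i by (auto simp: b_def)
  note alg = fun_algebra_poly_funs[of scl d]
  have chart_coord: "chart_coord (flag_of_frame scl ds v) i j =
      (\<Sum>l<ds ! b. fadj (ds ! b) (coord_matrix v) i l * co j (v ! l)) / fdet (ds ! b) (coord_matrix v)"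
    and nz: "fdet (ds ! b) (coord_matrix v) \<noteq> 0"
    if v: "v \<in> frames scl d" "flag_of_frame scl ds v \<in> chart_dom" for v
  proof -
    show nz: "fdet (ds ! b) (coord_matrix v) \<noteq> 0"
      using that b by (simp add: flag_in_dom_iff)
    have "chart_coord (flag_of_frame scl ds v) i j = co j (reduced_vec (span (set (take (ds ! b) v))) (ds ! b) i)"
      using b(1) v(1) last_ds(1) length_frame[OF v(1)]
      by (cases "j < d") (simp_all add: chart_coord_def b_def flag_of_frame_nth last_flag_of_frame)
    then show "chart_coord (flag_of_frame scl ds v) i j =
      (\<Sum>l<ds ! b. fadj (ds ! b) (coord_matrix v) i l * co j (v ! l)) / fdet (ds ! b) (coord_matrix v)"
      using reduced_vec_span_take[OF v(1) b(3,2) nz] by (simp add: co_sum co_scale sum_divide_distrib)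
  qed
  show ?thesis
    by (rule bexI[of _ "\<lambda>v. \<Sum>l<ds ! b. fadj (ds ! b) (coord_matrix v) i l * co j (v ! l)"],
        rule bexI[of _ "\<lambda>v. fdet (ds ! b) (coord_matrix v)"])
       (use chart_coord nz b j last_le in \<open>auto intro!: fun_algebra_sum[OF alg] fun_algebra_mult[OF alg]
          fun_algebra_fadj[OF alg] fun_algebra_fdet[OF alg] co_coord\<close>)
qed

text \<open>
  The equations that define the frame can be solved for the graph vectors, beginning with the last
  one.
\<close>

lemma graph_vec_in_span: "i < d \<Longrightarrow> graph_vec y i \<in> span (set (chart_frame y))"
proof (induction "d - i" arbitrary: i rule: less_induct)
  case less
  have "graph_vec y i = chart_frame y ! i - (\<Sum>j\<in>{ds ! block i..<d}. scl (y i j) (graph_vec y j))"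
    using less.prems by (simp add: nth_chart_frame)
  moreover have "chart_frame y ! i \<in> span (set (chart_frame y))"
    using less.prems by (intro span_base nth_mem) (simp add: length_chart_frame)
  moreover have "graph_vec y j \<in> span (set (chart_frame y))" if "j \<in> {ds ! block i..<d}" for j
    using less.hyps[of j] that block(2)[OF less.prems] by force
  ultimately show ?case by (auto intro!: span_diff span_sum span_scale)
qed

lemma span_chart_frame: "span (set (chart_frame y)) = span (graph_vec y ` {..<d})"
proof (rule span_eq[THEN iffD2], intro conjI subsetI)
  fix x assume "x \<in> set (chart_frame y)"
  then obtain i where i: "i < d" "x = chart_frame y ! i" by (metis in_set_conv_nth length_chart_frame)
  show "x \<in> span (graph_vec y ` {..<d})"
    unfolding i(2) nth_chart_frame[OF i(1)] using i(1)
    by (intro span_add span_sum span_scale span_base) auto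
next
  fix x assume "x \<in> graph_vec y ` {..<d}"
  then show "x \<in> span (set (chart_frame y))" using graph_vec_in_span by auto
qed

lemma chart_coord_chart_frame:
  assumes "(i, j) \<in> free_pos"
  shows "chart_coord (flag_of_frame scl ds (chart_frame y)) i j = y i j"
proof -
  let ?V = "flag_of_frame scl ds (chart_frame y)"
  have i: "i < d" and j: "ds ! block i \<le> j" "j < D" using assms by (auto simp: free_pos_def)
  have dom: "\<forall>x\<in>?V ! b. (\<forall>j<ds ! b. co j x = 0) \<longrightarrow> x = 0" if "b < length ds" for b
    using chart_frame_in_dom that by (simp add: chart_dom_def)
  have sub: "subspace (?V ! b)" if "b < length ds" for b
    using that by (simp add: flag_of_frame_nth subspace_span)
  have last: "last ?V = span (set (chart_frame y))"
    by (rule last_flag_of_frame[OF chart_frame_in_frames])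
  have lastn: "last ?V = ?V ! (length ds - 1)"
    using ds_ne by (simp add: last_conv_nth flag_of_frame_def)
  show ?thesis
  proof (cases "j < d")
    case True
    have "reduced_vec (?V ! block i) (ds ! block i) i = chart_frame y ! i"
    proof (rule reduced_vec_eqI[OF sub dom])
      have "i < length (take (ds ! block i) (chart_frame y))"
        using block[OF i] i by (simp add: length_chart_frame)
      then have "chart_frame y ! i \<in> set (take (ds ! block i) (chart_frame y))"
        by (metis length_take min_less_iff_conj nth_mem nth_take)
      then show "chart_frame y ! i \<in> ?V ! block i"
        using block[OF i] by (simp add: flag_of_frame_nth span_base)
      show "co k (chart_frame y ! i) = (if i = k then 1 else 0)" if "k < ds ! block i" for k
        using that block(3)[OF i] i by (simp add: co_chart_frame)
    qed (use block[OF i] in auto)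
    then show ?thesis using True i j block(2)[OF i] by (simp add: chart_coord_def co_chart_frame)
  next
    case False
    have "reduced_vec (last ?V) d i = graph_vec y i"
    proof (rule reduced_vec_eqI)
      show "\<forall>x\<in>last ?V. (\<forall>j<d. co j x = 0) \<longrightarrow> x = 0" using dom[of "length ds - 1"] last_ds lastn by simp
      show "subspace (last ?V)" by (simp add: last subspace_span)
      show "graph_vec y i \<in> last ?V" using graph_vec_in_span[OF i] last by simp
      show "co k (graph_vec y i) = (if i = k then 1 else 0)" if "k < d" for k
        using that i last_le by (simp add: co_graph_vec)
    qed
    then show ?thesis using False i j by (simp add: chart_coord_def co_graph_vec)
  qed
qed

lemma chart_frame_cong:
  assumes "\<And>i j. (i, j) \<in> free_pos \<Longrightarrow> y i j = y' i j"
  shows "chart_frame y = chart_frame y'"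
proof -
  have g: "graph_vec y i = graph_vec y' i" if "i < d" for i
    unfolding graph_vec_def using assms that block(3)[OF that]
    by (intro arg_cong2[of _ _ _ _ "(+)"] sum.cong refl) (auto simp: free_pos_def)
  show ?thesis unfolding chart_frame_def
    using assms g last_le
    by (intro map_cong refl arg_cong2[of _ _ _ _ "(+)"] sum.cong) (auto simp: free_pos_def)
qed

lemma flagD:
  assumes "Vs \<in> flags scl ds" "b < length ds"
  shows "subspace (Vs ! b)" "dim (Vs ! b) = ds ! b" "length Vs = length ds"
    "\<And>a. a \<le> b \<Longrightarrow> Vs ! a \<subseteq> Vs ! b"
proof -
  show "subspace (Vs ! b)" "dim (Vs ! b) = ds ! b" "length Vs = length ds"
    using assms by (auto simp: flags_def)
  fix a assume "a \<le> b"
  then show "Vs ! a \<subseteq> Vs ! b"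
    using assms sorted_wrt_nth_less[of "(\<subseteq>)" Vs a b] by (cases "a = b") (auto simp: flags_def)
qed

lemma reduced_vec_props:
  assumes Vs: "Vs \<in> chart_dom" and b: "b < length ds" and i: "i < ds ! b"
  shows "reduced_vec (Vs ! b) (ds ! b) i \<in> Vs ! b"
    and "\<And>j. j < ds ! b \<Longrightarrow> co j (reduced_vec (Vs ! b) (ds ! b) i) = (if i = j then 1 else 0)"
proof -
  have "Vs \<in> flags scl ds" using Vs by (simp add: chart_dom_def)
  then obtain v where v: "v \<in> frames scl d" "flag_of_frame scl ds v = Vs"
    using flag_has_frame[OF sorted_ds ds_ne] by metis
  let ?s = "ds ! b" and ?M = "coord_matrix v"
  have nz: "fdet ?s ?M \<noteq> 0" using Vs v b flag_in_dom_iff[OF v(1)] by auto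
  have Vb: "Vs ! b = span (set (take ?s v))" using v b flag_of_frame_nth by metis
  have eq: "reduced_vec (Vs ! b) ?s i = (\<Sum>l<?s. scl (fadj ?s ?M i l / fdet ?s ?M) (v ! l))"
    unfolding Vb by (rule reduced_vec_span_take[OF v(1) ds_le[OF b] i nz])
  show "reduced_vec (Vs ! b) (ds ! b) i \<in> Vs ! b"
    unfolding eq unfolding Vb using span_take_iff[of ?s v] length_frame[OF v(1)] ds_le[OF b] by auto
  fix j assume j: "j < ?s"
  have "co j (reduced_vec (Vs ! b) ?s i) = (\<Sum>l<?s. fadj ?s ?M i l * co j (v ! l)) / fdet ?s ?M"
    unfolding eq by (simp add: co_sum co_scale sum_divide_distrib)
  then show "co j (reduced_vec (Vs ! b) ?s i) = (if i = j then 1 else 0)"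
    using fadj_mult[OF i j, of ?M] nz by simp
qed

text \<open>
  A vector of the largest member is determined by its first \<open>d\<close> coordinates.  Comparison of these
  shows that the \<open>i\<close>-th vector of the chart frame is the reduced vector of the member in which it first
  appears.
\<close>

lemma flag_of_chart_frame_coord:
  assumes Vs: "Vs \<in> chart_dom"
  shows "flag_of_frame scl ds (chart_frame (chart_coord Vs)) = Vs"
proof -
  let ?y = "chart_coord Vs"
  have fl: "Vs \<in> flags scl ds" using Vs by (simp add: chart_dom_def)
  note fD = flagD[OF fl]
  have lastV: "last Vs = Vs ! (length ds - 1)"
    using fD(3)[OF last_ds(2)] ds_ne by (metis last_conv_nth length_0_conv)
  have w: "reduced_vec (last Vs) d i \<in> last Vs" "\<And>j. j < d \<Longrightarrow> co j (reduced_vec (last Vs) d i) = (if i = j then 1 else 0)"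
    if "i < d" for i
    using reduced_vec_props[OF Vs last_ds(2), of i] that last_ds lastV by auto
  have gv: "graph_vec ?y i = reduced_vec (last Vs) d i" if "i < d" for i
  proof (rule eqI_co)
    fix j assume j: "j < D"
    show "co j (graph_vec ?y i) = co j (reduced_vec (last Vs) d i)"
      using that j w(2)[OF that] by (simp add: co_graph_vec chart_coord_def)
  qed
  have subd: "subspace (last Vs)" and dom_last: "\<forall>x\<in>last Vs. (\<forall>j<d. co j x = 0) \<longrightarrow> x = 0"
    using fD(1)[OF last_ds(2)] Vs last_ds lastV by (auto simp: chart_dom_def)
  have cf: "chart_frame ?y ! i = reduced_vec (Vs ! block i) (ds ! block i) i" (is "?f = ?g") if i: "i < d" for i
  proof -
    have g: "?g \<in> Vs ! block i" "\<And>j. j < ds ! block i \<Longrightarrow> co j ?g = (if i = j then 1 else 0)"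
      using reduced_vec_props[OF Vs block(1,2)[OF i]] by auto
    have "Vs ! block i \<subseteq> last Vs" unfolding lastV
      using fD(4)[OF last_ds(2), of "block i"] block(1)[OF i] by simp
    then have "?g \<in> last Vs" using g by blast
    moreover have "?f \<in> last Vs"
      unfolding nth_chart_frame[OF i] using gv w(1) i
      by (intro subspace_add[OF subd] subspace_sum[OF subd] subspace_scale[OF subd]) auto
    ultimately have "?f - ?g \<in> last Vs" using subd by (simp add: subspace_diff)
    moreover have "co j (?f - ?g) = 0" if "j < d" for j
      using that i g(2)[of j] block(2)[OF i] by (auto simp: co_diff co_chart_frame chart_coord_def)
    ultimately show ?thesis using dom_last by auto
  qed
  show ?thesis
  proof (rule nth_equalityI)
    show "length (flag_of_frame scl ds (chart_frame ?y)) = length Vs"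
      using fD(3)[OF last_ds(2)] by (simp add: flag_of_frame_def)
    fix b assume "b < length (flag_of_frame scl ds (chart_frame ?y))"
    then have b: "b < length ds" by (simp add: flag_of_frame_def)
    have "set (take (ds ! b) (chart_frame ?y)) \<subseteq> Vs ! b"
    proof
      fix x assume "x \<in> set (take (ds ! b) (chart_frame ?y))"
      then obtain i where i: "i < ds ! b" "x = chart_frame ?y ! i"
        by (auto simp: in_set_conv_nth)
      have "i < d" using i ds_le[OF b] by simp
      then have "x \<in> Vs ! block i" using cf i reduced_vec_props(1)[OF Vs block(1,2)] by metis
      then show "x \<in> Vs ! b" using fD(4)[OF b block_le[OF i(1)]] by blast
    qed
    then have "span (set (take (ds ! b) (chart_frame ?y))) \<subseteq> Vs ! b"
      by (rule span_minimal[OF _ fD(1)[OF b]])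
    moreover have "dim (span (set (take (ds ! b) (chart_frame ?y)))) = ds ! b"
      by (rule dim_span_take[OF chart_frame_in_frames ds_le[OF b]])
    ultimately show "flag_of_frame scl ds (chart_frame ?y) ! b = Vs ! b"
      using subspace_dim_equal[OF subspace_span fD(1)[OF b]] fD(2)[OF b] b
      by (simp add: flag_of_frame_nth del: dim_span)
  qed
qed

lemma open_chart_dom: "openin (zar (flag_variety scl ds)) chart_dom"
proof -
  note alg = fun_algebra_poly_funs[of scl d]
  let ?h = "\<lambda>v. \<Prod>b<length ds. fdet (ds ! b) (coord_matrix v)"
  have "?h \<in> poly_funs scl d"
    using ds_le last_le
    by (intro fun_algebra_prod[OF alg] fun_algebra_fdet[OF alg] co_coord) fastforce+
  then have "openin (zar (quasi_affine (frames scl d) (poly_funs scl d))) {v \<in> frames scl d. ?h v \<noteq> 0}"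
    by (rule openin_principal[OF alg])
  moreover have "{v \<in> frames scl d. ?h v \<noteq> 0} = {v \<in> frames scl d. flag_of_frame scl ds v \<in> chart_dom}"
    using flag_in_dom_iff by blast
  ultimately show ?thesis
    by (auto simp: flag_variety_def openin_quotient_fspace topspace_quasi_affine[OF alg] chart_dom_def)
qed

lemma poly_graph_vec:
  assumes y: "\<And>i j. (i, j) \<in> free_pos \<Longrightarrow> (\<lambda>x. y x i j) \<in> affine_polys m"
    and \<phi>: "Vector_Spaces.linear scl (*) \<phi>" and i: "i < d"
  shows "(\<lambda>x. \<phi> (graph_vec (y x) i)) \<in> affine_polys m"
proof -
  note alg = fun_algebra_poly_funs[of "(*)" m]
  interpret \<phi>: Vector_Spaces.linear scl "(*)" \<phi> by fact
  have "\<phi> (graph_vec (y x) i) = \<phi> (e i) + (\<Sum>j\<in>{d..<D}. y x i j * \<phi> (e j))" for x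
    by (simp add: graph_vec_def \<phi>.add \<phi>.sum \<phi>.scale)
  moreover have "(\<lambda>x. \<phi> (e i) + (\<Sum>j\<in>{d..<D}. y x i j * \<phi> (e j))) \<in> affine_polys m"
    using i block(3)[OF i]
    by (intro fun_algebra_add[OF alg] fun_algebra_const[OF alg] fun_algebra_sum[OF alg]
          fun_algebra_mult[OF alg] y) (auto simp: free_pos_def)
  ultimately show ?thesis by simp
qed

lemma poly_pull_chart_frame:
  assumes y: "\<And>i j. (i, j) \<in> free_pos \<Longrightarrow> (\<lambda>x. y x i j) \<in> affine_polys m"
    and f: "f \<in> poly_funs scl d"
  shows "(\<lambda>x. f (chart_frame (y x))) \<in> affine_polys m"
  using f
proof induction
  case (const c)
  show ?case by (rule poly_funs.const)
next
  case (coord \<phi> i)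
  note alg = fun_algebra_poly_funs[of "(*)" m]
  interpret \<phi>: Vector_Spaces.linear scl "(*)" \<phi> by fact
  have "\<phi> (chart_frame (y x) ! i) = \<phi> (graph_vec (y x) i) +
      (\<Sum>j\<in>{ds ! block i..<d}. y x i j * \<phi> (graph_vec (y x) j))" for x
    by (simp add: nth_chart_frame[OF coord(2)] \<phi>.add \<phi>.sum \<phi>.scale)
  moreover have "(\<lambda>x. \<phi> (graph_vec (y x) i) +
      (\<Sum>j\<in>{ds ! block i..<d}. y x i j * \<phi> (graph_vec (y x) j))) \<in> affine_polys m"
    using coord last_le
    by (intro fun_algebra_add[OF alg] fun_algebra_sum[OF alg] fun_algebra_mult[OF alg] y
          poly_graph_vec[OF y]) (auto simp: free_pos_def)
  ultimately show ?case by simp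
next
  case (add f g)
  from add.IH show ?case by (rule poly_funs.add)
next
  case (mult f g)
  from mult.IH show ?case by (rule poly_funs.mult)
qed

text \<open>
  The coordinates at the positions \<open>ps\<close> are free on \<open>T\<close>, and \<open>ext\<close> recovers all coordinates from
  them.  With all positions in \<open>ps\<close> this gives the charts of the flag variety; leaving out those for
  which the equations are solved will give the charts of the isotropic flags.
\<close>

lemma chart_iso:
  fixes ps :: "(nat \<times> nat) list" and ext :: "complex list \<Rightarrow> nat \<Rightarrow> nat \<Rightarrow> complex"
  assumes ps: "set ps \<subseteq> free_pos" and T: "T \<subseteq> chart_dom"
    and poly: "\<And>i j. (i, j) \<in> free_pos \<Longrightarrow> (\<lambda>x. ext x i j) \<in> affine_polys (length ps)"
    and ext_T: "\<And>x. length x = length ps \<Longrightarrow> flag_of_frame scl ds (chart_frame (ext x)) \<in> T"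
    and ext_ps: "\<And>x k. length x = length ps \<Longrightarrow> k < length ps \<Longrightarrow> case ps ! k of (i, j) \<Rightarrow> ext x i j = x ! k"
    and ext_solved: "\<And>Vs i j. Vs \<in> T \<Longrightarrow> (i, j) \<in> free_pos \<Longrightarrow>
        ext (map (\<lambda>(i, j). chart_coord Vs i j) ps) i j = chart_coord Vs i j"
  shows "iso_fspace (sub_fspace (flag_variety scl ds) T)
    (quasi_affine {x. length x = length ps} (affine_polys (length ps)))
    (\<lambda>Vs. map (\<lambda>(i, j). chart_coord Vs i j) ps)"
proof (rule quotient_chart[where U = chart_dom and \<sigma> = "\<lambda>x. chart_frame (ext x)"])
  show "flag_variety scl ds = quotient_fspace (quasi_affine (frames scl d) (poly_funs scl d))
      (flag_of_frame scl ds) (flags scl ds)" by (rule flag_variety_def)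
  show "fun_algebra (poly_funs scl d)" by (rule fun_algebra_poly_funs)
  show "openin (zar (flag_variety scl ds)) chart_dom" by (rule open_chart_dom)
  show "T \<subseteq> chart_dom" by fact
  show "(\<lambda>x. f (chart_frame (ext x))) \<in> affine_polys (length ps)" if "f \<in> poly_funs scl d" for f
    by (rule poly_pull_chart_frame[OF poly that])
  show "chart_frame (ext x) \<in> frames scl d \<and> flag_of_frame scl ds (chart_frame (ext x)) \<in> T \<and>
      map (\<lambda>(i, j). chart_coord (flag_of_frame scl ds (chart_frame (ext x))) i j) ps = x"
    if x: "length x = length ps" for x
  proof (intro conjI chart_frame_in_frames ext_T x nth_equalityI)
    fix k assume "k < length (map (\<lambda>(i, j). chart_coord (flag_of_frame scl ds (chart_frame (ext x))) i j) ps)"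
    then have k: "k < length ps" by simp
    obtain i j where ij: "ps ! k = (i, j)" by (cases "ps ! k")
    then have "(i, j) \<in> free_pos" using ps k by (metis nth_mem subsetD)
    then show "map (\<lambda>(i, j). chart_coord (flag_of_frame scl ds (chart_frame (ext x))) i j) ps ! k = x ! k"
      using ext_ps[OF x k] ij k by (simp add: chart_coord_chart_frame)
  qed (simp add: x)
  show "flag_of_frame scl ds (chart_frame (ext (map (\<lambda>(i, j). chart_coord Vs i j) ps))) = Vs" if "Vs \<in> T" for Vs
  proof -
    have "chart_frame (ext (map (\<lambda>(i, j). chart_coord Vs i j) ps)) = chart_frame (chart_coord Vs)"
      by (rule chart_frame_cong) (rule ext_solved[OF that])
    then show ?thesis using flag_of_chart_frame_coord that T by auto
  qed
  fix k assume k: "k < length ps"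
  obtain i j where ij: "ps ! k = (i, j)" by (cases "ps ! k")
  then have "(i, j) \<in> free_pos" using ps k by (metis nth_mem subsetD)
  then show "\<exists>g\<in>poly_funs scl d. \<exists>h\<in>poly_funs scl d. \<forall>v\<in>frames scl d. flag_of_frame scl ds v \<in> chart_dom \<longrightarrow>
      h v \<noteq> 0 \<and> map (\<lambda>(i, j). chart_coord (flag_of_frame scl ds v) i j) ps ! k = g v / h v"
    using chart_coord_rational ij k by simp
qed simp

lemma chart_dom_iso:
  "\<exists>p. iso_fspace (sub_fspace (flag_variety scl ds) chart_dom)
    (quasi_affine {x. length x = card free_pos} (affine_polys (card free_pos))) p"
proof -
  obtain ps where ps: "set ps = free_pos" "distinct ps"
    using finite_distinct_list[OF finite_free_pos] by blast
  have l: "length ps = card free_pos" using distinct_card[OF ps(2)] ps(1) by simp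
  have "iso_fspace (sub_fspace (flag_variety scl ds) chart_dom)
    (quasi_affine {x. length x = length ps} (affine_polys (length ps)))
    (\<lambda>Vs. map (\<lambda>(i, j). chart_coord Vs i j) ps)"
  proof (rule chart_iso[where ext = "\<lambda>x i j. x ! pos_index ps (i, j)"])
    show "(\<lambda>x. x ! pos_index ps (i, j)) \<in> affine_polys (length ps)" if "(i, j) \<in> free_pos" for i j
      using that ps by (intro affine_coord pos_index(1)) auto
    show "map (\<lambda>(i, j). chart_coord Vs i j) ps ! pos_index ps (i, j) = chart_coord Vs i j"
      if "Vs \<in> chart_dom" "(i, j) \<in> free_pos" for Vs i j
      using that ps pos_index[OF ps(2), of "(i, j)"] by simp
    show "case ps ! k of (i, j) \<Rightarrow> x ! pos_index ps (i, j) = x ! k"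
      if "length x = length ps" "k < length ps" for x :: "complex list" and k
      using pos_index_nth[OF ps(2) that(2)] by (cases "ps ! k") simp
  qed (use ps chart_frame_in_dom in auto)
  then show ?thesis unfolding l by blast
qed

end

section \<open>Bases and dual families\<close>

context flag_space
begin

text \<open>
  Any flag is the origin of a chart, whose coordinate matrix is the unit matrix there.
\<close>

lemma flag_chart_at_frame:
  assumes es: "es \<in> frames scl D" and D: "dim UNIV = D"
    and ds: "sorted_wrt (<) ds" "ds \<noteq> []" "last ds \<le> D"
  shows "flag_chart scl (\<lambda>i. es ! i) D ds"
    and "flag_of_frame scl ds (take (last ds) es) \<in> flag_chart.chart_dom scl (\<lambda>i. es ! i) D ds"
    and "fdet (last ds) (\<lambda>l j. flag_chart.co scl (\<lambda>i. es ! i) D j (take (last ds) es ! l)) \<noteq> 0"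
proof -
  have l: "length es = D" and dst: "distinct es" and ind: "independent (set es)"
    using es by (auto simp: frames_def)
  have im: "(\<lambda>i. es ! i) ` {..<D} = set es"
    using l by (auto simp: set_conv_nth)
  have sp: "span (set es) = UNIV"
    using card_eq_dim[of "set es" UNIV] ind distinct_card[OF dst] l D by auto
  interpret C: flag_chart scl "\<lambda>i. es ! i" D ds
    by unfold_locales
       (use im sp ind ds dst l in \<open>auto simp: inj_on_def nth_eq_iff_index_eq\<close>)
  show "flag_chart scl (\<lambda>i. es ! i) D ds" ..
  have "C.chart_frame (\<lambda>_ _. 0) = take (last ds) es"
    by (rule nth_equalityI) (use l ds in \<open>auto simp: C.chart_frame_def C.graph_vec_def\<close>)
  then show "flag_of_frame scl ds (take (last ds) es) \<in> C.chart_dom"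
    using C.chart_frame_in_dom[of "\<lambda>_ _. 0"] by simp
  moreover have "take (last ds) es \<in> frames scl (last ds)"
    using C.chart_frame_in_frames[of "\<lambda>_ _. 0"] \<open>C.chart_frame _ = _\<close> by simp
  ultimately have "(\<Prod>b<length ds. fdet (ds ! b) (C.coord_matrix (take (last ds) es))) \<noteq> 0"
    using C.flag_in_dom_iff by blast
  then have "\<forall>b<length ds. fdet (ds ! b) (C.coord_matrix (take (last ds) es)) \<noteq> 0" by simp
  then show "fdet (last ds) (C.coord_matrix (take (last ds) es)) \<noteq> 0"
    using C.last_ds by metis
qed

lemma frame_extends_UNIV:
  assumes "v \<in> frames scl c"
  shows "\<exists>w. v @ w \<in> frames scl (dim UNIV)"
  using frame_extends[OF assms subspace_UNIV] by blast

text \<open>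
  Extend \<open>v\<close> to a basis and take for \<open>h\<close> the minor of the coordinates along \<open>v\<close>.
\<close>

lemma frames_open:
  assumes v: "v \<in> frames scl c"
  shows "\<exists>h\<in>poly_funs scl c. h v \<noteq> 0 \<and> (\<forall>u. length u = c \<and> h u \<noteq> 0 \<longrightarrow> u \<in> frames scl c)"
proof -
  define D where "D = dim (UNIV :: 'e set)"
  obtain w where es: "v @ w \<in> frames scl D" using frame_extends_UNIV[OF v] by (auto simp: D_def)
  have lv: "length v = c" using v by (simp add: frames_def)
  then have c: "c \<le> D" using length_frame[OF es] by simp
  interpret C: flag_chart scl "\<lambda>i. (v @ w) ! i" D "[c]"
    by (rule flag_chart_at_frame(1)[OF es D_def[symmetric]]) (use c in auto)
  let ?h = "\<lambda>u. fdet c (C.coord_matrix u)"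
  have "?h v \<noteq> 0" using flag_chart_at_frame(3)[OF es D_def[symmetric], of "[c]"] c lv by simp
  moreover have "?h \<in> poly_funs scl c"
    using c by (intro fun_algebra_fdet[OF fun_algebra_poly_funs] C.co_coord) auto
  moreover have "u \<in> frames scl c" if u: "length u = c" "?h u \<noteq> 0" for u
    unfolding frames_iff
  proof (intro conjI allI impI)
    fix a l assume a: "(\<Sum>l<c. scl (a l) (u ! l)) = 0" and l: "l < c"
    have "(\<Sum>l<c. a l * C.co j (u ! l)) = C.co j (\<Sum>l<c. scl (a l) (u ! l))" for j
      by (simp add: C.co_sum C.co_scale)
    then have "\<forall>j<c. (\<Sum>l<c. a l * C.co j (u ! l)) = 0" using a by (simp add: C.co_zero)
    then show "a l = 0" using u(2) l unfolding fdet_eq_0_iff by blast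
  qed (rule u(1))
  ultimately show ?thesis by (intro bexI[of _ ?h] conjI allI impI) simp_all
qed

text \<open>
  The corrected vectors still span the whole space, and there are no more of them than its dimension.
\<close>

lemma frame_corrected:
  assumes vw: "v @ w \<in> frames scl (dim UNIV)" and l: "length w' = length w"
    and diff: "\<And>j. j < length w \<Longrightarrow> w' ! j - w ! j \<in> span (set v)"
  shows "v @ w' \<in> frames scl (dim UNIV)"
proof -
  let ?D = "dim (UNIV :: 'e set)"
  have lD: "length (v @ w) = ?D" and ind: "independent (set (v @ w))" and dst: "distinct (v @ w)"
    using vw by (auto simp: frames_def)
  have sp: "UNIV \<subseteq> span (set (v @ w))"
    using card_eq_dim[of "set (v @ w)" UNIV] ind distinct_card[OF dst] lD by auto
  have vsub: "span (set v) \<subseteq> span (set (v @ w'))" by (rule span_mono) simp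
  have "set (v @ w) \<subseteq> span (set (v @ w'))"
  proof
    fix x assume "x \<in> set (v @ w)"
    then consider "x \<in> set v" | j where "j < length w" "x = w ! j" by (auto simp: in_set_conv_nth)
    then show "x \<in> span (set (v @ w'))"
    proof cases
      case 1
      then show ?thesis by (intro span_base) simp
    next
      case 2
      have "w' ! j \<in> span (set (v @ w'))" using 2 l by (intro span_base) simp
      then have "w' ! j - (w' ! j - w ! j) \<in> span (set (v @ w'))"
        by (rule span_diff) (use diff[OF 2(1)] vsub in blast)
      then show ?thesis using 2 by simp
    qed
  qed
  then have sp': "UNIV \<subseteq> span (set (v @ w'))"
    using span_minimal[OF _ subspace_span] sp by blast
  have len: "length (v @ w') = ?D" using lD l by simp
  have "?D \<le> card (set (v @ w'))" using dim_le_card[OF sp'] by simp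
  then have card: "card (set (v @ w')) = length (v @ w')" using card_length[of "v @ w'"] len by linarith
  then have "distinct (v @ w')" by (rule card_distinct)
  moreover have "independent (set (v @ w'))"
    by (rule card_le_dim_spanning[OF subset_UNIV sp' finite_set]) (use card len in simp)
  ultimately show ?thesis using len by (simp add: frames_def)
qed

lemma topspace_flag_variety:
  assumes ds: "sorted_wrt (<) ds"
  shows "topspace (zar (flag_variety scl ds)) = flags scl ds"
proof
  let ?Q = "quasi_affine (frames scl (last ds)) (poly_funs scl (last ds))"
  have top: "topspace (zar ?Q) = frames scl (last ds)"
    by (rule topspace_quasi_affine[OF fun_algebra_poly_funs])
  have op: "openin (zar (flag_variety scl ds)) U \<longleftrightarrow>
      U \<subseteq> flags scl ds \<and> openin (zar ?Q) {v \<in> frames scl (last ds). flag_of_frame scl ds v \<in> U}" for U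
    unfolding flag_variety_def openin_quotient_fspace top ..
  show "topspace (zar (flag_variety scl ds)) \<subseteq> flags scl ds"
    by (rule conjunct1[OF op[THEN iffD1, OF openin_topspace]])
  have "{v \<in> frames scl (last ds). flag_of_frame scl ds v \<in> flags scl ds} = topspace (zar ?Q)"
    using flag_of_frame_in_flags[OF ds] top by blast
  then have "openin (zar (flag_variety scl ds)) (flags scl ds)"
    unfolding op using openin_topspace[of "zar ?Q"] by (metis order_refl)
  then show "flags scl ds \<subseteq> topspace (zar (flag_variety scl ds))" by (rule openin_subset)
qed

text \<open>
  In the inductive step, some \<open>x\<close> is not annihilated by the difference of \<open>f k\<close> and the combination
  of the other functionals that agrees with it on their dual family.  Subtracting from \<open>x\<close> its values
  under the other functionals gives a multiple of the new dual vector.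
\<close>

lemma dual_family:
  assumes "finite J" and lin: "\<And>j. j \<in> J \<Longrightarrow> Vector_Spaces.linear scl (*) (f j)"
    and "\<And>c j. (\<And>x. (\<Sum>j\<in>J. c j * f j x) = 0) \<Longrightarrow> j \<in> J \<Longrightarrow> c j = 0"
  shows "\<exists>a. \<forall>i\<in>J. \<forall>j\<in>J. f j (a i) = (if i = j then 1 else 0)"
  using assms
proof (induction J rule: finite_induct)
  case empty
  then show ?case by simp
next
  case (insert k J)
  have "c j = 0" if c: "\<And>x. (\<Sum>j\<in>J. c j * f j x) = 0" and j: "j \<in> J" for c j
  proof -
    have "(\<Sum>j\<in>insert k J. (if j = k then 0 else c j) * f j x) = 0" for x
    proof -
      have "(\<Sum>j\<in>insert k J. (if j = k then 0 else c j) * f j x) = (\<Sum>j\<in>J. c j * f j x)"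
        using insert.hyps by (auto intro: sum.cong)
      then show ?thesis using c by simp
    qed
    from insert.prems(2)[OF this, of j] show ?thesis using j insert.hyps(2) by (auto split: if_splits)
  qed
  then obtain a where a: "\<forall>i\<in>J. \<forall>j\<in>J. f j (a i) = (if i = j then 1 else 0)"
    using insert.IH insert.prems(1) by blast
  have "\<exists>x. f k x - (\<Sum>i\<in>J. f k (a i) * f i x) \<noteq> 0"
  proof (rule ccontr)
    assume "\<not> ?thesis"
    then have 0: "f k x - (\<Sum>i\<in>J. f k (a i) * f i x) = 0" for x by blast
    have "(\<Sum>j\<in>insert k J. (if j = k then 1 else - f k (a j)) * f j x) = 0" for x
    proof -
      have "(\<Sum>j\<in>J. (if j = k then 1 else - f k (a j)) * f j x) = (\<Sum>j\<in>J. - (f k (a j) * f j x))"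
        by (rule sum.cong) (use insert.hyps in auto)
      then show ?thesis using 0[of x] insert.hyps by (simp add: sum_negf)
    qed
    from insert.prems(2)[OF this, of k] show False by simp
  qed
  then obtain x where x: "f k x - (\<Sum>i\<in>J. f k (a i) * f i x) \<noteq> 0" by blast
  define g where "g = f k x - (\<Sum>i\<in>J. f k (a i) * f i x)"
  define x' where "x' = x - (\<Sum>i\<in>J. scl (f i x) (a i))"
  define ak where "ak = scl (1 / g) x'"
  have fx': "f j x' = f j x - (\<Sum>i\<in>J. f i x * f j (a i))" if "j \<in> insert k J" for j
  proof -
    interpret Vector_Spaces.linear scl "(*)" "f j" by (rule insert.prems(1)[OF that])
    show ?thesis by (simp add: x'_def diff sum scale)
  qed
  have 1: "f j x' = 0" if "j \<in> J" for j
  proof -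
    have "(\<Sum>i\<in>J. f i x * f j (a i)) = (\<Sum>i\<in>J. if i = j then f i x else 0)"
      by (rule sum.cong) (use a that in auto)
    then show ?thesis using fx'[of j] that insert.hyps(1) by simp
  qed
  have 2: "f k x' = g" using fx'[of k] by (simp add: g_def mult.commute)
  have ak: "f j ak = (if j = k then 1 else 0)" if j: "j \<in> insert k J" for j
  proof -
    interpret Vector_Spaces.linear scl "(*)" "f j" by (rule insert.prems(1)[OF j])
    show ?thesis using 1 2 x j by (auto simp: ak_def scale g_def)
  qed
  define b where "b = (\<lambda>i. if i = k then ak else a i - scl (f k (a i)) ak)"
  have "f j (b i) = (if i = j then 1 else 0)" if ij: "i \<in> insert k J" "j \<in> insert k J" for i j
  proof -
    interpret Vector_Spaces.linear scl "(*)" "f j" by (rule insert.prems(1)[OF ij(2)])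
    have "f j (b i) = (if i = k then f j ak else f j (a i) - f k (a i) * f j ak)"
      by (simp add: b_def diff scale)
    then show ?thesis using ak ij a insert.hyps(2) by auto
  qed
  then show ?case by blast
qed

text \<open>
  If \<open>f s\<close> does not vanish on the common kernel of the functionals before it, this kernel is spanned by
  the vectors in it that \<open>f s\<close> annihilates and one more.
\<close>

lemma dim_common_kernel:
  assumes "\<And>i. i < s \<Longrightarrow> Vector_Spaces.linear scl (*) (f i)"
  shows "dim UNIV \<le> dim {x. \<forall>i<s. f i x = 0} + s"
  using assms
proof (induction s)
  case 0
  then show ?case by simp
next
  case (Suc s)
  interpret Vector_Spaces.linear scl "(*)" "f s" using Suc.prems by simp
  let ?S = "{x. \<forall>i<s. f i x = 0}" and ?S' = "{x. \<forall>i<Suc s. f i x = 0}"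
  have "dim ?S \<le> dim ?S' + 1"
  proof (cases "?S \<subseteq> ?S'")
    case True
    then show ?thesis using dim_subset[OF True] by simp
  next
    case False
    then obtain y where y: "y \<in> ?S" "f s y \<noteq> 0" by (auto simp: less_Suc_eq)
    have "?S \<subseteq> span (insert y ?S')"
    proof
      fix x assume x: "x \<in> ?S"
      have "x - scl (f s x / f s y) y \<in> ?S'"
      proof (intro CollectI allI impI)
        fix i assume i: "i < Suc s"
        interpret i: Vector_Spaces.linear scl "(*)" "f i" using Suc.prems i by simp
        have "f i (x - scl (f s x / f s y) y) = f i x - f s x / f s y * f i y"
          by (simp only: i.diff i.scale)
        then show "f i (x - scl (f s x / f s y) y) = 0"
          using x y i by (cases "i = s") auto
      qed
      then show "x \<in> span (insert y ?S')"
        unfolding span_breakdown_eq by (intro exI[of _ "f s x / f s y"]) (rule span_base)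
    qed
    then have "dim ?S \<le> dim (insert y ?S')" by (rule dim_mono)
    also have "\<dots> \<le> dim ?S' + 1" by (simp add: dim_insert)
    finally show ?thesis .
  qed
  then show ?case using Suc by simp
qed

end

section \<open>Skew-forms\<close>

locale skew_space = flag_space scl Basis
  for scl :: "complex \<Rightarrow> 'e::ab_group_add \<Rightarrow> 'e" and Basis +
  fixes \<omega> :: "'e \<Rightarrow> 'e \<Rightarrow> complex"
  assumes skew: "skew_form scl \<omega>"
begin

lemma \<omega>_right: "Vector_Spaces.linear scl (*) (\<omega> x)"
  and \<omega>_left: "Vector_Spaces.linear scl (*) (\<lambda>x. \<omega> x y)"
  using skew unfolding skew_form_def by blast+

lemma \<omega>_skew: "\<omega> x y = - \<omega> y x"
  using skew unfolding skew_form_def by blast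

lemma \<omega>_add: "\<omega> (x + x') y = \<omega> x y + \<omega> x' y" "\<omega> x (y + y') = \<omega> x y + \<omega> x y'"
  and \<omega>_scale: "\<omega> (scl c x) y = c * \<omega> x y" "\<omega> x (scl c y) = c * \<omega> x y"
  using \<omega>_right[of x] \<omega>_left[of y] by (auto simp: Vector_Spaces.linear_iff)

lemma \<omega>_zero: "\<omega> 0 y = 0" "\<omega> x 0 = 0"
  using \<omega>_scale(1)[of 0 0 y] \<omega>_scale(2)[of x 0 0] by auto

lemma \<omega>_diff: "\<omega> (x - x') y = \<omega> x y - \<omega> x' y" "\<omega> x (y - y') = \<omega> x y - \<omega> x y'"
  by (simp_all add: eq_diff_eq flip: \<omega>_add)

lemma \<omega>_sum: "\<omega> (\<Sum>i\<in>I. f i) y = (\<Sum>i\<in>I. \<omega> (f i) y)" "\<omega> x (\<Sum>i\<in>I. f i) = (\<Sum>i\<in>I. \<omega> x (f i))"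
  by (induction I rule: infinite_finite_induct) (auto simp: \<omega>_zero \<omega>_add)

lemma \<omega>_self: "\<omega> x x = 0"
  using \<omega>_skew[of x x] by simp

lemma subspace_perp: "subspace {x. \<omega> x y = 0}"
  by (rule subspaceI) (auto simp: \<omega>_add \<omega>_scale \<omega>_zero)

lemma isotropic_span: "isotropic \<omega> (span S) \<longleftrightarrow> (\<forall>x\<in>S. \<forall>y\<in>S. \<omega> x y = 0)"
proof
  assume S: "\<forall>x\<in>S. \<forall>y\<in>S. \<omega> x y = 0"
  have 1: "\<omega> x y = 0" if "x \<in> span S" "y \<in> S" for x y
    using span_minimal[OF _ subspace_perp[of y], of S] S that by blast
  have "\<omega> x y = 0" if "x \<in> span S" "y \<in> span S" for x y
  proof -
    have "\<omega> z x = 0" if "z \<in> S" for z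
      using 1[OF \<open>x \<in> span S\<close> that] \<omega>_skew[of z x] by simp
    then have "S \<subseteq> {z. \<omega> z x = 0}" by blast
    then have "\<omega> y x = 0" using span_minimal[OF _ subspace_perp] that(2) by blast
    then show ?thesis using \<omega>_skew[of x y] by simp
  qed
  then show "isotropic \<omega> (span S)" by (simp add: isotropic_def)
next
  assume "isotropic \<omega> (span S)"
  then show "\<forall>x\<in>S. \<forall>y\<in>S. \<omega> x y = 0" by (simp add: isotropic_def span_base)
qed

lemma isotropic_flag_iff:
  assumes "Vs \<in> flags scl ds" "ds \<noteq> []"
  shows "Vs \<in> isotropic_flags scl \<omega> ds \<longleftrightarrow> isotropic \<omega> (last Vs)"
proof -
  have Vs: "sorted_wrt (\<subseteq>) Vs" "Vs \<noteq> []" using assms by (auto simp: flags_def)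
  have "V \<subseteq> last Vs" if "V \<in> set Vs" for V
  proof -
    have "Vs = butlast Vs @ [last Vs]" using Vs by simp
    then have "sorted_wrt (\<subseteq>) (butlast Vs @ [last Vs])" "V \<in> set (butlast Vs @ [last Vs])"
      using Vs that by metis+
    then show ?thesis by (auto simp: sorted_wrt_append)
  qed
  then have "(\<forall>V\<in>set Vs. isotropic \<omega> V) \<longleftrightarrow> isotropic \<omega> (last Vs)"
    using last_in_set[OF Vs(2)] unfolding isotropic_def by blast
  then show ?thesis using assms(1) by (simp add: isotropic_flags_def)
qed

definition isotropic_frames :: "nat \<Rightarrow> 'e list set" where
  "isotropic_frames c = {v \<in> frames scl c. \<forall>x\<in>set v. \<forall>y\<in>set v. \<omega> x y = 0}"

lemma isotropic_flag_of_frame: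
  assumes "sorted_wrt (<) ds" "ds \<noteq> []" "v \<in> frames scl (last ds)"
  shows "flag_of_frame scl ds v \<in> isotropic_flags scl \<omega> ds \<longleftrightarrow> v \<in> isotropic_frames (last ds)"
proof -
  have "last (flag_of_frame scl ds v) = span (set v)"
    using assms by (simp add: flag_of_frame_def last_map frames_def)
  then show ?thesis
    using isotropic_flag_iff[OF flag_of_frame_in_flags[OF assms(1,3)] assms(2)] assms(3)
    by (simp add: isotropic_span isotropic_frames_def)
qed

section \<open>Chains of isotropic frames\<close>

text \<open>
  The condition on \<open>\<omega>\<close> says that for each \<open>t\<close> the vectors \<open>v\<^sub>i + t (w\<^sub>i - v\<^sub>i)\<close> are orthogonal to
  each other: as \<open>v\<close> and \<open>w\<close> are isotropic, only the mixed term, with factor \<open>t (1 - t)\<close>, is left.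
  The spans of \<open>v\<close> and \<open>w\<close> need not be orthogonal to each other.
\<close>

definition linked :: "'e list \<Rightarrow> 'e list \<Rightarrow> bool" where
  "linked v w \<longleftrightarrow> (\<exists>c. v \<in> isotropic_frames c \<and> w \<in> isotropic_frames c \<and>
     (\<forall>i<c. \<forall>j<c. \<omega> (v ! i) (w ! j) + \<omega> (w ! i) (v ! j) = 0))"

lemma linked_if_same_span:
  assumes "v \<in> isotropic_frames c" "w \<in> isotropic_frames c" "span (set v) = span (set w)"
  shows "linked v w"
proof -
  have iso: "isotropic \<omega> (span (set w))" using assms by (simp add: isotropic_span isotropic_frames_def)
  have "length v = c" "length w = c" using assms by (auto simp: isotropic_frames_def frames_def)
  then have "v ! i \<in> span (set v)" "w ! i \<in> span (set w)" if "i < c" for i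
    using that by (auto intro: span_base)
  then have "v ! i \<in> span (set w)" "w ! i \<in> span (set w)" if "i < c" for i
    using that assms(3) by auto
  then have "\<forall>i<c. \<forall>j<c. \<omega> (v ! i) (w ! j) + \<omega> (w ! i) (v ! j) = 0"
    using iso by (simp add: isotropic_def)
  then show ?thesis using assms(1,2) unfolding linked_def by blast
qed

lemma frame_snocI:
  assumes "h \<in> frames scl c" "x \<notin> span (set h)"
  shows "h @ [x] \<in> frames scl (Suc c)"
  using assms independent_insertI[OF assms(2)] span_superset[of "set h"] by (auto simp: frames_def)

text \<open>
  If \<open>z\<close> is orthogonal to \<open>V = span (set v)\<close>, any hyperplane of \<open>V\<close> that contains \<open>V \<inter> W\<close> will do.
  Otherwise the vectors of \<open>V\<close> orthogonal to \<open>z\<close> form a hyperplane, which contains \<open>V \<inter> W\<close> because \<open>W\<close>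
  is isotropic.
\<close>

lemma adapted_hyperplane:
  assumes v: "v \<in> isotropic_frames c" and w: "w \<in> isotropic_frames c"
    and z: "z \<in> span (set w)" and ne: "\<not> span (set v) \<subseteq> span (set w)"
  obtains h x where "h @ [x] \<in> frames scl c" "span (set (h @ [x])) = span (set v)"
    "span (set v) \<inter> span (set w) \<subseteq> span (set h)" "\<forall>y\<in>set h. \<omega> y z = 0"
proof -
  let ?V = "span (set v)" and ?W = "span (set w)"
  have dimV: "dim ?V = c" and isoW: "isotropic \<omega> ?W"
    using v w dim_span_take[of v c c]
    by (auto simp: isotropic_frames_def frames_def isotropic_span simp del: dim_span)
  have nil: "[] \<in> frames scl 0" by (simp add: frames_def independent_empty)
  obtain u where u: "u \<in> frames scl (dim (?V \<inter> ?W))" "span (set u) = ?V \<inter> ?W"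
    using frame_extends[OF nil subspace_inter[OF subspace_span subspace_span], of "set v" "set w"] by auto
  have uV: "set u \<subseteq> ?V" "set u \<subseteq> ?W" using u(2) span_superset[of "set u"] by auto
  show thesis
  proof (cases "\<forall>y\<in>?V. \<omega> y z = 0")
    case True
    obtain u' where u': "u @ u' \<in> frames scl c" "span (set (u @ u')) = ?V"
      using frame_extends[OF u(1) subspace_span uV(1)] dimV by auto
    have "u' \<noteq> []"
    proof
      assume "u' = []"
      then have "?V = ?V \<inter> ?W" using u' u(2) by simp
      then show False using ne by blast
    qed
    then have eq: "u @ u' = (u @ butlast u') @ [last u']" by simp
    show thesis
    proof (rule that[of "u @ butlast u'" "last u'"])
      show "(u @ butlast u') @ [last u'] \<in> frames scl c" "span (set ((u @ butlast u') @ [last u'])) = ?V"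
        using u' eq by metis+
      show "?V \<inter> ?W \<subseteq> span (set (u @ butlast u'))"
        unfolding u(2)[symmetric] by (rule span_mono) auto
      have "set (u @ butlast u') \<subseteq> ?V"
        using u'(2) span_superset[of "set (u @ u')"] in_set_butlastD[of _ u'] by auto
      then show "\<forall>y\<in>set (u @ butlast u'). \<omega> y z = 0" using True by blast
    qed
  next
    case False
    then obtain y where y: "y \<in> ?V" "\<omega> y z \<noteq> 0" by blast
    let ?S = "?V \<inter> {x. \<omega> x z = 0}"
    have S: "subspace ?S" by (intro subspace_inter subspace_span subspace_perp)
    have "set u \<subseteq> ?S" using uV z isoW by (auto simp: isotropic_def)
    then obtain h' where h: "u @ h' \<in> frames scl (dim ?S)" "span (set (u @ h')) = ?S"
      using frame_extends[OF u(1) S] by blast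
    let ?h = "u @ h'"
    have "y \<notin> span (set ?h)" using h y by auto
    then have f: "?h @ [y] \<in> frames scl (Suc (dim ?S))" by (rule frame_snocI[OF h(1)])
    have sp: "span (set (?h @ [y])) = ?V"
    proof
      have "set (?h @ [y]) \<subseteq> ?V" using h(2) span_superset[of "set ?h"] y by auto
      then show "span (set (?h @ [y])) \<subseteq> ?V" by (rule span_minimal) (rule subspace_span)
      show "?V \<subseteq> span (set (?h @ [y]))"
      proof
        fix x assume x: "x \<in> ?V"
        have "x - scl (\<omega> x z / \<omega> y z) y \<in> ?S"
          using x y by (auto simp: \<omega>_diff \<omega>_scale intro: span_diff span_scale)
        then have "x - scl (\<omega> x z / \<omega> y z) y \<in> span (set ?h)" using h(2) by simp
        then have "x \<in> span (insert y (set ?h))" unfolding span_breakdown_eq by blast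
        moreover have "set (?h @ [y]) = insert y (set ?h)" by auto
        ultimately show "x \<in> span (set (?h @ [y]))" by simp
      qed
    qed
    have "dim (span (set (?h @ [y]))) = Suc (dim ?S)"
      using dim_span_take[OF f order_refl] length_frame[OF f] by (simp del: dim_span)
    then have "Suc (dim ?S) = c" using sp dimV by metis
    show thesis
    proof (rule that[of ?h y])
      show "?h @ [y] \<in> frames scl c" using f \<open>Suc _ = c\<close> by simp
      show "?V \<inter> ?W \<subseteq> span (set ?h)" unfolding u(2)[symmetric] by (rule span_mono) auto
      show "\<forall>y\<in>set ?h. \<omega> y z = 0" using h(2) span_superset[of "set ?h"] by auto
    qed (rule sp)
  qed
qed

text \<open>
  As long as the spans \<open>V\<close> and \<open>W\<close> of the two frames differ, take \<open>z\<close> in \<open>W\<close> but not in \<open>V\<close> and a hyperplane \<open>H\<close> of \<open>V\<close> that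
  contains \<open>V \<inter> W\<close> and is orthogonal to \<open>z\<close>: the isotropic space \<open>H + z\<close> has a larger
  intersection with \<open>W\<close>.
\<close>

lemma isotropic_frames_chain:
  assumes "v \<in> isotropic_frames c" "w \<in> isotropic_frames c"
  shows "linked\<^sup>*\<^sup>* v w"
  using assms
proof (induction "c - dim (span (set v) \<inter> span (set w))" arbitrary: v rule: less_induct)
  case less
  note v = less.prems(1) and w = less.prems(2)
  let ?V = "span (set v)" and ?W = "span (set w)"
  have dims: "dim ?V = c" "dim ?W = c"
    using v w dim_span_take[of v c c] dim_span_take[of w c c]
    by (auto simp: isotropic_frames_def frames_def simp del: dim_span)
  show ?case
  proof (cases "?V = ?W")
    case True
    then show ?thesis using linked_if_same_span[OF v w] by blast
  next
    case False
    have "\<not> ?W \<subseteq> ?V" "\<not> ?V \<subseteq> ?W"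
      using False subspace_dim_equal[OF subspace_span subspace_span, of "set w" "set v"]
        subspace_dim_equal[OF subspace_span subspace_span, of "set v" "set w"] dims by auto
    then obtain z where z: "z \<in> ?W" "z \<notin> ?V" by blast
    obtain h x where hx: "h @ [x] \<in> frames scl c" "span (set (h @ [x])) = ?V"
      "?V \<inter> ?W \<subseteq> span (set h)" "\<forall>y\<in>set h. \<omega> y z = 0"
      using adapted_hyperplane[OF v w z(1) \<open>\<not> ?V \<subseteq> ?W\<close>] by blast
    have isoV: "isotropic \<omega> ?V" and isoW: "isotropic \<omega> ?W"
      using v w by (auto simp: isotropic_span isotropic_frames_def)
    have v1: "h @ [x] \<in> isotropic_frames c"
      using hx(1) isoV hx(2) isotropic_span[of "set (h @ [x])"] by (simp add: isotropic_frames_def)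
    have hV: "span (set h) \<subseteq> ?V" unfolding hx(2)[symmetric] by (rule span_mono) auto
    have c: "c = Suc (length h)" using length_frame[OF hx(1)] by simp
    have "h \<in> frames scl (length h)"
      using hx(1) independent_mono[of "set (h @ [x])" "set h"] by (auto simp: frames_def)
    then have v2f: "h @ [z] \<in> frames scl c"
      using frame_snocI[of h "length h" z] hV z(2) c by blast
    have v2: "h @ [z] \<in> isotropic_frames c"
    proof -
      have "\<forall>y\<in>set h. \<omega> z y = 0" using hx(4) \<omega>_skew by (metis neg_equal_0_iff_equal)
      then show ?thesis using v1 v2f hx(4) by (auto simp: isotropic_frames_def \<omega>_self)
    qed
    have "linked v (h @ [x])" by (rule linked_if_same_span[OF v v1 hx(2)[symmetric]])
    moreover have "linked (h @ [x]) (h @ [z])"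
    proof -
      have hh: "\<omega> a b = 0" if "a \<in> set (h @ [x])" "b \<in> set (h @ [x])" for a b
        using v1 that unfolding isotropic_frames_def by blast
      have hz: "\<omega> a b = 0" if "a \<in> set (h @ [z])" "b \<in> set (h @ [z])" for a b
        using v2 that unfolding isotropic_frames_def by blast
      have "\<omega> ((h @ [x]) ! i) ((h @ [z]) ! j) + \<omega> ((h @ [z]) ! i) ((h @ [x]) ! j) = 0"
        if "i < c" "j < c" for i j
        using that hh hz \<omega>_skew[of x z] c by (auto simp: nth_append less_Suc_eq)
      then show ?thesis using v1 v2 unfolding linked_def by blast
    qed
    moreover have "linked\<^sup>*\<^sup>* (h @ [z]) w"
    proof (rule less.hyps[OF _ v2 w])
      let ?V2 = "span (set (h @ [z]))"
      have "insert z (?V \<inter> ?W) \<subseteq> ?V2 \<inter> ?W"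
        using hx(3) z(1) span_mono[of "set h" "set (h @ [z])"] span_base[of z "set (h @ [z])"] by auto
      then have "dim (insert z (?V \<inter> ?W)) \<le> dim (?V2 \<inter> ?W)" by (rule dim_subset)
      moreover have "dim (insert z (?V \<inter> ?W)) = dim (?V \<inter> ?W) + 1"
      proof -
        have "span (?V \<inter> ?W) \<subseteq> ?V" by (rule span_minimal) (auto simp: subspace_span)
        then show ?thesis using z(2) by (auto simp: dim_insert)
      qed
      moreover have "dim (?V2 \<inter> ?W) \<le> c" using dim_subset[of "?V2 \<inter> ?W" ?W] dims(2) by auto
      ultimately show "c - dim (?V2 \<inter> ?W) < c - dim (?V \<inter> ?W)" by linarith
    qed
    ultimately show ?thesis by (meson converse_rtranclp_into_rtranclp)
  qed
qed

text \<open>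
  On the line through two linked frames all tuples are isotropic, and almost all of them are frames.
  Both open sets contain almost all flags on the line.
\<close>

lemma linked_flags_meet:
  assumes vw: "linked v w" and v: "v \<in> frames scl (last ds)"
    and ds: "sorted_wrt (<) ds" "ds \<noteq> []"
    and A: "openin (zar (flag_variety scl ds)) A" "flag_of_frame scl ds v \<in> A"
    and B: "openin (zar (flag_variety scl ds)) B" "flag_of_frame scl ds w \<in> B"
  shows "A \<inter> B \<inter> isotropic_flags scl \<omega> ds \<noteq> {}"
proof -
  let ?d = "last ds" and ?P = "frames scl (last ds)"
  note alg = fun_algebra_poly_funs[of scl ?d]
  have lv: "length v = ?d" using v by (simp add: frames_def)
  have iso: "v \<in> isotropic_frames ?d" "w \<in> isotropic_frames ?d"
    and link: "\<And>i j. i < ?d \<Longrightarrow> j < ?d \<Longrightarrow> \<omega> (v ! i) (w ! j) + \<omega> (w ! i) (v ! j) = 0"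
    using vw lv by (auto simp: linked_def isotropic_frames_def frames_def)
  have w: "w \<in> ?P" and lw: "length w = ?d" using iso by (auto simp: isotropic_frames_def frames_def)
  have open_pre: "\<exists>f\<in>poly_funs scl ?d. f u \<noteq> 0 \<and>
      (\<forall>y\<in>?P. f y \<noteq> 0 \<longrightarrow> flag_of_frame scl ds y \<in> C)"
    if C: "openin (zar (flag_variety scl ds)) C" "flag_of_frame scl ds u \<in> C" "u \<in> ?P" for C u
  proof -
    have "openin (zar (quasi_affine ?P (poly_funs scl ?d))) {v \<in> ?P. flag_of_frame scl ds v \<in> C}"
      using C(1) by (simp add: flag_variety_def openin_quotient_fspace topspace_quasi_affine[OF alg])
    moreover have "u \<in> {v \<in> ?P. flag_of_frame scl ds v \<in> C}" using C by simp
    ultimately obtain f where "f \<in> poly_funs scl ?d" "f u \<noteq> 0"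
      "{y \<in> ?P. f y \<noteq> 0} \<subseteq> {v \<in> ?P. flag_of_frame scl ds v \<in> C}"
      unfolding openin_quasi_affine[OF alg] by blast
    then show ?thesis by blast
  qed
  obtain f where f: "f \<in> poly_funs scl ?d" "f v \<noteq> 0" "\<forall>y\<in>?P. f y \<noteq> 0 \<longrightarrow> flag_of_frame scl ds y \<in> A"
    using open_pre[OF A v] by blast
  obtain g where g: "g \<in> poly_funs scl ?d" "g w \<noteq> 0" "\<forall>y\<in>?P. g y \<noteq> 0 \<longrightarrow> flag_of_frame scl ds y \<in> B"
    using open_pre[OF B w] by blast
  obtain h where h: "h \<in> poly_funs scl ?d" "h v \<noteq> 0" "\<forall>u. length u = ?d \<and> h u \<noteq> 0 \<longrightarrow> u \<in> ?P"
    using frames_open[OF v] by blast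
  obtain t where t: "f (line_point scl v w t) * h (line_point scl v w t) \<noteq> 0" "g (line_point scl v w t) \<noteq> 0"
    using nonzero_on_line[OF vector_space_axioms fun_algebra_mult[OF alg f(1) h(1)] g(1) lv lw] f(2) h(2) g(2)
    by auto
  define u where "u = line_point scl v w t"
  have lu: "length u = ?d" by (simp add: u_def line_point_def lv)
  have u: "u \<in> ?P" using h(3) t(1) lu by (simp add: u_def)
  have "\<omega> (u ! i) (u ! j) = 0" if ij: "i < ?d" "j < ?d" for i j
  proof -
    have "\<omega> (v ! i) (v ! j) = 0" "\<omega> (w ! i) (w ! j) = 0"
      using iso ij lv lw by (auto simp: isotropic_frames_def)
    moreover have uij: "u ! i = v ! i + scl t (w ! i - v ! i)" "u ! j = v ! j + scl t (w ! j - v ! j)"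
      using ij lv by (simp_all add: u_def line_point_def)
    ultimately have "\<omega> (u ! i) (u ! j) = t * (1 - t) * (\<omega> (v ! i) (w ! j) + \<omega> (w ! i) (v ! j))"
      unfolding uij by (simp add: \<omega>_add \<omega>_scale \<omega>_diff) (simp add: algebra_simps)
    then show ?thesis using link[OF ij] by simp
  qed
  then have "u \<in> isotropic_frames ?d" using u lu by (auto simp: isotropic_frames_def in_set_conv_nth)
  then have "flag_of_frame scl ds u \<in> isotropic_flags scl \<omega> ds"
    using isotropic_flag_of_frame[OF ds u] by simp
  moreover have "flag_of_frame scl ds u \<in> A \<inter> B" using f(3) g(3) t u by (simp add: u_def)
  ultimately show ?thesis by blast
qed

text \<open>
  A frame of \<open>c\<close> isotropic vectors can be extended as long as its orthogonal complement, of codimension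
  at most \<open>c\<close>, is larger than its span.
\<close>

lemma isotropic_frame_exists:
  assumes "2 * c \<le> dim UNIV + 1"
  shows "\<exists>v. v \<in> isotropic_frames c"
  using assms
proof (induction c)
  case 0
  have "[] \<in> isotropic_frames 0" by (simp add: isotropic_frames_def frames_def independent_empty)
  then show ?case by blast
next
  case (Suc c)
  then obtain v where v: "v \<in> isotropic_frames c" by auto
  have lv: "length v = c" and vf: "v \<in> frames scl c" using v by (auto simp: isotropic_frames_def frames_def)
  let ?P = "{x. \<forall>i<c. \<omega> (v ! i) x = 0}"
  have "dim UNIV \<le> dim ?P + c" by (rule dim_common_kernel) (rule \<omega>_right)
  then have "c < dim ?P" using Suc.prems by simp
  moreover have "dim (span (set v)) = c" using dim_span_take[OF vf order_refl] lv by simp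
  ultimately have "\<not> ?P \<subseteq> span (set v)" using dim_subset[of ?P "span (set v)"] by linarith
  then obtain x where x: "x \<in> ?P" "x \<notin> span (set v)" by blast
  have "v @ [x] \<in> frames scl (Suc c)" by (rule frame_snocI[OF vf x(2)])
  moreover have vx: "\<omega> y x = 0" if "y \<in> set v" for y
    using that x(1) lv by (auto simp: in_set_conv_nth)
  moreover have "\<omega> x y = 0" if "y \<in> set v" for y
    using vx[OF that] \<omega>_skew[of x y] by simp
  ultimately have "v @ [x] \<in> isotropic_frames (Suc c)"
    using v by (auto simp: isotropic_frames_def \<omega>_self)
  then show ?case by blast
qed

lemma closed_isotropic_flags:
  assumes ds: "sorted_wrt (<) ds" "ds \<noteq> []"
  shows "closedin (zar (flag_variety scl ds)) (isotropic_flags scl \<omega> ds)"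
proof -
  let ?d = "last ds" and ?P = "frames scl (last ds)"
  note alg = fun_algebra_poly_funs[of scl ?d]
  have top: "topspace (zar (quasi_affine ?P (poly_funs scl ?d))) = ?P" by (rule topspace_quasi_affine[OF alg])
  have pre: "{v \<in> ?P. flag_of_frame scl ds v \<in> flags scl ds} = ?P"
    using flag_of_frame_in_flags[OF ds(1)] by blast
  note topX = topspace_flag_variety[OF ds(1)]
  have \<omega>_poly: "(\<lambda>v. \<omega> (v ! i) (v ! j)) \<in> poly_funs scl ?d" if ij: "i < ?d" "j < ?d" for i j
  proof -
    have expand: "\<omega> x y = (\<Sum>b\<in>Basis. representation Basis x b * \<omega> b y)" for x y
    proof -
      have "x = (\<Sum>b\<in>Basis. scl (representation Basis x b) b)"
        by (rule sum_representation_eq[symmetric])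
           (auto simp: independent_Basis span_Basis finite_Basis)
      then have "\<omega> x y = \<omega> (\<Sum>b\<in>Basis. scl (representation Basis x b) b) y" by simp
      then show ?thesis by (simp add: \<omega>_sum \<omega>_scale)
    qed
    have eq: "(\<lambda>v. \<omega> (v ! i) (v ! j)) =
        (\<lambda>v. \<Sum>b\<in>Basis. representation Basis (v ! i) b * \<omega> b (v ! j))"
      by (rule ext) (rule expand)
    show ?thesis
      unfolding eq
      by (intro fun_algebra_sum[OF alg] fun_algebra_mult[OF alg] poly_funs.coord[OF _ ij(1)]
            poly_funs.coord[OF _ ij(2)] \<omega>_right linear_representation[OF independent_Basis span_Basis])
  qed
  have "openin (zar (quasi_affine ?P (poly_funs scl ?d)))
      (\<Union>i\<in>{..<?d}. \<Union>j\<in>{..<?d}. {v \<in> ?P. \<omega> (v ! i) (v ! j) \<noteq> 0})"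
    by (intro openin_Union) (auto intro!: openin_Union openin_principal[OF alg] \<omega>_poly)
  moreover have "(\<Union>i\<in>{..<?d}. \<Union>j\<in>{..<?d}. {v \<in> ?P. \<omega> (v ! i) (v ! j) \<noteq> 0}) =
      {v \<in> ?P. flag_of_frame scl ds v \<in> flags scl ds - isotropic_flags scl \<omega> ds}" (is "?L = ?R")
  proof (intro equalityI subsetI)
    fix v assume "v \<in> ?L"
    then obtain i j where v: "v \<in> ?P" "i < ?d" "j < ?d" "\<omega> (v ! i) (v ! j) \<noteq> 0" by blast
    then have "v ! i \<in> set v" "v ! j \<in> set v" using length_frame[OF v(1)] by auto
    then have "v \<notin> isotropic_frames ?d" using v(4) unfolding isotropic_frames_def by blast
    moreover note v(1)
    ultimately show "v \<in> ?R" using pre isotropic_flag_of_frame[OF ds] by blast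
  next
    fix v assume "v \<in> ?R"
    then have v: "v \<in> ?P" "v \<notin> isotropic_frames ?d" using isotropic_flag_of_frame[OF ds] by auto
    then obtain x y where "x \<in> set v" "y \<in> set v" "\<omega> x y \<noteq> 0" by (auto simp: isotropic_frames_def)
    then obtain i j where "i < ?d" "j < ?d" "\<omega> (v ! i) (v ! j) \<noteq> 0"
      using length_frame[OF v(1)] by (metis in_set_conv_nth)
    then show "v \<in> ?L" using v(1) by blast
  qed
  ultimately have "openin (zar (flag_variety scl ds)) (flags scl ds - isotropic_flags scl \<omega> ds)"
    by (simp add: flag_variety_def openin_quotient_fspace top)
  then show ?thesis by (simp add: closedin_def topX isotropic_flags_def)
qed

end

section \<open>Affine charts of the isotropic flags\<close>

text \<open>
  The basis starts with an isotropic frame.  The index set \<open>I\<close> singles out its members outside the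
  kernel of \<open>\<omega>\<close>, and \<open>e (st i)\<close> is the dual vector of \<open>e i\<close>.  On the remaining basis vectors, with indices
  in \<open>rest\<close> below, the form is arbitrary.
\<close>

locale isotropic_chart = flag_chart scl e D ds + skew_space scl "e ` {..<D}" \<omega>
  for scl :: "complex \<Rightarrow> 'e::ab_group_add \<Rightarrow> 'e" and e :: "nat \<Rightarrow> 'e" and D :: nat and ds :: "nat list"
    and \<omega> :: "'e \<Rightarrow> 'e \<Rightarrow> complex" +
  fixes I :: "nat set" and st :: "nat \<Rightarrow> nat"
  assumes I: "I \<subseteq> {..<d}" "\<And>i j. i < d \<Longrightarrow> j < d \<Longrightarrow> i \<notin> I \<Longrightarrow> j \<notin> I \<Longrightarrow> i = j"
    and st: "inj_on st I" "\<And>i. i \<in> I \<Longrightarrow> d \<le> st i \<and> st i < D"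
    and iso_e: "\<And>i j. i < d \<Longrightarrow> j < d \<Longrightarrow> \<omega> (e i) (e j) = 0"
    and dual: "\<And>i w. i < d \<Longrightarrow> d \<le> w \<Longrightarrow> w < D \<Longrightarrow>
      \<omega> (e i) (e w) = (if i \<in> I \<and> w = st i then 1 else 0)"
    and st_perp: "\<And>i w. i \<in> I \<Longrightarrow> d \<le> w \<Longrightarrow> w < D \<Longrightarrow> \<omega> (e (st i)) (e w) = 0"
begin

definition rest :: "nat set" where
  "rest = {d..<D} - st ` I"

definition quad :: "(nat \<Rightarrow> nat \<Rightarrow> complex) \<Rightarrow> nat \<Rightarrow> nat \<Rightarrow> complex" where
  "quad y i j = (\<Sum>w\<in>rest. \<Sum>w'\<in>rest. y i w * y j w' * \<omega> (e w) (e w'))"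

text \<open>
  Selects one order of each pair of distinct indices below \<open>d\<close>.  The first index must have a dual
  vector, so an index outside \<open>I\<close> comes second.
\<close>

definition prec :: "nat \<Rightarrow> nat \<Rightarrow> bool" where
  "prec i j \<longleftrightarrow> i \<in> I \<and> (j \<in> I \<longrightarrow> i < j)"

text \<open>
  The value of the coordinate at \<open>(j, st i)\<close> that makes the \<open>i\<close>-th and the \<open>j\<close>-th graph vector
  orthogonal.
\<close>

definition solved :: "(nat \<Rightarrow> nat \<Rightarrow> complex) \<Rightarrow> nat \<Rightarrow> nat \<Rightarrow> complex" where
  "solved y i j = (if j \<in> I then y i (st j) else 0) - quad y i j"

definition pivots :: "(nat \<times> nat) set" where
  "pivots = {(j, st i) | i j. i < d \<and> j < d \<and> prec i j}"

lemma \<omega>_graph_vec: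
  assumes i: "i < d" and j: "j < d"
  shows "\<omega> (graph_vec y i) (graph_vec y j) =
    (if i \<in> I then y j (st i) else 0) - (if j \<in> I then y i (st j) else 0) + quad y i j"
proof -
  let ?K = "{d..<D}"
  have lin: "(\<Sum>w\<in>?K. y b w * \<omega> (e a) (e w)) = (if a \<in> I then y b (st a) else 0)" if "a < d" for a b
  proof -
    have "(\<Sum>w\<in>?K. y b w * \<omega> (e a) (e w)) = (\<Sum>w\<in>?K. if w = st a then (if a \<in> I then y b w else 0) else 0)"
      by (rule sum.cong) (use that in \<open>auto simp: dual\<close>)
    then show ?thesis using st(2)[of a] by simp
  qed
  have zero: "\<omega> (e w) (e w') = 0" if "w \<in> ?K" "w' \<in> ?K" "w \<notin> rest \<or> w' \<notin> rest" for w w'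
    using that st_perp \<omega>_skew[of "e w" "e w'"] by (auto simp: rest_def)
  have "quad y i j = (\<Sum>w\<in>?K. \<Sum>w'\<in>rest. y i w * y j w' * \<omega> (e w) (e w'))"
    unfolding quad_def
    by (rule sum.mono_neutral_left) (use zero in \<open>auto simp: rest_def intro!: sum.neutral\<close>)
  also have "\<dots> = (\<Sum>w\<in>?K. \<Sum>w'\<in>?K. y i w * y j w' * \<omega> (e w) (e w'))"
    by (intro sum.cong refl sum.mono_neutral_left) (use zero in \<open>auto simp: rest_def\<close>)
  finally have quad: "(\<Sum>w\<in>?K. \<Sum>w'\<in>?K. y i w * y j w' * \<omega> (e w) (e w')) = quad y i j" ..
  have "\<omega> (graph_vec y i) (graph_vec y j) = \<omega> (e i) (e j) + (\<Sum>w\<in>?K. y j w * \<omega> (e i) (e w))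
      + (\<Sum>w\<in>?K. y i w * \<omega> (e w) (e j)) + (\<Sum>w\<in>?K. \<Sum>w'\<in>?K. y i w * y j w' * \<omega> (e w) (e w'))"
    by (simp add: graph_vec_def \<omega>_add \<omega>_sum \<omega>_scale sum_distrib_left distrib_left sum.distrib mult.assoc)
       (rule trans[OF sum.swap], simp add: mult.left_commute)
  also have "(\<Sum>w\<in>?K. y i w * \<omega> (e w) (e j)) = - (\<Sum>w\<in>?K. y i w * \<omega> (e j) (e w))"
    using \<omega>_skew[of _ "e j"] by (simp add: sum_negf[symmetric])
  finally show ?thesis using lin[OF i, of j] lin[OF j, of i] quad iso_e[OF i j] by simp
qed

text \<open>
  There is one equation for each unordered pair, solved for the coordinate at the pivot \<open>(j, st i)\<close>.
  By \<open>nonpivot_star\<close> and \<open>nonpivot_rest\<close> below, the right-hand side contains no coordinates at pivots,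
  so the equations can be solved simultaneously.
\<close>

lemma isotropic_graph_iff:
  "isotropic \<omega> (span (graph_vec y ` {..<d})) \<longleftrightarrow>
    (\<forall>i j. i < d \<and> j < d \<and> prec i j \<longrightarrow> y j (st i) = solved y i j)"
proof -
  have eq: "\<omega> (graph_vec y i) (graph_vec y j) = y j (st i) - solved y i j"
    if "i < d" "j < d" "prec i j" for i j
    using \<omega>_graph_vec[OF that(1,2)] that(3) by (simp add: prec_def solved_def)
  have "\<omega> (graph_vec y i) (graph_vec y j) = 0"
    if ij: "i < d" "j < d" and s: "\<forall>i j. i < d \<and> j < d \<and> prec i j \<longrightarrow> y j (st i) = solved y i j" for i j
  proof -
    consider "i = j" | "prec i j" | "prec j i"
      using I(2)[OF ij] unfolding prec_def by (meson linorder_neqE_nat)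
    then show ?thesis
    proof cases
      case 1
      then show ?thesis by (simp add: \<omega>_self)
    next
      case 2
      then show ?thesis using eq ij s by simp
    next
      case 3
      then have "\<omega> (graph_vec y j) (graph_vec y i) = 0" using eq ij s by simp
      then show ?thesis using \<omega>_skew[of "graph_vec y i" "graph_vec y j"] by simp
    qed
  qed
  then show ?thesis unfolding isotropic_span using eq by fastforce
qed

lemma nonpivot_star:
  assumes "i < d" "j < d" "prec i j" "j \<in> I"
  shows "(i, st j) \<in> free_pos - pivots"
proof -
  have "(i, st j) \<in> free_pos"
    using assms st(2)[of j] block(3)[of i] by (auto simp: free_pos_def)
  moreover have "(i, st j) \<notin> pivots"
    using assms st(1) by (auto simp: pivots_def prec_def inj_on_eq_iff)
  ultimately show ?thesis by blast
qed

lemma nonpivot_rest: "i < d \<Longrightarrow> w \<in> rest \<Longrightarrow> (i, w) \<in> free_pos - pivots"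
  using block(3)[of i] by (auto simp: free_pos_def pivots_def rest_def prec_def)

lemma pivots_subset: "pivots \<subseteq> free_pos"
proof
  fix p assume "p \<in> pivots"
  then obtain i j where p: "p = (j, st i)" "j < d" "i \<in> I" by (auto simp: pivots_def prec_def)
  then show "p \<in> free_pos" using st(2)[of i] block(3)[of j] by (auto simp: free_pos_def)
qed

lemma solved_cong:
  assumes "i < d" "j < d" "prec i j" and y: "\<And>a b. (a, b) \<in> free_pos - pivots \<Longrightarrow> y a b = y' a b"
  shows "solved y i j = solved y' i j"
  using assms(1-3) y[OF nonpivot_star] y[OF nonpivot_rest]
  by (simp add: solved_def quad_def)

lemma solved_poly:
  assumes "i < d" "j < d" "prec i j"
    and y: "\<And>a b. (a, b) \<in> free_pos - pivots \<Longrightarrow> (\<lambda>x. y x a b) \<in> affine_polys m"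
  shows "(\<lambda>x. solved (y x) i j) \<in> affine_polys m"
proof -
  note alg = fun_algebra_poly_funs[of "(*)" m]
  have "(\<lambda>x. quad (y x) i j) \<in> affine_polys m"
    unfolding quad_def using assms(1,2)
    by (intro fun_algebra_sum[OF alg] fun_algebra_mult[OF alg] fun_algebra_const[OF alg] y nonpivot_rest)
  moreover have "(\<lambda>x. if j \<in> I then y x i (st j) else 0) \<in> affine_polys m"
    using y[OF nonpivot_star[OF assms(1-3)]] fun_algebra_const[OF alg] by (cases "j \<in> I") auto
  ultimately show ?thesis unfolding solved_def by (rule fun_algebra_minus[OF alg, rotated])
qed

text \<open>
  The ordered pairs in \<open>prec\<close> and their converses make up all ordered pairs off the diagonal.
\<close>

lemma card_pivots: "card pivots = d * (d - 1) div 2"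
proof -
  let ?R = "{(i, j). i < d \<and> j < d \<and> prec i j}"
  have fin: "finite ?R" by (rule finite_subset[of _ "{..<d} \<times> {..<d}"]) auto
  have piv: "pivots = (\<lambda>(i, j). (j, st i)) ` ?R" by (auto simp: pivots_def)
  have "inj_on (\<lambda>(i, j). (j, st i)) ?R"
    using st(1) by (auto simp: inj_on_def prec_def)
  then have 1: "card pivots = card ?R" unfolding piv by (rule card_image)
  have 2: "card (?R\<inverse>) = card ?R" by (rule card_inverse)
  have "?R \<inter> ?R\<inverse> = {}" by (auto simp: prec_def)
  then have "card (?R \<union> ?R\<inverse>) = card ?R + card (?R\<inverse>)" by (intro card_Un_disjoint) (use fin in auto)
  moreover have "?R \<union> ?R\<inverse> = {..<d} \<times> {..<d} - (\<lambda>i. (i, i)) ` {..<d}"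
    using I(2) by (auto simp: prec_def)
  moreover have "card ({..<d} \<times> {..<d} - (\<lambda>i. (i, i)) ` {..<d}) = d * d - d"
    by (subst card_Diff_subset) (auto simp: card_image inj_on_def card_cartesian_product)
  ultimately have "2 * card pivots = d * d - d" using 1 2 by simp
  then show ?thesis by (simp add: diff_mult_distrib2)
qed

text \<open>
  All chart coordinates of an isotropic flag, given those at the non-pivot positions \<open>ps\<close>.
\<close>

definition extension :: "(nat \<times> nat) list \<Rightarrow> complex list \<Rightarrow> nat \<Rightarrow> nat \<Rightarrow> complex" where
  "extension ps x = (let y = (\<lambda>a b. x ! pos_index ps (a, b)) in
     (\<lambda>a b. if (a, b) \<in> pivots then solved y (the_inv_into I st b) a else y a b))"

lemma extension_pivot:
  assumes "i < d" "j < d" "prec i j"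
  shows "extension ps x j (st i) = solved (\<lambda>a b. x ! pos_index ps (a, b)) i j"
proof -
  have "(j, st i) \<in> pivots" using assms by (auto simp: pivots_def)
  moreover have "the_inv_into I st (st i) = i"
    using assms(3) by (intro the_inv_into_f_f[OF st(1)]) (simp add: prec_def)
  ultimately show ?thesis by (simp add: extension_def)
qed

lemma extension_nonpivot: "(a, b) \<notin> pivots \<Longrightarrow> extension ps x a b = x ! pos_index ps (a, b)"
  by (simp add: extension_def)

lemma isotropic_chart_iso:
  "\<exists>p. iso_fspace (sub_fspace (flag_variety scl ds) (isotropic_flags scl \<omega> ds \<inter> chart_dom))
    (quasi_affine {x. length x = card free_pos - d * (d - 1) div 2}
      (affine_polys (card free_pos - d * (d - 1) div 2))) p"
proof -
  obtain ps where ps: "set ps = free_pos - pivots" "distinct ps"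
    using finite_distinct_list[of "free_pos - pivots"] finite_free_pos by blast
  have l: "length ps = card free_pos - d * (d - 1) div 2"
    using distinct_card[OF ps(2)] ps(1) card_Diff_subset[OF finite_subset[OF pivots_subset finite_free_pos] pivots_subset]
    by (simp add: card_pivots)
  have flag_iso: "flag_of_frame scl ds (chart_frame y) \<in> isotropic_flags scl \<omega> ds \<longleftrightarrow>
      isotropic \<omega> (span (graph_vec y ` {..<d}))" for y
    using isotropic_flag_iff[OF flag_of_frame_in_flags[OF sorted_ds chart_frame_in_frames] ds_ne]
    by (simp add: last_flag_of_frame[OF chart_frame_in_frames] span_chart_frame)
  have "iso_fspace (sub_fspace (flag_variety scl ds) (isotropic_flags scl \<omega> ds \<inter> chart_dom))
    (quasi_affine {x. length x = length ps} (affine_polys (length ps)))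
    (\<lambda>Vs. map (\<lambda>(i, j). chart_coord Vs i j) ps)"
  proof (rule chart_iso[where ext = "extension ps"])
    have coord: "(\<lambda>x. x ! pos_index ps (a, b)) \<in> affine_polys (length ps)"
      if "(a, b) \<in> free_pos - pivots" for a b
      using that ps by (intro affine_coord pos_index(1)) auto
    show "(\<lambda>x. extension ps x a b) \<in> affine_polys (length ps)" if ab: "(a, b) \<in> free_pos" for a b
    proof (cases "(a, b) \<in> pivots")
      case True
      then obtain i where i: "i < d" "a < d" "prec i a" "b = st i" by (auto simp: pivots_def)
      then show ?thesis using solved_poly[OF i(1-3) coord] by (simp add: extension_pivot)
    next
      case False
      then show ?thesis using coord ab by (simp add: extension_nonpivot)
    qed
    show "flag_of_frame scl ds (chart_frame (extension ps x)) \<in> isotropic_flags scl \<omega> ds \<inter> chart_dom" for x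
    proof -
      have "extension ps x j (st i) = solved (extension ps x) i j" if "i < d" "j < d" "prec i j" for i j
        unfolding extension_pivot[OF that]
        by (rule solved_cong[OF that, symmetric]) (simp add: extension_nonpivot)
      then show ?thesis using flag_iso isotropic_graph_iff chart_frame_in_dom by simp
    qed
    show "case ps ! k of (i, j) \<Rightarrow> extension ps x i j = x ! k"
      if "length x = length ps" "k < length ps" for x k
    proof (cases "ps ! k")
      case (Pair i j)
      then have "(i, j) \<notin> pivots" using ps(1) nth_mem[OF that(2)] by auto
      then show ?thesis using pos_index_nth[OF ps(2) that(2)] Pair by (simp add: extension_nonpivot)
    qed
    show "extension ps (map (\<lambda>(i, j). chart_coord Vs i j) ps) a b = chart_coord Vs a b"
      if Vs: "Vs \<in> isotropic_flags scl \<omega> ds \<inter> chart_dom" and ab: "(a, b) \<in> free_pos" for Vs a b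
    proof -
      let ?y = "\<lambda>a b. map (\<lambda>(i, j). chart_coord Vs i j) ps ! pos_index ps (a, b)"
      have y: "?y a b = chart_coord Vs a b" if "(a, b) \<in> free_pos - pivots" for a b
        using that ps pos_index[OF ps(2), of "(a, b)"] by simp
      show ?thesis
      proof (cases "(a, b) \<in> pivots")
        case True
        then obtain i where i: "i < d" "a < d" "prec i a" "b = st i" by (auto simp: pivots_def)
        have "isotropic \<omega> (span (graph_vec (chart_coord Vs) ` {..<d}))"
          using Vs flag_iso[of "chart_coord Vs"] flag_of_chart_frame_coord by auto
        then have "chart_coord Vs a (st i) = solved (chart_coord Vs) i a"
          using isotropic_graph_iff i by blast
        also have "\<dots> = solved ?y i a"
          by (rule solved_cong[OF i(1-3), symmetric]) (rule y)
        finally show ?thesis using extension_pivot[OF i(1-3)] i(4) by simp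
      next
        case False
        then show ?thesis using y ab by (simp add: extension_nonpivot)
      qed
    qed
  qed (use ps in auto)
  then show ?thesis unfolding l by blast
qed

lemma codim_le: "d * (d - 1) div 2 \<le> card free_pos"
  using card_mono[OF finite_free_pos pivots_subset] card_pivots by simp

end

section \<open>Adapted bases\<close>

context skew_space
begin

definition radical :: "'e set" where
  "radical = {x. \<forall>y. \<omega> x y = 0}"

lemma frame_coeff_zero:
  "v \<in> frames scl c \<Longrightarrow> (\<Sum>l<c. scl (a l) (v ! l)) = 0 \<Longrightarrow> l < c \<Longrightarrow> a l = 0"
  unfolding frames_iff by blast

text \<open>
  If the span of the frame contains a nonzero vector \<open>\<kappa>\<close> of the radical, \<open>\<kappa>\<close> replaces the last vector of the
  frame that occurs in it with a nonzero coefficient.  As the radical is a line, no nontrivial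
  combination of the other vectors lies in it.
\<close>

lemma frame_adapted_to_radical:
  assumes rad: "\<forall>\<kappa>\<in>radical. \<kappa> \<noteq> 0 \<longrightarrow> radical \<subseteq> span {\<kappa>}"
    and v: "v \<in> frames scl c"
  shows "\<exists>v' I. v' \<in> frames scl c \<and> (\<forall>s\<le>c. span (set (take s v')) = span (set (take s v))) \<and>
    I \<subseteq> {..<c} \<and> (\<forall>i<c. \<forall>j<c. i \<notin> I \<and> j \<notin> I \<longrightarrow> i = j) \<and> (\<forall>i<c. i \<notin> I \<longrightarrow> v' ! i \<in> radical) \<and>
    (\<forall>b. (\<Sum>i\<in>I. scl (b i) (v' ! i)) \<in> radical \<longrightarrow> (\<forall>i\<in>I. b i = 0))"
proof (cases "\<exists>\<kappa>\<in>span (set v). \<kappa> \<in> radical \<and> \<kappa> \<noteq> 0")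
  case False
  have "\<forall>i\<in>{..<c}. b i = 0" if b: "(\<Sum>i\<in>{..<c}. scl (b i) (v ! i)) \<in> radical" for b
  proof -
    have "(\<Sum>i\<in>{..<c}. scl (b i) (v ! i)) \<in> span (set v)"
      using length_frame[OF v] by (intro span_sum span_scale span_base) auto
    then have "(\<Sum>i\<in>{..<c}. scl (b i) (v ! i)) = 0" using False b by blast
    then show ?thesis using frame_coeff_zero[OF v] by blast
  qed
  then show ?thesis using v by (intro exI[of _ v] exI[of _ "{..<c}"]) auto
next
  case True
  then obtain \<kappa> where \<kappa>: "\<kappa> \<in> span (set v)" "\<kappa> \<in> radical" "\<kappa> \<noteq> 0" by blast
  have lv: "length v = c" by (rule length_frame[OF v])
  obtain a where a: "\<kappa> = (\<Sum>l<c. scl (a l) (v ! l))"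
    using span_take_iff[of c v \<kappa>] \<kappa>(1) lv by auto
  let ?A = "{l. l < c \<and> a l \<noteq> 0}"
  have "?A \<noteq> {}"
  proof
    assume "?A = {}"
    then have "\<kappa> = 0" unfolding a by (intro sum.neutral) auto
    then show False using \<kappa>(3) by simp
  qed
  \<comment> \<open>since \<open>k\<close> is maximal, \<open>\<kappa>\<close> lies in the span of each initial segment that contains \<open>v ! k\<close>\<close>
  define k where "k = Max ?A"
  have k: "k < c" "a k \<noteq> 0" using Max_in[of ?A] \<open>?A \<noteq> {}\<close> by (auto simp: k_def)
  have above: "a l = 0" if "k < l" "l < c" for l
  proof (rule ccontr)
    assume "a l \<noteq> 0"
    then have "l \<le> k" unfolding k_def using that(2) by (intro Max_ge) auto
    then show False using that(1) by simp
  qed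
  let ?v = "v[k := \<kappa>]"
  have vf: "?v \<in> frames scl c"
    unfolding frames_iff
  proof (intro conjI allI impI)
    fix b l assume b: "(\<Sum>l<c. scl (b l) (?v ! l)) = 0" and l: "l < c"
    let ?b = "\<lambda>l. (if l = k then 0 else b l) + b k * a l"
    have "(\<Sum>l<c. scl (b l) (?v ! l)) =
        (\<Sum>l<c. scl (if l = k then 0 else b l) (v ! l) + (if l = k then scl (b k) \<kappa> else 0))"
      by (rule sum.cong) (use lv in auto)
    also have "\<dots> = (\<Sum>l<c. scl (if l = k then 0 else b l) (v ! l)) + scl (b k) \<kappa>"
      using k(1) by (simp add: sum.distrib)
    also have "\<dots> = (\<Sum>l<c. scl (?b l) (v ! l))"
      unfolding a by (simp only: scale_left_distrib sum.distrib scale_sum_right scale_scale)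
    finally have 0: "?b l = 0" if "l < c" for l
      using frame_coeff_zero[OF v, of ?b] that b by metis
    have "b k = 0" using 0[OF k(1)] k(2) by simp
    then show "b l = 0" using 0[OF l] by (cases "l = k") auto
  qed (simp add: lv)
  have spans: "span (set (take s ?v)) = span (set (take s v))" if s: "s \<le> c" for s
  proof (cases "s \<le> k")
    case True
    then show ?thesis by simp
  next
    case False
    have "\<kappa> = (\<Sum>l<s. scl (a l) (v ! l))"
      unfolding a by (rule sum.mono_neutral_right) (use False s above in auto)
    then have \<kappa>s: "\<kappa> \<in> span (set (take s v))" using span_take_iff[of s v] s lv by auto
    have "set (take s ?v) \<subseteq> span (set (take s v))"
    proof
      fix x assume "x \<in> set (take s ?v)"
      then have "x \<in> insert \<kappa> (set (take s v))"
        by (metis take_update_swap set_update_subset_insert subsetD)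
      then show "x \<in> span (set (take s v))" using \<kappa>s span_base by blast
    qed
    then have "span (set (take s ?v)) \<subseteq> span (set (take s v))" by (rule span_minimal) (rule subspace_span)
    then show ?thesis
      using subspace_dim_equal[OF subspace_span subspace_span] dim_span_take[OF vf s] dim_span_take[OF v s]
      by (metis order_refl)
  qed
  have coeff: "\<forall>i\<in>{..<c} - {k}. b i = 0" if b: "(\<Sum>i\<in>{..<c} - {k}. scl (b i) (?v ! i)) \<in> radical" for b
  proof -
    obtain t where t: "(\<Sum>i\<in>{..<c} - {k}. scl (b i) (?v ! i)) = scl t \<kappa>"
      using rad \<kappa>(2,3) b unfolding span_singleton by blast
    have "(\<Sum>l<c. scl (if l = k then - t else b l) (?v ! l)) =
        scl (- t) (?v ! k) + (\<Sum>i\<in>{..<c} - {k}. scl (if i = k then - t else b i) (?v ! i))"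
      using k(1) by (subst sum.remove[of _ k]) auto
    also have "(\<Sum>i\<in>{..<c} - {k}. scl (if i = k then - t else b i) (?v ! i)) = scl t \<kappa>"
      unfolding t[symmetric] by (rule sum.cong) auto
    finally have "(\<Sum>l<c. scl (if l = k then - t else b l) (?v ! l)) = 0" using k(1) lv by simp
    note zero = frame_coeff_zero[OF vf this]
    show ?thesis
    proof
      fix i assume "i \<in> {..<c} - {k}"
      then show "b i = 0" using zero[of i] by simp
    qed
  qed
  show ?thesis
    by (rule exI[of _ ?v], rule exI[of _ "{..<c} - {k}"])
       (use vf spans coeff k(1) lv \<kappa>(2) in auto)
qed

text \<open>
  A dual family \<open>a\<close> remains dual if combinations of the isotropic vectors \<open>v\<close> are added.  Adding
  \<open>- \<omega> (a i) (a l) / 2\<close> times \<open>v l\<close> for all \<open>l\<close> to each \<open>a i\<close> makes the \<open>a i\<close> orthogonal to each other, as half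
  of \<open>\<omega> (a i) (a j)\<close> is cancelled from either side.
\<close>

lemma isotropic_dual_family:
  assumes I: "finite I" and iso: "\<And>i j. i \<in> I \<Longrightarrow> j \<in> I \<Longrightarrow> \<omega> (v i) (v j) = 0"
    and ind: "\<And>b. (\<Sum>i\<in>I. scl (b i) (v i)) \<in> radical \<Longrightarrow> \<forall>i\<in>I. b i = 0"
  shows "\<exists>a. (\<forall>i\<in>I. \<forall>j\<in>I. \<omega> (v j) (a i) = (if i = j then 1 else 0)) \<and> (\<forall>i\<in>I. \<forall>j\<in>I. \<omega> (a i) (a j) = 0)"
proof -
  have "\<exists>a. \<forall>i\<in>I. \<forall>j\<in>I. \<omega> (v j) (a i) = (if i = j then 1 else 0)"
  proof (rule dual_family[OF I \<omega>_right])
    fix c j assume "\<And>x. (\<Sum>j\<in>I. c j * \<omega> (v j) x) = 0" and j: "j \<in> I"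
    then have "(\<Sum>i\<in>I. scl (c i) (v i)) \<in> radical" by (simp add: radical_def \<omega>_sum \<omega>_scale)
    then show "c j = 0" using ind j by blast
  qed
  then obtain a where a: "\<And>i j. i \<in> I \<Longrightarrow> j \<in> I \<Longrightarrow> \<omega> (v j) (a i) = (if i = j then 1 else 0)" by blast
  have a': "\<omega> (a i) (v j) = (if i = j then - 1 else 0)" if "i \<in> I" "j \<in> I" for i j
    using a[OF that] \<omega>_skew[of "a i" "v j"] by simp
  define t where "t = (\<lambda>i l. - \<omega> (a i) (a l) / 2)"
  define s where "s = (\<lambda>i. \<Sum>l\<in>I. scl (t i l) (v l))"
  have vs: "\<omega> (v j) (s i) = 0" "\<omega> (s i) (v j) = 0" "\<omega> (s i) (s j) = 0" if "i \<in> I" "j \<in> I" for i j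
    using iso that by (auto simp: s_def \<omega>_sum \<omega>_scale intro!: sum.neutral)
  have sa: "\<omega> (s i) (a j) = - \<omega> (a i) (a j) / 2" if ij: "i \<in> I" "j \<in> I" for i j
  proof -
    have "\<omega> (s i) (a j) = (\<Sum>l\<in>I. if l = j then t i l else 0)"
      unfolding s_def \<omega>_sum \<omega>_scale by (rule sum.cong) (use a ij in auto)
    then show ?thesis using I ij by (simp add: t_def)
  qed
  have as: "\<omega> (a i) (s j) = - \<omega> (a i) (a j) / 2" if ij: "i \<in> I" "j \<in> I" for i j
    using sa[OF ij(2,1)] \<omega>_skew[of "a i" "s j"] \<omega>_skew[of "a i" "a j"] by simp
  show ?thesis
  proof (intro exI[of _ "\<lambda>i. a i + s i"] conjI ballI)
    fix i j assume ij: "i \<in> I" "j \<in> I"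
    show "\<omega> (v j) (a i + s i) = (if i = j then 1 else 0)"
      using a[OF ij] vs(1)[OF ij] by (simp add: \<omega>_add)
    have "\<omega> (a i + s i) (a j + s j) = \<omega> (a i) (a j) + \<omega> (a i) (s j) + \<omega> (s i) (a j) + \<omega> (s i) (s j)"
      by (simp add: \<omega>_add)
    then show "\<omega> (a i + s i) (a j + s j) = 0" unfolding sa[OF ij] as[OF ij] vs(3)[OF ij] by simp
  qed
qed

text \<open>
  An adapted frame of the flag is followed by dual vectors \<open>a\<close> and by any completion to a basis, from
  which the components along the hyperbolic pairs \<open>v ! l\<close>, \<open>a l\<close> are removed.
\<close>

lemma isotropic_chart_exists:
  assumes rad: "\<forall>\<kappa>\<in>radical. \<kappa> \<noteq> 0 \<longrightarrow> radical \<subseteq> span {\<kappa>}"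
    and ds: "sorted_wrt (<) ds" "ds \<noteq> []" and Vs: "Vs \<in> isotropic_flags scl \<omega> ds"
    and D: "dim UNIV = D"
  shows "\<exists>e I st. isotropic_chart scl e D ds \<omega> I st \<and> Vs \<in> flag_chart.chart_dom scl e D ds"
proof -
  let ?c = "last ds"
  have "Vs \<in> flags scl ds" using Vs by (simp add: isotropic_flags_def)
  then obtain v0 where v0: "v0 \<in> frames scl ?c" "flag_of_frame scl ds v0 = Vs"
    using flag_has_frame[OF ds] by metis
  from frame_adapted_to_radical[OF rad v0(1)]
  obtain v I where v: "v \<in> frames scl ?c" and spans: "\<forall>s\<le>?c. span (set (take s v)) = span (set (take s v0))"
    and I: "I \<subseteq> {..<?c}" "\<forall>i<?c. \<forall>j<?c. i \<notin> I \<and> j \<notin> I \<longrightarrow> i = j"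
    and kernel: "\<forall>i<?c. i \<notin> I \<longrightarrow> v ! i \<in> radical"
    and ind: "\<forall>b. (\<Sum>i\<in>I. scl (b i) (v ! i)) \<in> radical \<longrightarrow> (\<forall>i\<in>I. b i = 0)"
    by (elim exE conjE)
  have lv: "length v = ?c" by (rule length_frame[OF v])
  have finI: "finite I" using I(1) finite_subset by blast
  have flag: "flag_of_frame scl ds v = Vs"
    unfolding v0(2)[symmetric] flag_of_frame_def
    using spans nth_le_last[OF ds(1)] by (auto simp: in_set_conv_nth)
  have "v \<in> isotropic_frames ?c"
    using isotropic_flag_of_frame[OF ds v] flag Vs by simp
  then have iso: "\<omega> (v ! i) (v ! j) = 0" if "i < ?c" "j < ?c" for i j
    using that lv by (simp add: isotropic_frames_def)
  have isoI: "\<omega> (v ! i) (v ! j) = 0" if "i \<in> I" "j \<in> I" for i j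
    using that iso I(1) by auto
  have indI: "\<forall>i\<in>I. b i = 0" if "(\<Sum>i\<in>I. scl (b i) (v ! i)) \<in> radical" for b
    using ind that by simp
  have "\<exists>a. (\<forall>i\<in>I. \<forall>j\<in>I. \<omega> (v ! j) (a i) = (if i = j then 1 else 0)) \<and>
      (\<forall>i\<in>I. \<forall>j\<in>I. \<omega> (a i) (a j) = 0)"
    by (rule isotropic_dual_family[where v = "(!) v", OF finI]) (auto intro: isoI dest: indI)
  then obtain a where aa: "\<forall>i\<in>I. \<forall>j\<in>I. \<omega> (a i) (a j) = 0"
    and "\<forall>i\<in>I. \<forall>j\<in>I. \<omega> (v ! j) (a i) = (if i = j then 1 else 0)"
    by (elim exE conjE)
  then have va: "\<omega> (v ! j) (a i) = (if i = j then 1 else 0)" if "i \<in> I" "j < ?c" for i j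
    using that kernel by (cases "j \<in> I") (auto simp: radical_def)
  have av: "\<omega> (a i) (v ! j) = (if i = j then - 1 else 0)" if "i \<in> I" "j < ?c" for i j
    using va[OF that] \<omega>_skew[of "a i" "v ! j"] by simp
  obtain il where il: "set il = I" "distinct il" using finite_distinct_list[OF finI] by blast
  have "distinct js \<Longrightarrow> set js \<subseteq> I \<Longrightarrow> v @ map a js \<in> frames scl (?c + length js)" for js
  proof (induction js rule: rev_induct)
    case Nil
    then show ?case using v by simp
  next
    case (snoc j js)
    have j: "j \<in> I" "j < ?c" "j \<notin> set js" "set js \<subseteq> I" using snoc.prems I(1) by auto
    have "set (v @ map a js) \<subseteq> {x. \<omega> x (v ! j) = 0}"
    proof
      fix x assume "x \<in> set (v @ map a js)"
      then consider k where "k < ?c" "x = v ! k" | i where "i \<in> set js" "x = a i"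
        using lv by (auto simp: in_set_conv_nth)
      then show "x \<in> {x. \<omega> x (v ! j) = 0}"
        by cases (use iso av j in \<open>auto split: if_splits\<close>)
    qed
    then have "span (set (v @ map a js)) \<subseteq> {x. \<omega> x (v ! j) = 0}"
      by (rule span_minimal) (rule subspace_perp)
    then have "a j \<notin> span (set (v @ map a js))" using av[OF j(1,2)] by auto
    then show ?case using frame_snocI[OF snoc.IH, of "a j"] snoc.prems by simp
  qed
  then have u: "v @ map a il \<in> frames scl (?c + length il)" using il by simp
  obtain w where w: "(v @ map a il) @ w \<in> frames scl D" using frame_extends_UNIV[OF u] D by auto
  \<comment> \<open>the projection to the orthogonal complement of the hyperbolic pairs\<close>
  define corr where "corr = (\<lambda>b. b + (\<Sum>l\<in>I. scl (\<omega> (a l) b) (v ! l) - scl (\<omega> (v ! l) b) (a l)))"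
  have corr_v: "\<omega> (v ! i) (corr b) = 0" if i: "i < ?c" for i b
  proof (cases "i \<in> I")
    case True
    have "\<omega> (v ! i) (corr b) = \<omega> (v ! i) b + (\<Sum>l\<in>I. if l = i then - \<omega> (v ! l) b else 0)"
      unfolding corr_def \<omega>_add \<omega>_sum \<omega>_diff \<omega>_scale
      by (intro arg_cong2[of _ _ _ _ "(+)"] refl sum.cong) (use iso va i I(1) in auto)
    then show ?thesis using True finI by simp
  next
    case False
    then show ?thesis using kernel i by (simp add: radical_def)
  qed
  have corr_a: "\<omega> (a i) (corr b) = 0" if i: "i \<in> I" for i b
  proof -
    have "\<omega> (a i) (corr b) = \<omega> (a i) b + (\<Sum>l\<in>I. if l = i then - \<omega> (a l) b else 0)"
      unfolding corr_def \<omega>_add \<omega>_sum \<omega>_diff \<omega>_scale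
      by (intro arg_cong2[of _ _ _ _ "(+)"] refl sum.cong) (use av aa i I(1) in auto)
    then show ?thesis using i finI by simp
  qed
  define es where "es = (v @ map a il) @ map corr w"
  have es: "es \<in> frames scl D"
  proof -
    have "(v @ map a il) @ map corr w \<in> frames scl (dim UNIV)"
    proof (rule frame_corrected)
      show "(v @ map a il) @ w \<in> frames scl (dim UNIV)" using w D by simp
      fix j assume j: "j < length w"
      have "scl (\<omega> (a l) b) (v ! l) - scl (\<omega> (v ! l) b) (a l) \<in> span (set (v @ map a il))" if "l \<in> I" for l b
        using that I(1) lv il(1) by (intro span_diff span_scale span_base) auto
      then have "corr (w ! j) - w ! j \<in> span (set (v @ map a il))"
        by (auto simp: corr_def intro: span_sum)
      then show "map corr w ! j - w ! j \<in> span (set (v @ map a il))" using j by simp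
    qed simp
    then show ?thesis using D by (simp add: es_def)
  qed
  have les: "?c + length il + length w = D" using length_frame[OF es] lv by (simp add: es_def)
  have es1: "es ! i = v ! i" if "i < ?c" for i using that lv by (simp add: es_def nth_append)
  have es2: "es ! (?c + m) = a (il ! m)" if "m < length il" for m
    using that lv by (simp add: es_def nth_append)
  have es3: "\<exists>b. es ! j = corr b" if "?c + length il \<le> j" "j < D" for j
    using that lv les by (auto simp: es_def nth_append)
  define st where "st = (\<lambda>i. ?c + pos_index il i)"
  have st: "st i < ?c + length il" "?c \<le> st i" "es ! st i = a i" if "i \<in> I" for i
    using pos_index[OF il(2), of i] il(1) that es2 by (auto simp: st_def)
  have st_eq: "st (il ! m) = ?c + m" if "m < length il" for m
    using pos_index_nth[OF il(2) that] by (simp add: st_def)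
  have cols: "(\<exists>m<length il. j = ?c + m) \<or> (\<exists>b. es ! j = corr b) \<and> ?c + length il \<le> j" if "?c \<le> j" "j < D" for j
    using es3[of j] that by (metis le_add_diff_inverse nat_add_left_cancel_less not_le)
  have le: "?c \<le> D" using les by simp
  note chart = flag_chart_at_frame[OF es D ds le]
  interpret C: flag_chart scl "\<lambda>i. es ! i" D ds by (rule chart(1))
  have "isotropic_chart scl (\<lambda>i. es ! i) D ds \<omega> I st"
  proof (unfold_locales)
    show "skew_form scl \<omega>" by (rule skew)
    show "I \<subseteq> {..<?c}" by fact
    show "i = j" if "i < ?c" "j < ?c" "i \<notin> I" "j \<notin> I" for i j using I(2) that by blast
    show "inj_on st I"
    proof (rule inj_onI)
      fix i j assume "i \<in> I" "j \<in> I" "st i = st j"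
      then show "i = j" using pos_index(2)[OF il(2)] il(1) by (metis add_left_cancel st_def)
    qed
    show "?c \<le> st i \<and> st i < D" if "i \<in> I" for i using st(1,2)[OF that] les by simp
    show "\<omega> (es ! i) (es ! j) = 0" if "i < ?c" "j < ?c" for i j
      using that iso es1 by simp
    show "\<omega> (es ! i) (es ! j) = (if i \<in> I \<and> j = st i then 1 else 0)"
      if i: "i < ?c" and j: "?c \<le> j" "j < D" for i j
      using cols[OF j]
    proof (elim disjE conjE exE)
      fix m assume m: "m < length il" "j = ?c + m"
      have mI: "il ! m \<in> I" using m(1) il(1) by auto
      have "j = st i \<longleftrightarrow> il ! m = i" if "i \<in> I"
        using st_eq[OF m(1)] m(2) st(3)[OF that] pos_index[OF il(2), of i] il that
        by (auto simp: st_def)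
      then show ?thesis using va[OF mI i] es1[OF i] es2[OF m(1)] m(2) mI by auto
    next
      fix b assume b: "es ! j = corr b" "?c + length il \<le> j"
      then have "\<not> (i \<in> I \<and> j = st i)" using st(1)[of i] by auto
      then show ?thesis using corr_v[OF i] b es1[OF i] by auto
    qed
    show "\<omega> (es ! st i) (es ! j) = 0" if i: "i \<in> I" and j: "?c \<le> j" "j < D" for i j
      using cols[OF j]
    proof (elim disjE conjE exE)
      fix m assume m: "m < length il" "j = ?c + m"
      then have "il ! m \<in> I" using il(1) by auto
      then show ?thesis using aa i st(3)[OF i] es2[OF m(1)] m(2) by simp
    next
      fix b assume "es ! j = corr b"
      then show ?thesis using corr_a[OF i] st(3)[OF i] by simp
    qed
  qed
  moreover have "take ?c es = v" using lv by (simp add: es_def)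
  then have "Vs \<in> C.chart_dom" using chart(2) flag by simp
  ultimately show ?thesis by blast
qed

text \<open>
  If two independent vectors lay in the radical, the image of the form would be spanned by the
  remaining \<open>2n - 1\<close> vectors of a basis.
\<close>

lemma radical_line:
  assumes rank: "form_rank \<omega> = 2 * n" and D: "dim UNIV = 2 * n + 1"
  shows "\<forall>\<kappa>\<in>radical. \<kappa> \<noteq> 0 \<longrightarrow> radical \<subseteq> span {\<kappa>}"
proof (intro ballI impI subsetI, rule ccontr)
  fix \<kappa> x assume \<kappa>: "\<kappa> \<in> radical" "\<kappa> \<noteq> 0" and x: "x \<in> radical" and "x \<notin> span {\<kappa>}"
  then have ind: "independent {x, \<kappa>}" using \<kappa>(2) by (intro independent_insertI) (auto simp: independent_empty)
  obtain B where B: "{x, \<kappa>} \<subseteq> B" "independent B" "UNIV \<subseteq> span B"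
    using maximal_independent_subset_extend[OF subset_UNIV ind] by metis
  have fin: "finite B" using finiteI_independent[OF B(2)] .
  have card: "card B = 2 * n + 1" using basis_card_eq_dim[OF subset_UNIV B(3,2)] D by simp
  have ne: "x \<noteq> \<kappa>" using \<open>x \<notin> span {\<kappa>}\<close> by (auto simp: span_base)
  let ?s = "\<lambda>(c::complex) (f::'e \<Rightarrow> complex) y. c * f y"
  interpret F: vector_space ?s
    by unfold_locales (auto simp: fun_eq_iff algebra_simps)
  have "Vector_Spaces.linear scl ?s \<omega>"
    unfolding Vector_Spaces.linear_iff
    using vector_space_axioms F.vector_space_axioms
    by (auto simp: fun_eq_iff \<omega>_add \<omega>_scale)
  then interpret \<omega>: Vector_Spaces.linear scl ?s \<omega> .
  have "range \<omega> = \<omega> ` span B" using B(3) by auto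
  also have "\<dots> = F.span (\<omega> ` B)" by (rule \<omega>.span_image[symmetric])
  also have "\<omega> ` B \<subseteq> insert 0 (\<omega> ` (B - {x, \<kappa>}))"
    using \<kappa>(1) x by (auto simp: radical_def fun_eq_iff)
  then have "F.span (\<omega> ` B) \<subseteq> F.span (\<omega> ` (B - {x, \<kappa>}))"
    using F.span_mono F.span_insert_0 by metis
  finally have "F.dim (range \<omega>) \<le> card (\<omega> ` (B - {x, \<kappa>}))"
    by (rule F.dim_le_card) (use fin in simp)
  also have "\<dots> \<le> card (B - {x, \<kappa>})" by (rule card_image_le) (use fin in simp)
  also have "\<dots> = 2 * n - 1" using B(1) fin card ne by (subst card_Diff_subset) auto
  finally have "2 * n \<le> 2 * n - 1" using rank by (simp add: form_rank_def)
  moreover have "2 \<le> card B" using card_mono[OF fin B(1)] ne by simp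
  ultimately show False using card by linarith
qed

section \<open>The odd symplectic flag manifold\<close>

lemma isotropic_flags_subvariety:
  assumes rank: "form_rank \<omega> = 2 * n" and D: "dim UNIV = 2 * n + 1"
    and ds: "sorted_wrt (<) ds" "ds \<noteq> []" and le: "last ds \<le> n + 1"
  shows "smooth_subvariety_of_codim (flag_variety scl ds) (isotropic_flags scl \<omega> ds)
           (last ds * (last ds - 1) div 2)"
proof -
  let ?X = "flag_variety scl ds" and ?Z = "isotropic_flags scl \<omega> ds" and ?D = "2 * n + 1"
  let ?N = "card (flag_chart.free_pos ?D ds)" and ?c = "last ds * (last ds - 1) div 2"
  have leD: "last ds \<le> ?D" using le by simp
  note topX = topspace_flag_variety[OF ds(1)]
  have ZX: "?Z \<subseteq> flags scl ds" by (auto simp: isotropic_flags_def)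
  then have topZ: "topspace (zar (sub_fspace ?X ?Z)) = ?Z" by (auto simp: zar_sub_fspace topX)
  have res: "restrictable ?X" unfolding flag_variety_def by (rule restrictable_quotient)
  have chartX: "\<exists>U p. openin (zar ?X) U \<and> Vs \<in> U \<and>
      iso_fspace (sub_fspace ?X U) (quasi_affine {x. length x = ?N} (affine_polys ?N)) p"
    if "Vs \<in> topspace (zar ?X)" for Vs
  proof -
    have "Vs \<in> flags scl ds" using that topX by simp
    then obtain v where v: "v \<in> frames scl (last ds)" "flag_of_frame scl ds v = Vs"
      using flag_has_frame[OF ds] by metis
    obtain w where w: "v @ w \<in> frames scl ?D" using frame_extends_UNIV[OF v(1)] D by auto
    interpret C: flag_chart scl "\<lambda>i. (v @ w) ! i" ?D ds by (rule flag_chart_at_frame(1)[OF w D ds leD])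
    have "Vs \<in> C.chart_dom"
      using flag_chart_at_frame(2)[OF w D ds leD] v length_frame[OF v(1)] by simp
    then show ?thesis using C.chart_dom_iso C.open_chart_dom by blast
  qed
  have chartZ: "\<exists>U p. openin (zar (sub_fspace ?X ?Z)) U \<and> Vs \<in> U \<and>
      iso_fspace (sub_fspace (sub_fspace ?X ?Z) U) (quasi_affine {x. length x = ?N - ?c} (affine_polys (?N - ?c))) p"
    and cN: "?c \<le> ?N"
    if Vs: "Vs \<in> ?Z" for Vs
  proof -
    obtain e I st where C: "isotropic_chart scl e ?D ds \<omega> I st" "Vs \<in> flag_chart.chart_dom scl e ?D ds"
      using isotropic_chart_exists[OF radical_line[OF rank D] ds Vs D] by blast
    interpret C: isotropic_chart scl e ?D ds \<omega> I st by (rule C(1))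
    obtain p where p: "iso_fspace (sub_fspace ?X (?Z \<inter> C.chart_dom))
        (quasi_affine {x. length x = ?N - ?c} (affine_polys (?N - ?c))) p"
      using C.isotropic_chart_iso by blast
    have "iso_fspace (sub_fspace (sub_fspace ?X ?Z) (?Z \<inter> C.chart_dom))
        (quasi_affine {x. length x = ?N - ?c} (affine_polys (?N - ?c))) p"
      by (rule iso_fspace_sub_sub[OF res]) (use p in simp)
    moreover have "openin (zar (sub_fspace ?X ?Z)) (?Z \<inter> C.chart_dom)"
      using C.open_chart_dom by (auto simp: zar_sub_fspace openin_subtopology)
    ultimately show "\<exists>U p. openin (zar (sub_fspace ?X ?Z)) U \<and> Vs \<in> U \<and>
      iso_fspace (sub_fspace (sub_fspace ?X ?Z) U) (quasi_affine {x. length x = ?N - ?c} (affine_polys (?N - ?c))) p"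
      using C(2) Vs by blast
    show "?c \<le> ?N" by (rule C.codim_le)
  qed
  obtain v where v: "v \<in> isotropic_frames (last ds)"
    using isotropic_frame_exists[of "last ds"] le D by auto
  then have "flag_of_frame scl ds v \<in> ?Z"
    using isotropic_flag_of_frame[OF ds] by (auto simp: isotropic_frames_def)
  then have ne: "?Z \<noteq> {}" and cN: "?c \<le> ?N" using cN by blast+
  \<comment> \<open>two flags are related if they have frames on a common line of isotropic tuples\<close>
  define R where "R Vs Ws \<longleftrightarrow> (\<exists>v w. linked v w \<and> v \<in> frames scl (last ds) \<and>
      Vs = flag_of_frame scl ds v \<and> Ws = flag_of_frame scl ds w)" for Vs Ws
  have irr: "irreducible_space (zar (sub_fspace ?X ?Z))"
  proof (rule irreducible_space_if_chain_connected[where R = R])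
    show "topspace (zar (sub_fspace ?X ?Z)) \<noteq> {}" using ne topZ by simp
  next
    fix Vs assume "Vs \<in> topspace (zar (sub_fspace ?X ?Z))"
    then obtain N p where N: "openin (zar (sub_fspace ?X ?Z)) N" "Vs \<in> N"
      "iso_fspace (sub_fspace (sub_fspace ?X ?Z) N)
        (quasi_affine {x. length x = ?N - ?c} (affine_polys (?N - ?c))) p"
      using chartZ topZ by blast
    have irrN: "U \<inter> V \<noteq> {}" if UV: "openin (zar (sub_fspace ?X ?Z)) U" "openin (zar (sub_fspace ?X ?Z)) V"
      "U \<subseteq> N" "V \<subseteq> N" "U \<noteq> {}" "V \<noteq> {}" for U V
      by (rule irreducible_if_affine_chart[OF N(3) UV])
    show "\<exists>N. openin (zar (sub_fspace ?X ?Z)) N \<and> Vs \<in> N \<and> (\<forall>U V. openin (zar (sub_fspace ?X ?Z)) U \<and>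
        openin (zar (sub_fspace ?X ?Z)) V \<and> U \<subseteq> N \<and> V \<subseteq> N \<and> U \<noteq> {} \<and> V \<noteq> {} \<longrightarrow> U \<inter> V \<noteq> {})"
      by (intro exI[of _ N] conjI allI impI N(1,2), elim conjE) (rule irrN)
  next
    fix Vs Ws assume "R Vs Ws"
    then obtain v w where vw: "linked v w" "v \<in> frames scl (last ds)"
      "Vs = flag_of_frame scl ds v" "Ws = flag_of_frame scl ds w" by (auto simp: R_def)
    then have iso: "v \<in> isotropic_frames (last ds)" "w \<in> isotropic_frames (last ds)"
      by (auto simp: linked_def isotropic_frames_def frames_def)
    then have Z: "Vs \<in> ?Z" "Ws \<in> ?Z"
      using isotropic_flag_of_frame[OF ds] vw by (auto simp: isotropic_frames_def)
    have meet: "U \<inter> V \<noteq> {}" if "openin (zar (sub_fspace ?X ?Z)) U" "openin (zar (sub_fspace ?X ?Z)) V"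
      "Vs \<in> U" "Ws \<in> V" for U V
    proof -
      obtain A B where AB: "openin (zar ?X) A" "U = A \<inter> ?Z" "openin (zar ?X) B" "V = B \<inter> ?Z"
        using \<open>openin _ U\<close> \<open>openin _ V\<close> by (auto simp: zar_sub_fspace openin_subtopology)
      have "A \<inter> B \<inter> ?Z \<noteq> {}"
        by (rule linked_flags_meet[OF vw(1,2) ds AB(1) _ AB(3)]) (use that AB vw in auto)
      then show ?thesis using AB by blast
    qed
    show "Vs \<in> topspace (zar (sub_fspace ?X ?Z)) \<and> Ws \<in> topspace (zar (sub_fspace ?X ?Z)) \<and>
        (\<forall>U V. openin (zar (sub_fspace ?X ?Z)) U \<and> openin (zar (sub_fspace ?X ?Z)) V \<and> Vs \<in> U \<and> Ws \<in> V
          \<longrightarrow> U \<inter> V \<noteq> {})"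
      unfolding topZ by (intro conjI allI impI Z, elim conjE) (rule meet)
  next
    fix Vs Ws assume "Vs \<in> topspace (zar (sub_fspace ?X ?Z))" "Ws \<in> topspace (zar (sub_fspace ?X ?Z))"
    then have Z: "Vs \<in> ?Z" "Ws \<in> ?Z" using topZ by auto
    then obtain v w where v: "v \<in> frames scl (last ds)" "flag_of_frame scl ds v = Vs"
      and w: "w \<in> frames scl (last ds)" "flag_of_frame scl ds w = Ws"
      using flag_has_frame[OF ds] ZX by (metis subsetD)
    have iso: "v \<in> isotropic_frames (last ds)" "w \<in> isotropic_frames (last ds)"
      using isotropic_flag_of_frame[OF ds] v w Z by auto
    have "linked\<^sup>*\<^sup>* v w" by (rule isotropic_frames_chain[OF iso])
    then have "R\<^sup>*\<^sup>* (flag_of_frame scl ds v) (flag_of_frame scl ds w) \<and> w \<in> frames scl (last ds)"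
    proof induction
      case base
      then show ?case using v by simp
    next
      case (step w w')
      then have "w' \<in> frames scl (last ds)" by (auto simp: linked_def isotropic_frames_def frames_def)
      moreover have "R (flag_of_frame scl ds w) (flag_of_frame scl ds w')"
        using step by (auto simp: R_def)
      ultimately show ?case using step.IH by (meson rtranclp.rtrancl_into_rtrancl)
    qed
    then show "R\<^sup>*\<^sup>* Vs Ws" using v w by simp
  qed
  have "smooth_of_dim ?X ((?N - ?c) + ?c)"
    using smooth_of_dim_if_affine_charts[OF chartX] cN by simp
  moreover have "smooth_of_dim (sub_fspace ?X ?Z) (?N - ?c)"
    by (rule smooth_of_dim_if_affine_charts) (use chartZ topZ in blast)
  ultimately show ?thesis
    unfolding smooth_subvariety_of_codim_def using closed_isotropic_flags[OF ds] irr by blast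
qed

end

theorem proposition4p1:
  fixes scl :: "complex \<Rightarrow> 'e::ab_group_add \<Rightarrow> 'e"
    and \<omega> :: "'e \<Rightarrow> 'e \<Rightarrow> complex"
    and n :: nat and ds :: "nat list"
  assumes "vector_space scl"
    and "vector_space.dim scl (UNIV :: 'e set) = 2 * n + 1"
    and "skew_form scl \<omega>"
    and "form_rank \<omega> = 2 * n"
    and "ds \<noteq> []" and "1 \<le> hd ds" and "sorted_wrt (<) ds" and "last ds \<le> n + 1"
  shows "smooth_subvariety_of_codim (flag_variety scl ds) (isotropic_flags scl \<omega> ds)
           (last ds * (last ds - 1) div 2)"
proof -
  interpret vector_space scl by fact
  obtain B where B: "independent B" "span B = UNIV" "card B = 2 * n + 1"
    using basis_exists[of UNIV] assms(2) by (metis top.extremum_uniqueI)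
  have "finite B" by (rule card_ge_0_finite) (simp add: B(3))
  interpret skew_space scl B \<omega>
    by unfold_locales (use B assms(3) \<open>finite B\<close> in auto)
  show ?thesis
    by (rule isotropic_flags_subvariety[OF assms(4,2,7,5,8)])
qed

end
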